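(* Let $(A,B,P)$ be a c.n.u. $\mathbb E$-contraction on a Hilbert space $\mathcal H$. Let $\mathcal H_1$ be the maximal subspace of $\mathcal H$ which reduces $P$ and on which $P$ is an isometry, and let $\mathcal H_2=\mathcal H\ominus\mathcal H_1$. If either $A^*,B^*$ commute with $P$, or $\mathcal H_1$ is the maximal invariant subspace for $P$ on which $P$ is an isometry, then: (1) $\mathcal H_1,\mathcal H_2$ reduce $A$ and $B$; (2) $(A|_{\mathcal H_1},B|_{\mathcal H_1},P|_{\mathcal H_1})$ is a c.n.u. $\mathbb E$-isometry; (3) $(A|_{\mathcal H_2},B|_{\mathcal H_2},P|_{\mathcal H_2})$ is a c.n.i. $\mathbb E$-contraction. Either of $\mathcal H_1,\mathcal H_2$ may be the trivial subspace $\{0\}$.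
   Context: All operators are bounded linear operators on complex Hilbert spaces; subspaces are closed. A subspace reduces $T$ if it is invariant under $T$ and $T^*$. The tetrablock is $\mathbb E=\{(x_1,x_2,x_3)\in\mathbb C^3:1-zx_1-wx_2+zwx_3\ne0\ \ \forall z,w\in\overline{\mathbb D}\}$, and $b\mathbb E=\{(a,b,p)\in\overline{\mathbb E}:|p|=1\}$. A compact set $K\subset\mathbb C^3$ is a spectral set for a commuting triple $\underline T$ if the Taylor joint spectrum of $\underline T$ lies in $K$ and $\|f(\underline T)\|\le\sup_K|f|$ for every rational function $f$ with poles off $K$. An $\mathbb E$-contraction is a commuting triple $(A,B,P)$ having $\overline{\mathbb E}$ as a spectral set (then $P$ is a contraction). An $\mathbb E$-unitary is a commuting triple of normal operators with Taylor joint spectrum contained in $b\mathbb E$. An $\mathbb E$-isometry is the restriction of an $\mathbb E$-unitary to a joint invariant subspace. A contraction is c.n.u. (completely non-unitary) if no nonzero reducing subspace exists on which it is unitary; c.n.i. (completely non-isometry) if no nonzero reducing subspace exists on which it is an isometry. An $\mathbb E$-contraction $(A,B,P)$ is c.n.u. (resp. c.n.i.) if $P$ is a c.n.u. (resp. c.n.i.) contraction. *)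

theory Defs
  imports "HOL-Analysis.Analysis" "HOL-Library.Poly_Mapping"
begin

section \<open>Complex Hilbert spaces\<close>

text \<open>The inner product is linear in its first argument; its real part is the inner product of
  the underlying real Hilbert space, which also supplies norm and topology.\<close>

class complex_inner = real_inner +
  fixes scaleC :: "complex \<Rightarrow> 'a \<Rightarrow> 'a"  (infixr \<open>*\<^sub>C\<close> 75)
    and cinner :: "'a \<Rightarrow> 'a \<Rightarrow> complex"
  assumes scaleC_add_right: "c *\<^sub>C (x + y) = c *\<^sub>C x + c *\<^sub>C y"
    and scaleC_add_left: "(c + d) *\<^sub>C x = c *\<^sub>C x + d *\<^sub>C x"
    and scaleC_scaleC: "c *\<^sub>C d *\<^sub>C x = (c * d) *\<^sub>C x"
    and scaleC_of_real: "complex_of_real r *\<^sub>C x = r *\<^sub>R x"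
    and cinner_add_left: "cinner (x + y) z = cinner x z + cinner y z"
    and cinner_scaleC_left: "cinner (c *\<^sub>C x) y = c * cinner x y"
    and cinner_commute: "cinner x y = cnj (cinner y x)"
    and Re_cinner: "Re (cinner x y) = inner x y"

class chilbert_space = complex_inner + complete_space

lemma norm_cinner_le: "cmod (cinner x y) \<le> norm x * norm (y :: 'a::complex_inner)"
proof (cases "cinner x y = 0")
  case False
  define c where "c = cnj (cinner x y) / of_real (cmod (cinner x y))"
  have cc: "cnj (cinner x y) * cinner x y = of_real (cmod (cinner x y)) * of_real (cmod (cinner x y))"
    using complex_norm_square[of "cinner x y"] by (simp add: mult.commute power2_eq_square)
  have 1: "cinner (c *\<^sub>C x) y = of_real (cmod (cinner x y))"
    using False cc by (simp add: cinner_scaleC_left c_def)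
  have uc: "cnj c * c = 1"
    using False cc by (simp add: c_def mult.commute)
  have 2: "norm (c *\<^sub>C x) = norm x"
  proof -
    have "cinner (c *\<^sub>C x) (c *\<^sub>C x) = c * cnj (c * cinner x x)"
      by (metis cinner_scaleC_left cinner_commute)
    also have "\<dots> = cinner x x"
      using uc by (metis cinner_commute complex_cnj_mult mult.assoc mult.commute mult_1)
    finally show ?thesis
      by (metis Re_cinner norm_eq_sqrt_inner)
  qed
  have "cmod (cinner x y) = inner (c *\<^sub>C x) y"
    using 1 by (metis Re_cinner Re_complex_of_real)
  also have "\<dots> \<le> norm x * norm y"
    using norm_cauchy_schwarz[of "c *\<^sub>C x" y] 2 by simp
  finally show ?thesis .
qed simp

lemma norm_scaleC: "norm (c *\<^sub>C x) = cmod c * norm (x :: 'a::complex_inner)"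
proof -
  have "cinner (c *\<^sub>C x) (c *\<^sub>C x) = c * cnj (c * cinner x x)"
    by (metis cinner_scaleC_left cinner_commute)
  also have "\<dots> = of_real ((cmod c)\<^sup>2) * cinner x x"
    by (metis cinner_commute complex_cnj_mult complex_norm_square mult.assoc)
  finally have "inner (c *\<^sub>C x) (c *\<^sub>C x) = (cmod c)\<^sup>2 * inner x x"
    by (metis Re_cinner Re_complex_of_real times_complex.sel(1) Im_complex_of_real mult_zero_left diff_zero)
  then show ?thesis
    by (simp add: norm_eq_sqrt_inner real_sqrt_mult)
qed

section \<open>Square-summable sequences\<close>

typedef (overloaded) 'a ell2 = "{f :: nat \<Rightarrow> 'a::chilbert_space. summable (\<lambda>n. (norm (f n))\<^sup>2)}"
  morphisms ell2_nth Abs_ell2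
  by (rule exI[of _ "\<lambda>_. 0"]) simp

lemma summable_ell2: "summable (\<lambda>n. (norm (ell2_nth f n))\<^sup>2)"
  using ell2_nth[of f] by simp

lemma ell2_nth_Abs: "summable (\<lambda>n. (norm (f n))\<^sup>2) \<Longrightarrow> ell2_nth (Abs_ell2 f) = f"
  by (simp add: Abs_ell2_inverse)

lemma ell2_eqI: "(\<And>n. ell2_nth f n = ell2_nth g n) \<Longrightarrow> f = g"
  by (metis ell2_nth_inject ext)

lemma norm_add_sq_le: "(norm (x + y))\<^sup>2 \<le> 2 * (norm x)\<^sup>2 + 2 * (norm (y :: 'a::real_normed_vector))\<^sup>2"
proof -
  have "(norm (x + y))\<^sup>2 \<le> (norm x + norm y)\<^sup>2"
    by (simp add: norm_triangle_ineq power_mono)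
  also have "\<dots> \<le> 2 * (norm x)\<^sup>2 + 2 * (norm y)\<^sup>2"
    using sum_squares_bound[of "norm x" "norm y"] by (simp add: power2_sum)
  finally show ?thesis .
qed

lemma summable_sq_add:
  fixes f g :: "nat \<Rightarrow> 'a::real_normed_vector"
  assumes "summable (\<lambda>n. (norm (f n))\<^sup>2)" "summable (\<lambda>n. (norm (g n))\<^sup>2)"
  shows "summable (\<lambda>n. (norm (f n + g n))\<^sup>2)"
  by (rule summable_comparison_test'[where N = 0, OF summable_add[OF summable_mult summable_mult, OF assms]])
     (use norm_add_sq_le in auto)

lemma summable_sq_scaleC:
  "summable (\<lambda>n. (norm (f n))\<^sup>2) \<Longrightarrow> summable (\<lambda>n. (norm (c *\<^sub>C (f n :: 'a::complex_inner)))\<^sup>2)"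
  by (simp add: norm_scaleC power_mult_distrib summable_mult)

lemma summable_sq_scaleR:
  "summable (\<lambda>n. (norm (f n))\<^sup>2) \<Longrightarrow> summable (\<lambda>n. (norm (r *\<^sub>R (f n :: 'a::real_normed_vector)))\<^sup>2)"
  by (simp add: power_mult_distrib summable_mult)

lemma summable_ell2_cinner: "summable (\<lambda>n. cinner (ell2_nth f n) (ell2_nth g n))"
proof (rule summable_comparison_test'[where N = 0, OF summable_add[OF summable_ell2 summable_ell2]])
  fix n
  have "cmod (cinner (ell2_nth f n) (ell2_nth g n)) \<le> norm (ell2_nth f n) * norm (ell2_nth g n)"
    by (rule norm_cinner_le)
  also have "\<dots> \<le> (norm (ell2_nth f n))\<^sup>2 + (norm (ell2_nth g n))\<^sup>2"
    using sum_squares_bound[of "norm (ell2_nth f n)" "norm (ell2_nth g n)"]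
      mult_nonneg_nonneg[OF norm_ge_zero[of "ell2_nth f n"] norm_ge_zero[of "ell2_nth g n"]]
    by linarith
  finally show "cmod (cinner (ell2_nth f n) (ell2_nth g n)) \<le> (norm (ell2_nth f n))\<^sup>2 + (norm (ell2_nth g n))\<^sup>2" .
qed

instantiation ell2 :: (chilbert_space) complex_inner
begin

definition "0 = Abs_ell2 (\<lambda>_. 0)"
definition "f + g = Abs_ell2 (\<lambda>n. ell2_nth f n + ell2_nth g n)"
definition "- f = Abs_ell2 (\<lambda>n. - ell2_nth f n)"
definition "f - g = Abs_ell2 (\<lambda>n. ell2_nth f n - ell2_nth g n)"
definition "r *\<^sub>R f = Abs_ell2 (\<lambda>n. r *\<^sub>R ell2_nth f n)"
definition "c *\<^sub>C f = Abs_ell2 (\<lambda>n. c *\<^sub>C ell2_nth f n)"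
definition cinner_ell2 :: "'a ell2 \<Rightarrow> 'a ell2 \<Rightarrow> complex" where
  "cinner_ell2 f g = suminf (\<lambda>n. cinner (ell2_nth f n) (ell2_nth g n))"
definition inner_ell2 :: "'a ell2 \<Rightarrow> 'a ell2 \<Rightarrow> real" where
  "inner_ell2 f g = suminf (\<lambda>n. inner (ell2_nth f n) (ell2_nth g n))"
definition norm_ell2 :: "'a ell2 \<Rightarrow> real" where
  "norm_ell2 f = sqrt (inner f f)"
definition sgn_ell2 :: "'a ell2 \<Rightarrow> 'a ell2" where
  "sgn_ell2 f = inverse (norm f) *\<^sub>R f"
definition dist_ell2 :: "'a ell2 \<Rightarrow> 'a ell2 \<Rightarrow> real" where
  "dist_ell2 f g = norm (f - g)"
definition uniformity_ell2 :: "('a ell2 \<times> 'a ell2) filter" where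
  "uniformity_ell2 = (INF e\<in>{0<..}. principal {(x, y). dist x y < e})"
definition open_ell2 :: "'a ell2 set \<Rightarrow> bool" where
  "open_ell2 U = (\<forall>x\<in>U. \<forall>\<^sub>F (x', y) in uniformity. x' = x \<longrightarrow> y \<in> U)"

lemma ell2_nth_zero: "ell2_nth 0 n = (0::'a)"
  by (simp add: zero_ell2_def ell2_nth_Abs)

lemma ell2_nth_add: "ell2_nth (f + g) n = ell2_nth f n + ell2_nth (g::'a ell2) n"
  by (simp add: plus_ell2_def ell2_nth_Abs summable_sq_add summable_ell2)

lemma ell2_nth_minus: "ell2_nth (- f) n = - ell2_nth (f::'a ell2) n"
  by (simp add: uminus_ell2_def ell2_nth_Abs summable_ell2)

lemma ell2_nth_diff: "ell2_nth (f - g) n = ell2_nth f n - ell2_nth (g::'a ell2) n"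
proof -
  have "summable (\<lambda>n. (norm (ell2_nth f n - ell2_nth g n))\<^sup>2)"
    using summable_sq_add[of "ell2_nth f" "\<lambda>n. - ell2_nth g n"] by (simp add: summable_ell2)
  then show ?thesis
    by (simp add: minus_ell2_def ell2_nth_Abs)
qed

lemma ell2_nth_scaleR: "ell2_nth (r *\<^sub>R f) n = r *\<^sub>R ell2_nth (f::'a ell2) n"
  unfolding scaleR_ell2_def
  using ell2_nth_Abs[OF summable_sq_scaleR[OF summable_ell2, of r f]] by simp

lemma ell2_nth_scaleC: "ell2_nth (c *\<^sub>C f) n = c *\<^sub>C ell2_nth (f::'a ell2) n"
  unfolding scaleC_ell2_def
  using ell2_nth_Abs[OF summable_sq_scaleC[OF summable_ell2, of c f]] by simp

lemma summable_ell2_inner: "summable (\<lambda>n. inner (ell2_nth f n) (ell2_nth (g::'a ell2) n))"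
  using summable_Re[OF summable_ell2_cinner[of f g]] by (simp add: Re_cinner)

instance
proof
  fix f g h :: "'a ell2" and r s :: real and c d :: complex
  show "f + g + h = f + (g + h)" "f + g = g + f" "0 + f = f" "- f + f = 0" "f - g = f + - g"
    by (rule ell2_eqI, simp add: ell2_nth_add ell2_nth_zero ell2_nth_minus ell2_nth_diff add_ac)+
  show "r *\<^sub>R (f + g) = r *\<^sub>R f + r *\<^sub>R g" "(r + s) *\<^sub>R f = r *\<^sub>R f + s *\<^sub>R f"
    "r *\<^sub>R s *\<^sub>R f = (r * s) *\<^sub>R f" "1 *\<^sub>R f = f"
    by (rule ell2_eqI, simp add: ell2_nth_add ell2_nth_scaleR scaleR_add_right scaleR_add_left)+
  show "dist f g = norm (f - g)"
    by (rule dist_ell2_def)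
  show "sgn f = inverse (norm f) *\<^sub>R f"
    by (rule sgn_ell2_def)
  show "uniformity = (INF e\<in>{0<..}. principal {(x, y::'a ell2). dist x y < e})"
    by (rule uniformity_ell2_def)
  show "open U = (\<forall>x\<in>U. \<forall>\<^sub>F (x', y) in uniformity. x' = x \<longrightarrow> y \<in> U)" for U :: "'a ell2 set"
    by (rule open_ell2_def)
  show "inner f g = inner g f"
    by (simp add: inner_ell2_def inner_commute)
  show "inner (f + g) h = inner f h + inner g h"
    by (simp add: inner_ell2_def ell2_nth_add inner_add_left suminf_add summable_ell2_inner)
  show "inner (r *\<^sub>R f) g = r * inner f g"
    by (simp add: inner_ell2_def ell2_nth_scaleR suminf_mult summable_ell2_inner)
  show "0 \<le> inner f f"
    by (simp add: inner_ell2_def suminf_nonneg summable_ell2_inner)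
  show "(inner f f = 0) = (f = 0)"
  proof
    assume "inner f f = 0"
    then have "\<forall>n. inner (ell2_nth f n) (ell2_nth f n) = 0"
      unfolding inner_ell2_def by (subst suminf_eq_zero_iff[symmetric]) (auto simp: summable_ell2_inner)
    then show "f = 0"
      by (intro ell2_eqI) (simp add: ell2_nth_zero)
  qed (simp add: inner_ell2_def ell2_nth_zero)
  show "norm f = sqrt (inner f f)"
    by (rule norm_ell2_def)
  show "c *\<^sub>C (f + g) = c *\<^sub>C f + c *\<^sub>C g" "(c + d) *\<^sub>C f = c *\<^sub>C f + d *\<^sub>C f"
    "c *\<^sub>C d *\<^sub>C f = (c * d) *\<^sub>C f" "complex_of_real r *\<^sub>C f = r *\<^sub>R f"
    by (rule ell2_eqI, simp add: ell2_nth_add ell2_nth_scaleC ell2_nth_scaleR scaleC_add_right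
        scaleC_add_left scaleC_scaleC scaleC_of_real)+
  show "cinner (f + g) h = cinner f h + cinner g h"
    by (simp add: cinner_ell2_def ell2_nth_add cinner_add_left suminf_add summable_ell2_cinner)
  show "cinner (c *\<^sub>C f) g = c * cinner f g"
    by (simp add: cinner_ell2_def ell2_nth_scaleC cinner_scaleC_left suminf_mult summable_ell2_cinner)
  have "(\<lambda>n. cnj (cinner (ell2_nth g n) (ell2_nth f n))) sums cnj (cinner g f)"
    unfolding cinner_ell2_def sums_cnj using summable_ell2_cinner by (rule summable_sums)
  moreover have "(\<lambda>n. cnj (cinner (ell2_nth g n) (ell2_nth f n))) = (\<lambda>n. cinner (ell2_nth f n) (ell2_nth g n))"
    using cinner_commute by metis
  ultimately show "cinner f g = cnj (cinner g f)"
    using sums_unique unfolding cinner_ell2_def by metis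
  have "(\<lambda>n. Re (cinner (ell2_nth f n) (ell2_nth g n))) sums Re (cinner f g)"
    unfolding cinner_ell2_def using summable_ell2_cinner by (intro sums_Re summable_sums)
  then show "Re (cinner f g) = inner f g"
    unfolding Re_cinner inner_ell2_def by (rule sums_unique)
qed

end

lemma norm_ell2_sq: "(norm f)\<^sup>2 = suminf (\<lambda>n. (norm (ell2_nth f n))\<^sup>2)"
  by (simp add: power2_norm_eq_inner inner_ell2_def)

instance ell2 :: (chilbert_space) chilbert_space
proof
  fix X :: "nat \<Rightarrow> 'a ell2"
  assume X: "Cauchy X"
  have part: "(\<Sum>n<L. (norm (ell2_nth f n))\<^sup>2) \<le> (norm f)\<^sup>2" for f :: "'a ell2" and L
    unfolding norm_ell2_sq by (intro sum_le_suminf summable_ell2) auto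
  have coord: "norm (ell2_nth f n) \<le> norm f" for f :: "'a ell2" and n
  proof -
    have "(norm (ell2_nth f n))\<^sup>2 \<le> (\<Sum>k<Suc n. (norm (ell2_nth f k))\<^sup>2)"
      by (simp add: sum_nonneg)
    also have "\<dots> \<le> (norm f)\<^sup>2" by (rule part)
    finally show ?thesis by (rule power2_le_imp_le) simp
  qed
  have "Cauchy (\<lambda>k. ell2_nth (X k) n)" for n
  proof (rule metric_CauchyI)
    fix e :: real assume "0 < e"
    then obtain M where M: "\<forall>m\<ge>M. \<forall>k\<ge>M. dist (X m) (X k) < e"
      using metric_CauchyD[OF X] by blast
    have "dist (ell2_nth (X m) n) (ell2_nth (X k) n) \<le> dist (X m) (X k)" for m k
      using coord[of "X m - X k" n] by (simp add: dist_norm ell2_nth_diff)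
    with M show "\<exists>M. \<forall>m\<ge>M. \<forall>k\<ge>M. dist (ell2_nth (X m) n) (ell2_nth (X k) n) < e"
      by (meson le_less_trans)
  qed
  then have "\<forall>n. \<exists>l. (\<lambda>k. ell2_nth (X k) n) \<longlonglongrightarrow> l"
    using Cauchy_convergent convergent_def by blast
  then obtain g where g: "\<And>n. (\<lambda>k. ell2_nth (X k) n) \<longlonglongrightarrow> g n"
    by metis
  have key: "\<exists>N. \<forall>m\<ge>N. \<forall>L. (\<Sum>n<L. (norm (ell2_nth (X m) n - g n))\<^sup>2) \<le> e\<^sup>2" if "0 < e" for e :: real
  proof -
    obtain N where N: "\<forall>m\<ge>N. \<forall>k\<ge>N. dist (X m) (X k) < e"
      using metric_CauchyD[OF X \<open>0 < e\<close>] by blast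
    have "(\<Sum>n<L. (norm (ell2_nth (X m) n - g n))\<^sup>2) \<le> e\<^sup>2" if "m \<ge> N" for m L
    proof (rule LIMSEQ_le_const2)
      show "(\<lambda>k. \<Sum>n<L. (norm (ell2_nth (X m) n - ell2_nth (X k) n))\<^sup>2)
          \<longlonglongrightarrow> (\<Sum>n<L. (norm (ell2_nth (X m) n - g n))\<^sup>2)"
        by (intro tendsto_intros g)
      have "(\<Sum>n<L. (norm (ell2_nth (X m) n - ell2_nth (X k) n))\<^sup>2) \<le> e\<^sup>2" if "k \<ge> N" for k
      proof -
        have "(\<Sum>n<L. (norm (ell2_nth (X m) n - ell2_nth (X k) n))\<^sup>2) \<le> (norm (X m - X k))\<^sup>2"
          using part[of "X m - X k" L] by (simp add: ell2_nth_diff)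
        also have "\<dots> \<le> e\<^sup>2"
          using N \<open>m \<ge> N\<close> that by (intro power_mono) (auto simp: dist_norm less_imp_le)
        finally show ?thesis .
      qed
      then show "\<exists>N. \<forall>k\<ge>N. (\<Sum>n<L. (norm (ell2_nth (X m) n - ell2_nth (X k) n))\<^sup>2) \<le> e\<^sup>2"
        by blast
    qed
    then show ?thesis by blast
  qed
  have summ: "summable (\<lambda>n. (norm (h n))\<^sup>2)"
    if "\<And>L. (\<Sum>n<L. (norm (h n))\<^sup>2) \<le> e" for h :: "nat \<Rightarrow> 'a" and e
    by (rule summableI_nonneg_bounded[of _ e]) (use that in auto)
  obtain N1 where N1: "\<And>L. (\<Sum>n<L. (norm (ell2_nth (X N1) n - g n))\<^sup>2) \<le> 1\<^sup>2"
    using key[of 1] by auto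
  have "summable (\<lambda>n. (norm (ell2_nth (X N1) n + - (ell2_nth (X N1) n - g n)))\<^sup>2)"
    by (intro summable_sq_add summable_ell2) (use summ[OF N1] in \<open>simp add: norm_minus_commute\<close>)
  then have gl: "ell2_nth (Abs_ell2 g) = g"
    by (simp add: ell2_nth_Abs)
  have "X \<longlonglongrightarrow> Abs_ell2 g"
  proof (rule metric_LIMSEQ_I)
    fix e :: real assume "0 < e"
    then obtain N where N: "\<And>m L. m \<ge> N \<Longrightarrow> (\<Sum>n<L. (norm (ell2_nth (X m) n - g n))\<^sup>2) \<le> (e/2)\<^sup>2"
      using key[of "e/2"] by auto
    have "dist (X m) (Abs_ell2 g) < e" if "m \<ge> N" for m
    proof -
      have "(norm (X m - Abs_ell2 g))\<^sup>2 \<le> (e/2)\<^sup>2"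
        unfolding norm_ell2_sq ell2_nth_diff gl
        using N[OF that] by (intro suminf_le_const summ) auto
      then have "norm (X m - Abs_ell2 g) \<le> e/2"
        by (rule power2_le_imp_le) (use \<open>0 < e\<close> in simp)
      then show ?thesis using \<open>0 < e\<close> by (simp add: dist_norm)
    qed
    then show "\<exists>N. \<forall>m\<ge>N. dist (X m) (Abs_ell2 g) < e" by blast
  qed
  then show "convergent X" by (rule convergentI)
qed

section \<open>Operators on closed subspaces\<close>

text \<open>A Hilbert space is a closed complex subspace \<open>M\<close> of a type of class \<^class>\<open>chilbert_space\<close>
  (possibly \<open>UNIV\<close>), and an operator on \<open>M\<close> is a function of which only the values on \<open>M\<close>
  matter. The restriction of \<open>T\<close> to a subspace \<open>N\<close> is thus \<open>T\<close> itself, regarded as an operator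
  on \<open>N\<close>.\<close>

definition closed_csubspace :: "'a::chilbert_space set \<Rightarrow> bool" where
  "closed_csubspace M \<longleftrightarrow>
    0 \<in> M \<and> (\<forall>x\<in>M. \<forall>y\<in>M. x + y \<in> M) \<and> (\<forall>c. \<forall>x\<in>M. c *\<^sub>C x \<in> M) \<and> closed M"

definition clinear_on :: "'a::chilbert_space set \<Rightarrow> ('a \<Rightarrow> 'b::chilbert_space) \<Rightarrow> bool" where
  "clinear_on M T \<longleftrightarrow>
    (\<forall>x\<in>M. \<forall>y\<in>M. T (x + y) = T x + T y) \<and> (\<forall>c. \<forall>x\<in>M. T (c *\<^sub>C x) = c *\<^sub>C T x)"

definition operator_on :: "'a::chilbert_space set \<Rightarrow> ('a \<Rightarrow> 'a) \<Rightarrow> bool" where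
  "operator_on M T \<longleftrightarrow>
    clinear_on M T \<and> T ` M \<subseteq> M \<and> (\<exists>c. \<forall>x\<in>M. norm (T x) \<le> c * norm x)"

definition adjoint_on :: "'a::chilbert_space set \<Rightarrow> ('a \<Rightarrow> 'a) \<Rightarrow> 'a \<Rightarrow> 'a" where
  "adjoint_on M T y = (THE z. z \<in> M \<and> (\<forall>x\<in>M. cinner (T x) y = cinner x z))"

definition commute_on :: "'a set \<Rightarrow> ('a \<Rightarrow> 'a) \<Rightarrow> ('a \<Rightarrow> 'a) \<Rightarrow> bool" where
  "commute_on M S T \<longleftrightarrow> (\<forall>x\<in>M. S (T x) = T (S x))"

definition normal_on :: "'a::chilbert_space set \<Rightarrow> ('a \<Rightarrow> 'a) \<Rightarrow> bool" where
  "normal_on M T \<longleftrightarrow> operator_on M T \<and> commute_on M (adjoint_on M T) T"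

definition isometry_on :: "'a::chilbert_space set \<Rightarrow> ('a \<Rightarrow> 'b::chilbert_space) \<Rightarrow> bool" where
  "isometry_on M T \<longleftrightarrow> clinear_on M T \<and> (\<forall>x\<in>M. norm (T x) = norm x)"

definition unitary_on :: "'a::chilbert_space set \<Rightarrow> ('a \<Rightarrow> 'a) \<Rightarrow> bool" where
  "unitary_on M T \<longleftrightarrow> isometry_on M T \<and> T ` M = M"

definition contraction_on :: "'a::chilbert_space set \<Rightarrow> ('a \<Rightarrow> 'a) \<Rightarrow> bool" where
  "contraction_on M T \<longleftrightarrow> operator_on M T \<and> (\<forall>x\<in>M. norm (T x) \<le> norm x)"

definition invariant_subspace :: "'a::chilbert_space set \<Rightarrow> ('a \<Rightarrow> 'a) \<Rightarrow> 'a set \<Rightarrow> bool" where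
  "invariant_subspace M T N \<longleftrightarrow> closed_csubspace N \<and> N \<subseteq> M \<and> T ` N \<subseteq> N"

definition reducing_subspace :: "'a::chilbert_space set \<Rightarrow> ('a \<Rightarrow> 'a) \<Rightarrow> 'a set \<Rightarrow> bool" where
  "reducing_subspace M T N \<longleftrightarrow>
    invariant_subspace M T N \<and> invariant_subspace M (adjoint_on M T) N"

definition orth_diff :: "'a::chilbert_space set \<Rightarrow> 'a set \<Rightarrow> 'a set"  (infixl \<open>\<ominus>\<close> 65) where
  "M \<ominus> N = {x \<in> M. \<forall>y\<in>N. cinner x y = 0}"

definition largest :: "('a set \<Rightarrow> bool) \<Rightarrow> 'a set \<Rightarrow> bool" where
  "largest Q M \<longleftrightarrow> Q M \<and> (\<forall>N. Q N \<longrightarrow> N \<subseteq> M)"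

definition cnu :: "'a::chilbert_space set \<Rightarrow> ('a \<Rightarrow> 'a) \<Rightarrow> bool" where
  "cnu M T \<longleftrightarrow> contraction_on M T \<and>
    \<not> (\<exists>N. N \<noteq> {0} \<and> reducing_subspace M T N \<and> unitary_on N T)"

definition cni :: "'a::chilbert_space set \<Rightarrow> ('a \<Rightarrow> 'a) \<Rightarrow> bool" where
  "cni M T \<longleftrightarrow> contraction_on M T \<and>
    \<not> (\<exists>N. N \<noteq> {0} \<and> reducing_subspace M T N \<and> isometry_on N T)"

definition commuting_triple ::
  "'a::chilbert_space set \<Rightarrow> ('a \<Rightarrow> 'a) \<Rightarrow> ('a \<Rightarrow> 'a) \<Rightarrow> ('a \<Rightarrow> 'a) \<Rightarrow> bool" where
  "commuting_triple M A B P \<longleftrightarrow>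
    operator_on M A \<and> operator_on M B \<and> operator_on M P \<and>
    commute_on M A B \<and> commute_on M A P \<and> commute_on M B P"

section \<open>Taylor joint spectrum\<close>

text \<open>The Koszul complex \<open>0 \<rightarrow> M \<rightarrow> M\<^sup>3 \<rightarrow> M\<^sup>3 \<rightarrow> M \<rightarrow> 0\<close>, where the two middle terms have the
  coordinates \<open>e\<^sub>1, e\<^sub>2, e\<^sub>3\<close> and \<open>e\<^sub>1 \<and> e\<^sub>2, e\<^sub>1 \<and> e\<^sub>3, e\<^sub>2 \<and> e\<^sub>3\<close>.\<close>

definition koszul0 ::
  "('a \<Rightarrow> 'a) \<Rightarrow> ('a \<Rightarrow> 'a) \<Rightarrow> ('a \<Rightarrow> 'a) \<Rightarrow> 'a::chilbert_space \<Rightarrow> 'a \<times> 'a \<times> 'a" where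
  "koszul0 A B P x = (A x, B x, P x)"

definition koszul1 ::
  "('a \<Rightarrow> 'a) \<Rightarrow> ('a \<Rightarrow> 'a) \<Rightarrow> ('a \<Rightarrow> 'a) \<Rightarrow> 'a::chilbert_space \<times> 'a \<times> 'a \<Rightarrow> 'a \<times> 'a \<times> 'a" where
  "koszul1 A B P = (\<lambda>(x1, x2, x3). (A x2 - B x1, A x3 - P x1, B x3 - P x2))"

definition koszul2 ::
  "('a \<Rightarrow> 'a) \<Rightarrow> ('a \<Rightarrow> 'a) \<Rightarrow> ('a \<Rightarrow> 'a) \<Rightarrow> 'a::chilbert_space \<times> 'a \<times> 'a \<Rightarrow> 'a" where
  "koszul2 A B P = (\<lambda>(y12, y13, y23). A y23 - B y13 + P y12)"

definition koszul_exact ::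
  "'a::chilbert_space set \<Rightarrow> ('a \<Rightarrow> 'a) \<Rightarrow> ('a \<Rightarrow> 'a) \<Rightarrow> ('a \<Rightarrow> 'a) \<Rightarrow> bool" where
  "koszul_exact M A B P \<longleftrightarrow>
    {x \<in> M. koszul0 A B P x = 0} = {0} \<and>
    {v \<in> M \<times> M \<times> M. koszul1 A B P v = 0} = koszul0 A B P ` M \<and>
    {v \<in> M \<times> M \<times> M. koszul2 A B P v = 0} = koszul1 A B P ` (M \<times> M \<times> M) \<and>
    M = koszul2 A B P ` (M \<times> M \<times> M)"

definition taylor_spectrum ::
  "'a::chilbert_space set \<Rightarrow> ('a \<Rightarrow> 'a) \<Rightarrow> ('a \<Rightarrow> 'a) \<Rightarrow> ('a \<Rightarrow> 'a) \<Rightarrow> (complex \<times> complex \<times> complex) set"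
  where
  "taylor_spectrum M A B P =
    {(a, b, p). \<not> koszul_exact M (\<lambda>x. A x - a *\<^sub>C x) (\<lambda>x. B x - b *\<^sub>C x) (\<lambda>x. P x - p *\<^sub>C x)}"

section \<open>Spectral sets\<close>

text \<open>Polynomials in three variables, given by their coefficients.\<close>

type_synonym poly3 = "(nat \<times> nat \<times> nat) \<Rightarrow>\<^sub>0 complex"

definition poly3_eval :: "poly3 \<Rightarrow> complex \<times> complex \<times> complex \<Rightarrow> complex" where
  "poly3_eval q = (\<lambda>(z1, z2, z3). \<Sum>(i, j, k)\<in>Poly_Mapping.keys q.
    Poly_Mapping.lookup q (i, j, k) * z1 ^ i * z2 ^ j * z3 ^ k)"

definition poly3_op ::
  "poly3 \<Rightarrow> ('a \<Rightarrow> 'a) \<Rightarrow> ('a \<Rightarrow> 'a) \<Rightarrow> ('a \<Rightarrow> 'a) \<Rightarrow> 'a::chilbert_space \<Rightarrow> 'a" where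
  "poly3_op q A B P x = (\<Sum>(i, j, k)\<in>Poly_Mapping.keys q.
    Poly_Mapping.lookup q (i, j, k) *\<^sub>C (A ^^ i) ((B ^^ j) ((P ^^ k) x)))"

text \<open>The rational function \<open>r / q\<close> with poles off \<open>K\<close> acts as \<open>r(A,B,P) q(A,B,P)\<^sup>-\<^sup>1\<close>.
  The bijectivity clause says that this is defined; by the spectral mapping theorem it
  already follows from the inclusion of the joint spectrum in \<open>K\<close>.\<close>

definition spectral_set ::
  "(complex \<times> complex \<times> complex) set \<Rightarrow>
    'a::chilbert_space set \<Rightarrow> ('a \<Rightarrow> 'a) \<Rightarrow> ('a \<Rightarrow> 'a) \<Rightarrow> ('a \<Rightarrow> 'a) \<Rightarrow> bool" where
  "spectral_set K M A B P \<longleftrightarrow>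
    compact K \<and> taylor_spectrum M A B P \<subseteq> K \<and>
    (\<forall>r q. (\<forall>z\<in>K. poly3_eval q z \<noteq> 0) \<longrightarrow>
      bij_betw (poly3_op q A B P) M M \<and>
      (\<forall>x\<in>M. norm (poly3_op r A B P (inv_into M (poly3_op q A B P) x))
        \<le> (SUP z\<in>K. cmod (poly3_eval r z / poly3_eval q z)) * norm x))"

section \<open>The tetrablock\<close>

definition tetrablock :: "(complex \<times> complex \<times> complex) set" where
  "tetrablock = {(x1, x2, x3). \<forall>z\<in>cball 0 1. \<forall>w\<in>cball 0 1. 1 - z * x1 - w * x2 + z * w * x3 \<noteq> 0}"

definition b_tetrablock :: "(complex \<times> complex \<times> complex) set" where
  "b_tetrablock = {(a, b, p). (a, b, p) \<in> closure tetrablock \<and> cmod p = 1}"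

definition E_contraction ::
  "'a::chilbert_space set \<Rightarrow> ('a \<Rightarrow> 'a) \<Rightarrow> ('a \<Rightarrow> 'a) \<Rightarrow> ('a \<Rightarrow> 'a) \<Rightarrow> bool" where
  "E_contraction M A B P \<longleftrightarrow>
    commuting_triple M A B P \<and> spectral_set (closure tetrablock) M A B P"

definition E_unitary ::
  "'a::chilbert_space set \<Rightarrow> ('a \<Rightarrow> 'a) \<Rightarrow> ('a \<Rightarrow> 'a) \<Rightarrow> ('a \<Rightarrow> 'a) \<Rightarrow> bool" where
  "E_unitary M A B P \<longleftrightarrow>
    commuting_triple M A B P \<and> normal_on M A \<and> normal_on M B \<and> normal_on M P \<and>
    taylor_spectrum M A B P \<subseteq> b_tetrablock"

text \<open>An E-isometry on \<open>M\<close> is, up to an isometric embedding \<open>V\<close> of \<open>M\<close>, the restriction of an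
  E-unitary on some Hilbert space \<open>K\<close> to the joint invariant subspace \<open>V ` M\<close>. HOL cannot
  quantify over the type of \<open>K\<close>; closed subspaces of the space of square-summable sequences in
  the ambient space of \<open>M\<close> suffice. Indeed, given any E-unitary extension, its third component
  \<open>P'\<close> is unitary, and the closed span of the spaces \<open>P'\<^sup>-\<^sup>n M\<close> reduces the extension to an
  E-unitary extension on a space of Hilbert dimension at most \<open>\<aleph>\<^sub>0 \<cdot> dim M\<close>.\<close>

definition E_isometry ::
  "'a::chilbert_space set \<Rightarrow> ('a \<Rightarrow> 'a) \<Rightarrow> ('a \<Rightarrow> 'a) \<Rightarrow> ('a \<Rightarrow> 'a) \<Rightarrow> bool" where
  "E_isometry M A B P \<longleftrightarrow> operator_on M A \<and> operator_on M B \<and> operator_on M P \<and>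
    (\<exists>(K :: 'a ell2 set) A' B' P' V.
      closed_csubspace K \<and> E_unitary K A' B' P' \<and> isometry_on M V \<and> V ` M \<subseteq> K \<and>
      (\<forall>x\<in>M. A' (V x) = V (A x) \<and> B' (V x) = V (B x) \<and> P' (V x) = V (P x)))"

end

theory Submission
  imports Defs
begin

text \<open>
  For \<open>\<bar>z\<bar> < 1\<close> the functions \<open>(x\<^sub>1 - z x\<^sub>3) / (1 - z x\<^sub>2)\<close> and \<open>(x\<^sub>2 - z x\<^sub>3) / (1 - z x\<^sub>1)\<close> are
  bounded by one on the closed tetrablock. The von Neumann inequalities for them add up to \<open>\<bar>\<langle>(A -
  B\<^sup>* P) x, x\<rangle>\<bar> \<le> \<parallel>x\<parallel>\<^sup>2 - \<parallel>P x\<parallel>\<^sup>2\<close>, and polarisation at a vector \<open>h\<close> with \<open>\<parallel>P h\<parallel> = \<parallel>h\<parallel>\<close> yields \<open>A h =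
  B\<^sup>* P h\<close> and \<open>A\<^sup>* h = P\<^sup>* B h\<close>, together with the same relations for \<open>A\<close> and \<open>B\<close> exchanged
  (\<open>fundamental_equations\<close>). They hold on \<open>H1\<close> and carry the rest of the argument.

  \<^emph>\<open>Reduction.\<close> If \<open>A\<^sup>*\<close> and \<open>B\<^sup>*\<close> commute with \<open>P\<close>, then \<open>A\<close>, \<open>B\<close> and their adjoints commute with
  \<open>P\<close> and \<open>P\<^sup>*\<close>, and the closures of the images of \<open>H1\<close> under these operators reduce \<open>P\<close> to
  isometries; by maximality they lie in \<open>H1\<close>. If \<open>H1\<close> is maximal among invariant subspaces, the
  relations show that \<open>P\<^sup>* P\<close> fixes \<open>A h\<close> and \<open>B h\<close> for \<open>h \<in> H1\<close>, so the closures of \<open>A H1\<close> and \<open>B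
  H1\<close> are invariant subspaces on which \<open>P\<close> is isometric and again lie in \<open>H1\<close>; and \<open>A\<^sup>* h = P\<^sup>* B h\<close>
  then gives invariance under the adjoints.

  \<^emph>\<open>The isometric part.\<close> Let \<open>U\<close> be the minimal unitary extension of the isometry \<open>P\<close> on \<open>H1\<close>,
  realised on \<open>H1 \<oplus> E \<oplus> E \<oplus> \<dots>\<close> with \<open>E = H1 \<ominus> P H1\<close>. The operators \<open>A\<close> and \<open>B\<close> extend to operators
  commuting with \<open>U\<close>, given by block matrices with two nonzero diagonals, and the extensions still
  satisfy \<open>A = B\<^sup>* U\<close> and \<open>B = A\<^sup>* U\<close> (\<open>isometric_triple\<close>). These relations make the extended triple
  normal and force, as \<open>B\<close> is contractive, its joint approximate eigenvalues into \<open>{(b\<^sup>* p, b, p) |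
  \<bar>p\<bar> = 1, \<bar>b\<bar> \<le> 1}\<close>, a subset of the distinguished boundary (\<open>E_unitary_criterion\<close>). For
  commuting normal operators the Taylor spectrum consists of such eigenvalues: when the operators
  are jointly bounded below, \<open>\<Sum> T\<^sub>i\<^sup>* T\<^sub>i\<close> is invertible and its inverse provides a contracting
  homotopy of the Koszul complex (\<open>koszul_exact_of_homotopy\<close>).

  \<^emph>\<open>The complement.\<close> The projection onto \<open>H2\<close> commutes with the triple, so the Koszul complexes and
  the rational functional calculus restrict to \<open>H2\<close> (\<open>spectral_set_reduce\<close>). A subspace of \<open>H2\<close>
  reducing \<open>P\<close> to an isometry is contained in \<open>H1\<close> by maximality and hence is trivial.
\<close>

section \<open>Hilbert space basics\<close>

lemma cinner_add_right: "cinner x (y + z) = cinner x y + cinner x (z :: 'a::complex_inner)"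
  by (metis cinner_add_left cinner_commute complex_cnj_add)

lemma cinner_scaleC_right: "cinner x (c *\<^sub>C y) = cnj c * cinner x (y :: 'a::complex_inner)"
  by (metis cinner_scaleC_left cinner_commute complex_cnj_mult)

lemma scaleC_one: "1 *\<^sub>C x = (x :: 'a::complex_inner)"
  using scaleC_of_real[of 1 x] by simp

lemma scaleC_zero_left: "0 *\<^sub>C x = (0 :: 'a::complex_inner)"
  using scaleC_of_real[of 0 x] by simp

lemma scaleC_minus_one: "(-1) *\<^sub>C x = - (x :: 'a::complex_inner)"
  using scaleC_of_real[of "-1" x] by simp

lemma scaleC_zero_right: "c *\<^sub>C 0 = (0 :: 'a::complex_inner)"
  by (metis norm_eq_zero norm_scaleC mult_zero_right)

lemma scaleC_minus_right: "c *\<^sub>C (- x) = - (c *\<^sub>C x :: 'a::complex_inner)"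
  by (metis scaleC_minus_one scaleC_scaleC mult.commute)

lemma scaleC_minus_left: "(- c) *\<^sub>C x = - (c *\<^sub>C x :: 'a::complex_inner)"
  by (metis scaleC_minus_one scaleC_scaleC mult_minus1)

lemma scaleC_diff_right: "c *\<^sub>C (x - y) = c *\<^sub>C x - c *\<^sub>C (y :: 'a::complex_inner)"
  by (metis scaleC_add_right scaleC_minus_right diff_conv_add_uminus)

lemma scaleC_diff_left: "(c - d) *\<^sub>C x = c *\<^sub>C x - d *\<^sub>C (x :: 'a::complex_inner)"
  by (metis scaleC_add_left scaleC_minus_left diff_conv_add_uminus)

lemma cinner_zero_left [simp]: "cinner 0 (x :: 'a::complex_inner) = 0"
  by (metis cinner_scaleC_left mult_zero_left scaleC_zero_left)

lemma cinner_zero_right [simp]: "cinner x (0 :: 'a::complex_inner) = 0"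
  by (metis cinner_commute cinner_zero_left complex_cnj_zero)

lemma cinner_minus_left: "cinner (- x) y = - cinner x (y :: 'a::complex_inner)"
  by (metis cinner_scaleC_left mult_minus1 scaleC_minus_one)

lemma cinner_minus_right: "cinner x (- y) = - cinner x (y :: 'a::complex_inner)"
  by (metis cinner_commute cinner_minus_left complex_cnj_minus)

lemma cinner_diff_left: "cinner (x - y) z = cinner x z - cinner y (z :: 'a::complex_inner)"
  by (metis cinner_add_left cinner_minus_left diff_conv_add_uminus)

lemma cinner_diff_right: "cinner x (y - z) = cinner x y - cinner x (z :: 'a::complex_inner)"
  by (metis cinner_add_right cinner_minus_right diff_conv_add_uminus)

lemmas cinner_simps = cinner_add_left cinner_add_right cinner_diff_left cinner_diff_right
  cinner_scaleC_left cinner_scaleC_right cinner_minus_left cinner_minus_right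

lemma cinner_self: "cinner x x = complex_of_real ((norm (x :: 'a::complex_inner))\<^sup>2)"
proof (rule complex_eqI)
  have "Im (cinner x x) = - Im (cinner x x)"
    using cinner_commute[of x x] by (metis cnj.simps(2))
  then show "Im (cinner x x) = Im (complex_of_real ((norm x)\<^sup>2))" by simp
qed (simp add: Re_cinner power2_norm_eq_inner)

lemma cinner_self_eq_0: "cinner x x = 0 \<longleftrightarrow> x = (0 :: 'a::complex_inner)"
  by (simp add: cinner_self)

lemma norm_diff_sq:
  "(norm (x - y))\<^sup>2 = (norm x)\<^sup>2 + (norm y)\<^sup>2 - 2 * Re (cinner x (y :: 'a::complex_inner))"
  by (simp add: Re_cinner power2_norm_eq_inner inner_diff_left inner_diff_right inner_commute)

lemma norm_plus_sq:
  "(norm (x + y))\<^sup>2 = (norm x)\<^sup>2 + (norm y)\<^sup>2 + 2 * Re (cinner x (y :: 'a::complex_inner))"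
  by (simp add: Re_cinner power2_norm_eq_inner inner_add_left inner_add_right inner_commute)

lemma Re_unimodular_le_zero:
  assumes "\<And>v. cmod v = 1 \<Longrightarrow> Re (v * a) \<le> 0"
  shows "a = 0"
proof -
  have "Re a \<le> 0" "- Re a \<le> 0" "- Im a \<le> 0" "Im a \<le> 0"
    using assms[of 1] assms[of "-1"] assms[of "\<i>"] assms[of "-\<i>"] by simp_all
  then show ?thesis by (simp add: complex_eq_iff)
qed

lemma cinner_eqI:
  fixes y z :: "'a::complex_inner"
  assumes "\<And>x. cinner x y = cinner x z"
  shows "y = z"
proof -
  have "cinner (y - z) (y - z) = 0" using assms[of "y - z"] by (simp add: cinner_diff_right)
  then show ?thesis by (simp add: cinner_self_eq_0)
qed

lemma tendsto_scaleC:
  fixes x :: "'a::complex_inner"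
  assumes "(f \<longlongrightarrow> x) F" shows "((\<lambda>n. c *\<^sub>C f n) \<longlongrightarrow> c *\<^sub>C x) F"
proof (rule LIM_zero_cancel, rule Lim_null_comparison)
  show "\<forall>\<^sub>F n in F. norm (c *\<^sub>C f n - c *\<^sub>C x) \<le> cmod c * norm (f n - x)"
    by (simp add: norm_scaleC scaleC_diff_right[symmetric])
  show "((\<lambda>n. cmod c * norm (f n - x)) \<longlongrightarrow> 0) F"
    using assms by (intro tendsto_mult_right_zero tendsto_norm_zero LIM_zero)
qed

lemma tendsto_cinner_left:
  fixes x y :: "'a::complex_inner"
  assumes "(f \<longlongrightarrow> x) F" shows "((\<lambda>n. cinner (f n) y) \<longlongrightarrow> cinner x y) F"
proof (rule LIM_zero_cancel, rule Lim_null_comparison)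
  show "\<forall>\<^sub>F n in F. norm (cinner (f n) y - cinner x y) \<le> norm (f n - x) * norm y"
    by (simp add: cinner_diff_left[symmetric] norm_cinner_le)
  show "((\<lambda>n. norm (f n - x) * norm y) \<longlongrightarrow> 0) F"
    using assms by (intro tendsto_mult_left_zero tendsto_norm_zero LIM_zero)
qed

subsection \<open>Closed subspaces and the Riesz representation\<close>

lemma csub_zero: "closed_csubspace M \<Longrightarrow> 0 \<in> M"
  and csub_add: "closed_csubspace M \<Longrightarrow> x \<in> M \<Longrightarrow> y \<in> M \<Longrightarrow> x + y \<in> M"
  and csub_scaleC: "closed_csubspace M \<Longrightarrow> x \<in> M \<Longrightarrow> c *\<^sub>C x \<in> M"
  and csub_closed: "closed_csubspace M \<Longrightarrow> closed M"
  by (auto simp: closed_csubspace_def)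

lemma csub_minus: "closed_csubspace M \<Longrightarrow> x \<in> M \<Longrightarrow> - x \<in> M"
  by (metis csub_scaleC scaleC_minus_one)

lemma csub_diff: "closed_csubspace M \<Longrightarrow> x \<in> M \<Longrightarrow> y \<in> M \<Longrightarrow> x - y \<in> M"
  by (metis csub_add csub_minus diff_conv_add_uminus)

lemma csub_scaleR: "closed_csubspace M \<Longrightarrow> x \<in> M \<Longrightarrow> r *\<^sub>R x \<in> M"
  by (metis csub_scaleC scaleC_of_real)

lemma csub_UNIV: "closed_csubspace UNIV"
  by (simp add: closed_csubspace_def)

text \<open>The representing vector minimises \<open>J x = \<parallel>x\<parallel>\<^sup>2 - 2 Re (f x)\<close> on \<open>M\<close>: by the parallelogram law
  every minimising sequence is Cauchy, and at the minimum the derivative of \<open>J\<close> vanishes in every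
  direction of \<open>M\<close>.\<close>

lemma riesz_representation:
  fixes M :: "'a::chilbert_space set" and f :: "'a \<Rightarrow> complex"
  assumes M: "closed_csubspace M"
    and add: "\<And>x y. x \<in> M \<Longrightarrow> y \<in> M \<Longrightarrow> f (x + y) = f x + f y"
    and scale: "\<And>c x. x \<in> M \<Longrightarrow> f (c *\<^sub>C x) = c * f x"
    and bdd: "\<And>x. x \<in> M \<Longrightarrow> cmod (f x) \<le> C * norm x"
  shows "\<exists>z\<in>M. \<forall>x\<in>M. f x = cinner x z"
proof -
  define J where "J x = (norm x)\<^sup>2 - 2 * Re (f x)" for x
  have J_lower: "- C\<^sup>2 \<le> J x" if "x \<in> M" for x
  proof -
    have "Re (f x) \<le> C * norm x"
      using bdd[OF that] complex_Re_le_cmod[of "f x"] by linarith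
    moreover have "0 \<le> (norm x - C)\<^sup>2" by simp
    ultimately show ?thesis by (simp add: J_def power2_diff algebra_simps)
  qed
  define m where "m = (INF x\<in>M. J x)"
  have bb: "bdd_below (J ` M)" using J_lower by (intro bdd_belowI[of _ "- C\<^sup>2"]) auto
  have m_le: "m \<le> J x" if "x \<in> M" for x unfolding m_def using bb that by (rule cINF_lower)
  have "\<exists>x\<in>M. J x < m + 1 / real (Suc n)" for n
  proof -
    have "(INF x\<in>M. J x) < m + 1 / real (Suc n)" by (simp add: m_def)
    then show ?thesis using cINF_less_iff[OF _ bb] csub_zero[OF M] by blast
  qed
  then obtain X where X: "\<And>n. X n \<in> M" "\<And>n. J (X n) < m + 1 / real (Suc n)" by metis
  have par: "(norm (x - y))\<^sup>2 \<le> 2 * (J x + J y - 2 * m)" if xy: "x \<in> M" "y \<in> M" for x y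
  proof -
    define h where "h = (1/2) *\<^sub>R (x + y)"
    have hM: "h \<in> M" unfolding h_def using M xy by (intro csub_scaleR csub_add)
    have fh: "f h = (1/2) * (f x + f y)"
      using scale[OF csub_add[OF M xy], of "complex_of_real (1/2)"] add[OF xy]
      unfolding h_def by (simp only: scaleC_of_real) simp
    have rh: "Re (f h) = (Re (f x) + Re (f y)) / 2" unfolding fh by simp
    have nh: "norm h = norm (x + y) / 2" unfolding h_def norm_scaleR by simp
    have "J h = (norm (x + y))\<^sup>2 / 4 - (Re (f x) + Re (f y))"
      unfolding J_def rh nh by (simp add: power_divide field_simps)
    moreover have "(norm (x + y))\<^sup>2 + (norm (x - y))\<^sup>2 = 2 * (norm x)\<^sup>2 + 2 * (norm y)\<^sup>2"
      by (simp add: norm_plus_sq norm_diff_sq)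
    ultimately show ?thesis using m_le[OF hM] by (simp add: J_def)
  qed
  have "Cauchy X"
  proof (rule metric_CauchyI)
    fix e :: real assume e: "0 < e"
    obtain N where N: "4 / e\<^sup>2 < real N" using reals_Archimedean2 by blast
    have N0: "0 < real N" using N e by (meson divide_pos_pos less_trans zero_less_numeral
        zero_less_power)
    have "dist (X i) (X j) < e" if ij: "i \<ge> N" "j \<ge> N" for i j
    proof -
      have a: "1 / real (Suc i) < 1 / real N" "1 / real (Suc j) < 1 / real N"
        using ij N0 by (simp_all add: divide_simps)
      have "(norm (X i - X j))\<^sup>2 < 2 * (2 / real N)"
        using par[OF X(1)[of i] X(1)[of j]] X(2)[of i] X(2)[of j] a by simp
      also have "\<dots> < e\<^sup>2" using N N0 e by (simp add: divide_simps mult.commute)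
      finally show ?thesis using e by (simp add: dist_norm power2_less_imp_less)
    qed
    then show "\<exists>N. \<forall>i\<ge>N. \<forall>j\<ge>N. dist (X i) (X j) < e" by blast
  qed
  then obtain z where z: "X \<longlonglongrightarrow> z" using Cauchy_convergent convergent_def by blast
  have zM: "z \<in> M" using closed_sequentially[OF csub_closed[OF M]] X(1) z by blast
  have diff: "f (x - y) = f x - f y" if "x \<in> M" "y \<in> M" for x y
    using add[OF csub_diff[OF M that] that(2)] by simp
  have fz: "(\<lambda>n. f (X n)) \<longlonglongrightarrow> f z"
  proof (rule LIM_zero_cancel, rule Lim_null_comparison)
    show "\<forall>\<^sub>F n in sequentially. norm (f (X n) - f z) \<le> C * norm (X n - z)"
      using bdd[OF csub_diff[OF M X(1) zM]] diff[OF X(1) zM] by (intro always_eventually) simp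
    show "(\<lambda>n. C * norm (X n - z)) \<longlonglongrightarrow> 0"
      by (rule tendsto_mult_right_zero, rule tendsto_norm_zero, rule LIM_zero, rule z)
  qed
  have "J z \<le> m"
  proof (rule LIMSEQ_le)
    show "(\<lambda>n. J (X n)) \<longlonglongrightarrow> J z" unfolding J_def by (intro tendsto_intros z fz)
    have "(\<lambda>n. m + 1 / real (Suc n)) \<longlonglongrightarrow> m + 0"
      by (intro tendsto_add tendsto_const LIMSEQ_Suc[OF lim_1_over_n])
    then show "(\<lambda>n. m + 1 / real (Suc n)) \<longlonglongrightarrow> m" by simp
    show "\<exists>N. \<forall>n\<ge>N. J (X n) \<le> m + 1 / real (Suc n)" using X(2) less_imp_le by blast
  qed
  have re: "Re (f y) = Re (cinner y z)" if y: "y \<in> M" for y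
  proof -
    define d where "d = Re (cinner y z) - Re (f y)"
    have ineq: "0 \<le> t\<^sup>2 * (norm y)\<^sup>2 + 2 * t * d" for t :: real
    proof -
      have "f (z + t *\<^sub>R y) = f z + of_real t * f y"
        using add[OF zM csub_scaleR[OF M y]] scale[OF y, of "of_real t"] by (simp add: scaleC_of_real)
      moreover have "Re (cinner z (t *\<^sub>R y)) = t * Re (cinner y z)"
        by (simp add: Re_cinner inner_commute)
      ultimately have "J (z + t *\<^sub>R y) - J z = t\<^sup>2 * (norm y)\<^sup>2 + 2 * t * d"
        by (simp add: J_def norm_plus_sq d_def power_mult_distrib algebra_simps)
      moreover have "J z \<le> J (z + t *\<^sub>R y)"
        using m_le[OF csub_add[OF M zM csub_scaleR[OF M y]], of t] \<open>J z \<le> m\<close> by linarith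
      ultimately show ?thesis by linarith
    qed
    have "d = 0"
    proof (rule ccontr)
      assume "d \<noteq> 0"
      define k where "k = (norm y)\<^sup>2 + 1"
      have k: "k > 0" by (simp add: k_def add_nonneg_pos)
      have "0 \<le> k * ((d / k)\<^sup>2 * (norm y)\<^sup>2 - 2 * (d / k) * d)"
        using ineq[of "- d / k"] k by simp
      also have "\<dots> = d\<^sup>2 * ((norm y)\<^sup>2 / k) - 2 * d\<^sup>2"
        using k by (simp add: field_simps power2_eq_square)
      also have "\<dots> \<le> d\<^sup>2 * 1 - 2 * d\<^sup>2"
        using k by (intro diff_mono mult_left_mono) (auto simp: k_def)
      also have "\<dots> < 0" using \<open>d \<noteq> 0\<close> by simp
      finally show False by simp
    qed
    then show ?thesis by (simp add: d_def)
  qed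
  have "f x = cinner x z" if x: "x \<in> M" for x
    using re[OF x] re[OF csub_scaleC[OF M x, of "- \<i>"]] scale[OF x, of "- \<i>"]
    by (simp add: complex_eq_iff cinner_scaleC_left)
  with zM show ?thesis by blast
qed

section \<open>Operators, adjoints and projections\<close>

lemma op_in: "operator_on M T \<Longrightarrow> x \<in> M \<Longrightarrow> T x \<in> M"
  and op_add: "operator_on M T \<Longrightarrow> x \<in> M \<Longrightarrow> y \<in> M \<Longrightarrow> T (x + y) = T x + T y"
  and op_scaleC: "operator_on M T \<Longrightarrow> x \<in> M \<Longrightarrow> T (c *\<^sub>C x) = c *\<^sub>C T x"
  by (auto simp: operator_on_def clinear_on_def)

lemma op_diff:
  assumes "closed_csubspace M" "operator_on M T" "x \<in> M" "y \<in> M"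
  shows "T (x - y) = T x - T y"
  using op_add[OF assms(2) csub_diff[OF assms(1,3,4)] assms(4)] by simp

lemma op_zero: "closed_csubspace M \<Longrightarrow> operator_on M T \<Longrightarrow> T 0 = 0"
  using op_diff[of M T 0 0] csub_zero[of M] by simp

lemma op_minus:
  assumes "closed_csubspace M" "operator_on M T" "x \<in> M"
  shows "T (- x) = - T x"
  using op_diff[OF assms(1,2) csub_zero[OF assms(1)] assms(3)] op_zero[OF assms(1,2)] by simp

lemma op_bound:
  assumes "operator_on M T" obtains c where "0 < c" "\<And>x. x \<in> M \<Longrightarrow> norm (T x) \<le> c * norm x"
proof -
  obtain c where c: "\<And>x. x \<in> M \<Longrightarrow> norm (T x) \<le> c * norm x"
    using assms by (auto simp: operator_on_def)
  have "norm (T x) \<le> (\<bar>c\<bar> + 1) * norm x" if "x \<in> M" for x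
    by (rule order_trans[OF c[OF that]]) (intro mult_right_mono, auto)
  then show ?thesis using that[of "\<bar>c\<bar> + 1"] by auto
qed

lemma operator_onI:
  assumes "\<And>x. x \<in> M \<Longrightarrow> T x \<in> M"
    and "\<And>x y. x \<in> M \<Longrightarrow> y \<in> M \<Longrightarrow> T (x + y) = T x + T y"
    and "\<And>c x. x \<in> M \<Longrightarrow> T (c *\<^sub>C x) = c *\<^sub>C T x"
    and "\<And>x. x \<in> M \<Longrightarrow> norm (T x) \<le> c * norm x"
  shows "operator_on M T"
  unfolding operator_on_def clinear_on_def
  by (intro conjI ballI allI image_subsetI exI[of _ c] assms)

lemma op_subspace: "operator_on M T \<Longrightarrow> N \<subseteq> M \<Longrightarrow> T ` N \<subseteq> N \<Longrightarrow> operator_on N T"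
  unfolding operator_on_def clinear_on_def by (metis subsetD)

lemma op_compose:
  assumes S: "operator_on M S" and T: "operator_on M T" shows "operator_on M (\<lambda>x. S (T x))"
proof -
  obtain c d where c: "0 < c" "\<And>x. x \<in> M \<Longrightarrow> norm (S x) \<le> c * norm x"
    and d: "\<And>x. x \<in> M \<Longrightarrow> norm (T x) \<le> d * norm x" using op_bound S T by metis
  have "norm (S (T x)) \<le> (c * d) * norm x" if "x \<in> M" for x
    using order_trans[OF c(2)[OF op_in[OF T that]] mult_left_mono[OF d[OF that] less_imp_le[OF c(1)]]]
    by (simp only: mult.assoc)
  then show ?thesis
    by (intro operator_onI) (simp_all add: op_in[OF S] op_in[OF T] op_add[OF S] op_add[OF T]
        op_scaleC[OF S] op_scaleC[OF T])
qed

lemma op_plus: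
  assumes M: "closed_csubspace M" and S: "operator_on M S" and T: "operator_on M T"
  shows "operator_on M (\<lambda>x. S x + T x)"
proof -
  obtain c d where c: "\<And>x. x \<in> M \<Longrightarrow> norm (S x) \<le> c * norm x"
    and d: "\<And>x. x \<in> M \<Longrightarrow> norm (T x) \<le> d * norm x" using op_bound S T by metis
  have "norm (S x + T x) \<le> (c + d) * norm x" if "x \<in> M" for x
    using norm_triangle_ineq[of "S x" "T x"] c[OF that] d[OF that] by (simp add: distrib_right)
  then show ?thesis
    by (intro operator_onI) (simp_all add: csub_add[OF M] op_in[OF S] op_in[OF T] op_add[OF S]
        op_add[OF T] op_scaleC[OF S] op_scaleC[OF T] scaleC_add_right)
qed

lemma op_const_scaleC:
  assumes M: "closed_csubspace M" shows "operator_on M (\<lambda>x. a *\<^sub>C x)"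
  by (rule operator_onI[where c = "cmod a"])
     (auto simp: csub_scaleC[OF M] scaleC_add_right scaleC_scaleC mult.commute norm_scaleC)

lemma op_sub:
  assumes M: "closed_csubspace M" and S: "operator_on M S" and T: "operator_on M T"
  shows "operator_on M (\<lambda>x. S x - T x)"
  using op_plus[OF M S op_compose[OF op_const_scaleC[OF M, of "- 1"] T]] by (simp add: scaleC_minus_one)

lemma op_minus_scaleC:
  assumes M: "closed_csubspace M" and T: "operator_on M T"
  shows "operator_on M (\<lambda>x. T x - a *\<^sub>C x)"
  by (rule op_sub[OF M T op_const_scaleC[OF M]])

lemma op_tendsto:
  assumes M: "closed_csubspace M" and T: "operator_on M T"
    and X: "\<And>n. X n \<in> M" "X \<longlonglongrightarrow> x"
  shows "(\<lambda>n. T (X n)) \<longlonglongrightarrow> T x"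
proof -
  have x: "x \<in> M" using closed_sequentially[OF csub_closed[OF M]] X by blast
  obtain c where c: "\<And>x. x \<in> M \<Longrightarrow> norm (T x) \<le> c * norm x" using op_bound[OF T] by metis
  show ?thesis
  proof (rule LIM_zero_cancel, rule Lim_null_comparison)
    show "\<forall>\<^sub>F n in sequentially. norm (T (X n) - T x) \<le> c * norm (X n - x)"
      using c[OF csub_diff[OF M X(1) x]] op_diff[OF M T X(1) x] by simp
    show "(\<lambda>n. c * norm (X n - x)) \<longlonglongrightarrow> 0"
      by (rule tendsto_mult_right_zero, rule tendsto_norm_zero, rule LIM_zero, rule X)
  qed
qed

text \<open>The adjoint as an explicit second operator. All computations run with such pairs; the
  description operator in \<^const>\<open>adjoint_on\<close> is met only through the uniqueness lemma
  \<open>adjoint_pair_eq\<close>.\<close>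

definition adjoint_pair :: "'a::chilbert_space set \<Rightarrow> ('a \<Rightarrow> 'a) \<Rightarrow> ('a \<Rightarrow> 'a) \<Rightarrow> bool" where
  "adjoint_pair M T S \<longleftrightarrow> operator_on M T \<and> operator_on M S \<and>
    (\<forall>x\<in>M. \<forall>y\<in>M. cinner (T x) y = cinner x (S y))"

lemma adjoint_pairD:
  assumes "adjoint_pair M T S"
  shows "operator_on M T" "operator_on M S"
    "\<And>x y. x \<in> M \<Longrightarrow> y \<in> M \<Longrightarrow> cinner (T x) y = cinner x (S y)"
  using assms by (auto simp: adjoint_pair_def)

lemma adjoint_pair_sym: "adjoint_pair M T S \<Longrightarrow> adjoint_pair M S T"
  unfolding adjoint_pair_def using cinner_commute by metis

lemma cinner_eqI_on:
  assumes "closed_csubspace M" "y \<in> M" "z \<in> M" "\<And>x. x \<in> M \<Longrightarrow> cinner x y = cinner x z"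
  shows "y = z"
proof -
  have "cinner (y - z) (y - z) = 0"
    using assms(4)[OF csub_diff[OF assms(1-3)]] by (simp add: cinner_diff_right)
  then show ?thesis by (simp add: cinner_self_eq_0)
qed

lemma adjoint_on_eq:
  assumes "closed_csubspace M" "z \<in> M" "\<And>x. x \<in> M \<Longrightarrow> cinner (T x) y = cinner x z"
  shows "adjoint_on M T y = z"
  unfolding adjoint_on_def
proof (rule the_equality)
  show "z \<in> M \<and> (\<forall>x\<in>M. cinner (T x) y = cinner x z)" using assms by simp
next
  fix w assume "w \<in> M \<and> (\<forall>x\<in>M. cinner (T x) y = cinner x w)"
  then have w: "w \<in> M" "\<And>x. x \<in> M \<Longrightarrow> cinner x w = cinner x z" using assms(3) by (metis, metis)
  show "w = z" by (rule cinner_eqI_on[OF assms(1) w(1) assms(2) w(2)])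
qed

lemma adjoint_pair_eq:
  "closed_csubspace M \<Longrightarrow> adjoint_pair M T S \<Longrightarrow> y \<in> M \<Longrightarrow> adjoint_on M T y = S y"
  by (rule adjoint_on_eq) (auto simp: adjoint_pair_def op_in)

text \<open>Boundedness of the adjoint comes from \<open>\<parallel>T\<^sup>* x\<parallel>\<^sup>2 = \<langle>T T\<^sup>* x, x\<rangle> \<le> c \<parallel>T\<^sup>* x\<parallel> \<parallel>x\<parallel>\<close>, after the
  Riesz representation of \<open>x \<mapsto> \<langle>T x, y\<rangle>\<close> has produced its values.\<close>

lemma adjoint_pair_adjoint_on:
  assumes M: "closed_csubspace M" and T: "operator_on M T"
  shows "adjoint_pair M T (adjoint_on M T)"
proof -
  obtain c where c: "0 < c" "\<And>x. x \<in> M \<Longrightarrow> norm (T x) \<le> c * norm x" using op_bound[OF T] by metis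
  have "\<exists>z\<in>M. \<forall>x\<in>M. cinner (T x) y = cinner x z" for y
  proof (rule riesz_representation[OF M, where C = "c * norm y"])
    show "cmod (cinner (T x) y) \<le> c * norm y * norm x" if "x \<in> M" for x
      using order_trans[OF norm_cinner_le[of "T x" y] mult_right_mono[OF c(2)[OF that]
          norm_ge_zero[of y]]]
      by (simp add: mult_ac)
  qed (simp_all add: op_add[OF T] op_scaleC[OF T] cinner_add_left cinner_scaleC_left)
  then have in_M: "adjoint_on M T y \<in> M"
    and adj: "x \<in> M \<Longrightarrow> cinner (T x) y = cinner x (adjoint_on M T y)" for x y
    by (metis adjoint_on_eq[OF M])+
  have "operator_on M (adjoint_on M T)"
  proof (rule operator_onI[where c = c])
    fix x assume "x \<in> M"
    show "adjoint_on M T x \<in> M" by (rule in_M)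
    let ?z = "adjoint_on M T x"
    have "(norm ?z)\<^sup>2 = cmod (cinner ?z ?z)" unfolding cinner_self norm_of_real by simp
    also have "\<dots> = cmod (cinner (T ?z) x)" using adj[OF in_M] by simp
    also have "\<dots> \<le> norm (T ?z) * norm x" by (rule norm_cinner_le)
    also have "\<dots> \<le> (c * norm ?z) * norm x" using c(2)[OF in_M] by (simp add: mult_right_mono)
    finally have "norm ?z * norm ?z \<le> norm ?z * (c * norm x)" by (simp add: power2_eq_square mult_ac)
    then show "norm ?z \<le> c * norm x"
      using c(1) by (cases "norm ?z = 0") (auto simp: mult_le_cancel_left)
  next
    fix x y assume "x \<in> M" "y \<in> M"
    then show "adjoint_on M T (x + y) = adjoint_on M T x + adjoint_on M T y"
      by (intro adjoint_on_eq[OF M]) (simp_all add: csub_add[OF M] in_M cinner_add_right adj)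
  next
    fix c x assume "x \<in> M"
    then show "adjoint_on M T (c *\<^sub>C x) = c *\<^sub>C adjoint_on M T x"
      by (intro adjoint_on_eq[OF M]) (simp_all add: csub_scaleC[OF M] in_M cinner_scaleC_right adj)
  qed
  then show ?thesis using T adj by (simp add: adjoint_pair_def)
qed

lemma adjoint_pair_minus_scaleC:
  assumes M: "closed_csubspace M" and "adjoint_pair M T S"
  shows "adjoint_pair M (\<lambda>x. T x - a *\<^sub>C x) (\<lambda>x. S x - cnj a *\<^sub>C x)"
  using assms(2) by (auto simp: adjoint_pair_def op_minus_scaleC[OF M] cinner_simps)

lemma adjoint_pair_norm:
  assumes "adjoint_pair M T S" "x \<in> M"
  shows "(norm (T x))\<^sup>2 = Re (cinner (S (T x)) x)" "(norm (T x))\<^sup>2 = Re (cinner x (S (T x)))"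
proof -
  have "complex_of_real ((norm (T x))\<^sup>2) = cinner x (S (T x))"
    using adjoint_pairD(3)[OF assms(1) assms(2) op_in[OF adjoint_pairD(1)[OF assms(1)] assms(2)]]
    by (simp add: cinner_self)
  then show 1: "(norm (T x))\<^sup>2 = Re (cinner x (S (T x)))" by (metis Re_complex_of_real)
  then show "(norm (T x))\<^sup>2 = Re (cinner (S (T x)) x)" by (metis cinner_commute cnj.sel(1))
qed

lemma normal_norm_eq:
  assumes "adjoint_pair M T S" "\<And>x. x \<in> M \<Longrightarrow> S (T x) = T (S x)" "x \<in> M"
  shows "norm (S x) = norm (T x)"
proof -
  have "(norm (S x))\<^sup>2 = (norm (T x))\<^sup>2"
    using adjoint_pair_norm(1)[OF assms(1,3)] adjoint_pair_norm(1)[OF adjoint_pair_sym[OF assms(1)]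
        assms(3)]
      assms(2)[OF assms(3)] by simp
  then show ?thesis by (simp add: power2_eq_iff_nonneg)
qed

subsection \<open>Orthogonal projection\<close>

definition proj :: "'a::chilbert_space set \<Rightarrow> 'a \<Rightarrow> 'a" where
  "proj M x = (SOME z. z \<in> M \<and> (\<forall>y\<in>M. cinner y x = cinner y z))"

lemma proj_props:
  assumes M: "closed_csubspace M"
  shows proj_in: "proj M x \<in> M" and proj_cinner: "y \<in> M \<Longrightarrow> cinner y (proj M x) = cinner y x"
proof -
  have "\<exists>z\<in>M. \<forall>y\<in>M. cinner y x = cinner y z"
    by (rule riesz_representation[OF M, where C = "norm x"])
       (simp_all add: cinner_simps norm_cinner_le mult.commute[of "norm x"])
  then have "\<exists>z. z \<in> M \<and> (\<forall>y\<in>M. cinner y x = cinner y z)" by blast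
  from someI_ex[OF this] show "proj M x \<in> M" and "y \<in> M \<Longrightarrow> cinner y (proj M x) = cinner y x"
    unfolding proj_def by auto
qed

lemma proj_unique:
  assumes "closed_csubspace M" "z \<in> M" "\<And>y. y \<in> M \<Longrightarrow> cinner y (x - z) = 0"
  shows "proj M x = z"
proof (rule cinner_eqI_on[OF assms(1) proj_in[OF assms(1)] assms(2)])
  fix y assume "y \<in> M"
  then show "cinner y (proj M x) = cinner y z"
    using proj_cinner[OF assms(1)] assms(3) by (simp add: cinner_diff_right)
qed

lemma csub_orth:
  fixes N :: "'a::chilbert_space set"
  shows "closed_csubspace (UNIV \<ominus> N)"
proof -
  have "closed {x. \<forall>y\<in>N. cinner x y = 0}"
    unfolding closed_sequential_limits
  proof (intro allI impI)
    fix X and l :: 'a assume a: "(\<forall>n. X n \<in> {x. \<forall>y\<in>N. cinner x y = 0}) \<and> X \<longlonglongrightarrow> l"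
    have "cinner l y = 0" if "y \<in> N" for y
      using LIMSEQ_unique[OF tendsto_cinner_left[of X l sequentially y]] a that by auto
    then show "l \<in> {x. \<forall>y\<in>N. cinner x y = 0}" by simp
  qed
  then show ?thesis by (simp add: closed_csubspace_def orth_diff_def cinner_simps)
qed

lemma orth_cinner: "x \<in> UNIV \<ominus> M \<Longrightarrow> y \<in> M \<Longrightarrow> cinner x y = 0 \<and> cinner y x = 0"
  unfolding orth_diff_def by (metis (mono_tags, lifting) cinner_commute complex_cnj_zero mem_Collect_eq)

subsection \<open>Inverting coercive operators\<close>

text \<open>For small \<open>t > 0\<close> the map \<open>x \<mapsto> x - t (S x - y)\<close> is a strict contraction, and its fixed point
  solves \<open>S x = y\<close>.\<close>

lemma coercive_bij:
  assumes M: "closed_csubspace M" and S: "operator_on M S" and e: "0 < e"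
    and co: "\<And>x. x \<in> M \<Longrightarrow> e * (norm x)\<^sup>2 \<le> Re (cinner (S x) x)"
  shows "bij_betw S M M"
proof -
  have inj: "inj_on S M"
  proof (rule inj_onI)
    fix x y assume xy: "x \<in> M" "y \<in> M" "S x = S y"
    then have "e * (norm (x - y))\<^sup>2 \<le> 0"
      using co[OF csub_diff[OF M xy(1,2)]] op_diff[OF M S xy(1,2)] by simp
    then show "x = y" using e by (simp add: mult_le_0_iff)
  qed
  obtain c where c: "0 < c" "\<And>x. x \<in> M \<Longrightarrow> norm (S x) \<le> c * norm x" using op_bound[OF S] by metis
  \<comment> \<open>Adding \<open>e\<close> ensures \<open>e < C\<close>, so that the contraction constant \<open>k\<close> is nonnegative.\<close>
  define C where "C = c + e"
  have C: "0 < C" "e \<le> C" "norm (S x) \<le> C * norm x" if "x \<in> M" for x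
    using c e order_trans[OF c(2)[OF that] mult_right_mono[of c C "norm x"]] by (auto simp: C_def)
  have C0: "0 < C" "e < C" using c(1) e by (auto simp: C_def)
  define t where "t = e / C\<^sup>2"
  have t: "0 < t" using e C0 by (simp add: t_def)
  define k where "k = 1 - (e / C)\<^sup>2"
  have k: "0 \<le> k" "k < 1" using e C0 by (auto simp: k_def power_le_one divide_simps)
  have contr: "(norm (x - t *\<^sub>R S x))\<^sup>2 \<le> k * (norm x)\<^sup>2" if x: "x \<in> M" for x
  proof -
    have "(norm (x - t *\<^sub>R S x))\<^sup>2 = (norm x)\<^sup>2 + t\<^sup>2 * (norm (S x))\<^sup>2 - 2 * t * Re (cinner (S x) x)"
      by (simp add: norm_diff_sq Re_cinner inner_commute power_mult_distrib)
    also have "\<dots> \<le> (norm x)\<^sup>2 + t\<^sup>2 * (C * norm x)\<^sup>2 - 2 * t * (e * (norm x)\<^sup>2)"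
      using C(3)[OF x] co[OF x] t by (intro diff_mono add_mono mult_left_mono power_mono) auto
    also have "\<dots> = (1 + t\<^sup>2 * C\<^sup>2 - 2 * t * e) * (norm x)\<^sup>2"
      by (simp add: algebra_simps power_mult_distrib)
    also have "1 + t\<^sup>2 * C\<^sup>2 - 2 * t * e = k"
      using C0 by (simp add: t_def k_def field_simps power2_eq_square)
    finally show ?thesis .
  qed
  have "\<exists>x\<in>M. S x = y" if y: "y \<in> M" for y
  proof -
    let ?f = "\<lambda>x. x - t *\<^sub>R (S x - y)"
    have "\<exists>!x\<in>M. ?f x = x"
    proof (rule Banach_fix[of M "sqrt k"])
      show "complete M" using csub_closed[OF M] complete_eq_closed by blast
      show "M \<noteq> {}" using csub_zero[OF M] by blast
      show "0 \<le> sqrt k" "sqrt k < 1" using k by auto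
      show "?f ` M \<subseteq> M" using y by (auto intro!: csub_diff[OF M] csub_scaleR[OF M] op_in[OF S])
      have "dist (?f x) (?f z) \<le> sqrt k * dist x z" if xz: "x \<in> M" "z \<in> M" for x z
      proof -
        have "?f x - ?f z = (x - z) - t *\<^sub>R S (x - z)"
          unfolding op_diff[OF M S xz] by (simp add: algebra_simps)
        then have "(norm (?f x - ?f z))\<^sup>2 \<le> k * (norm (x - z))\<^sup>2"
          using contr[OF csub_diff[OF M xz]] by (simp only:)
        also have "\<dots> = (sqrt k * norm (x - z))\<^sup>2" using k by (simp add: power_mult_distrib)
        finally show ?thesis unfolding dist_norm by (rule power2_le_imp_le) (simp add: k)
      qed
      then show "\<And>x y. \<lbrakk>x \<in> M; y \<in> M\<rbrakk> \<Longrightarrow> dist (?f x) (?f y) \<le> sqrt k * dist x y" by blast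
    qed
    then obtain x where "x \<in> M" "t *\<^sub>R (S x - y) = 0" by auto
    then show ?thesis using t by auto
  qed
  then have "M \<subseteq> S ` M" by blast
  then show ?thesis using inj op_in[OF S] by (auto simp: bij_betw_def)
qed

section \<open>Koszul complexes\<close>

text \<open>The operator \<open>S = \<Sum> R\<^sub>i T\<^sub>i\<close> commutes with the \<open>T\<^sub>i\<close>, hence so does its inverse \<open>G\<close>, and
  contraction of the exterior variables against \<open>(G R\<^sub>1, G R\<^sub>2, G R\<^sub>3)\<close> is a homotopy between the
  identity and the zero map of the Koszul complex.\<close>

lemma koszul_exact_of_homotopy:
  assumes M: "closed_csubspace M"
    and T: "operator_on M T1" "operator_on M T2" "operator_on M T3"
    and R: "operator_on M R1" "operator_on M R2" "operator_on M R3"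
    and TT: "\<And>x. x \<in> M \<Longrightarrow> T2 (T1 x) = T1 (T2 x)" "\<And>x. x \<in> M \<Longrightarrow> T3 (T1 x) = T1 (T3 x)"
      "\<And>x. x \<in> M \<Longrightarrow> T3 (T2 x) = T2 (T3 x)"
    and TR: "\<And>x. x \<in> M \<Longrightarrow> T1 (R1 x) = R1 (T1 x)" "\<And>x. x \<in> M \<Longrightarrow> T1 (R2 x) = R2 (T1 x)"
      "\<And>x. x \<in> M \<Longrightarrow> T1 (R3 x) = R3 (T1 x)" "\<And>x. x \<in> M \<Longrightarrow> T2 (R1 x) = R1 (T2 x)"
      "\<And>x. x \<in> M \<Longrightarrow> T2 (R2 x) = R2 (T2 x)" "\<And>x. x \<in> M \<Longrightarrow> T2 (R3 x) = R3 (T2 x)"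
      "\<And>x. x \<in> M \<Longrightarrow> T3 (R1 x) = R1 (T3 x)" "\<And>x. x \<in> M \<Longrightarrow> T3 (R2 x) = R2 (T3 x)"
      "\<And>x. x \<in> M \<Longrightarrow> T3 (R3 x) = R3 (T3 x)"
    and bij: "bij_betw (\<lambda>x. R1 (T1 x) + R2 (T2 x) + R3 (T3 x)) M M"
  shows "koszul_exact M T1 T2 T3"
proof -
  define S where "S = (\<lambda>x. R1 (T1 x) + R2 (T2 x) + R3 (T3 x))"
  define G where "G = inv_into M S"
  have bij: "bij_betw S M M" using bij by (simp add: S_def)
  note inM = op_in[OF T(1)] op_in[OF T(2)] op_in[OF T(3)] op_in[OF R(1)] op_in[OF R(2)] op_in[OF R(3)]
    csub_add[OF M] csub_diff[OF M] csub_zero[OF M] csub_minus[OF M]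
  note add = op_add[OF T(1)] op_add[OF T(2)] op_add[OF T(3)] op_add[OF R(1)] op_add[OF R(2)]
      op_add[OF R(3)]
  note diff = op_diff[OF M T(1)] op_diff[OF M T(2)] op_diff[OF M T(3)] op_diff[OF M R(1)]
    op_diff[OF M R(2)] op_diff[OF M R(3)] op_minus[OF M T(2)] op_minus[OF M T(3)]
  note zero = op_zero[OF M T(1)] op_zero[OF M T(2)] op_zero[OF M T(3)] op_zero[OF M R(1)]
    op_zero[OF M R(2)] op_zero[OF M R(3)]
  have Sin: "S x \<in> M" if "x \<in> M" for x unfolding S_def using that by (intro inM)
  have Sadd: "S (x + y) = S x + S y" if "x \<in> M" "y \<in> M" for x y
    unfolding S_def using that by (simp add: add inM add_ac)
  have GM: "G y \<in> M" if "y \<in> M" for y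
    unfolding G_def using bij that by (metis bij_betw_imp_surj_on inv_into_into)
  have SG: "S (G y) = y" if "y \<in> M" for y
    unfolding G_def using bij that by (metis bij_betw_imp_surj_on f_inv_into_f)
  have GS: "G (S y) = y" if "y \<in> M" for y
    unfolding G_def using bij that by (metis bij_betw_imp_inj_on inv_into_f_f)
  have Gadd: "G (x + y) = G x + G y" if "x \<in> M" "y \<in> M" for x y
  proof -
    have "S (G x + G y) = x + y"
      using SG[OF that(1)] SG[OF that(2)] Sadd[OF GM[OF that(1)] GM[OF that(2)]] by simp
    then show ?thesis using GS[of "G x + G y"] GM that inM(7) by metis
  qed
  have G0: "G 0 = 0" using Gadd[of 0 0] inM(9) by simp
  have Gdiff: "G (x - y) = G x - G y" if "x \<in> M" "y \<in> M" for x y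
    using Gadd[of "x - y" y] that inM(8) by simp
  have comm: "G (f x) = f (G x)"
    if x: "x \<in> M" and f: "operator_on M f" "\<And>x. x \<in> M \<Longrightarrow> f (S x) = S (f x)" for f x
  proof -
    have "S (f (G x)) = f x" using f(2)[OF GM[OF x]] SG[OF x] by simp
    then show ?thesis using GS[of "f (G x)"] GM[OF x] op_in[OF f(1)] by metis
  qed
  have GT: "G (T1 x) = T1 (G x)" "G (T2 x) = T2 (G x)" "G (T3 x) = T3 (G x)" if "x \<in> M" for x
    using that by (intro comm[OF _ T(1)] comm[OF _ T(2)] comm[OF _ T(3)];
      simp add: S_def add inM TT TR)+
  have e0: "{x \<in> M. koszul0 T1 T2 T3 x = 0} = {0}"
  proof -
    have "x = 0" if "x \<in> M" "T1 x = 0" "T2 x = 0" "T3 x = 0" for x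
      using GS[OF that(1)] G0 that by (simp add: S_def zero)
    then show ?thesis by (auto simp: koszul0_def zero inM prod_eq_iff)
  qed
  have k10: "koszul0 T1 T2 T3 x \<in> M \<times> M \<times> M" "koszul1 T1 T2 T3 (koszul0 T1 T2 T3 x) = 0" if "x \<in> M" for x
    using that by (simp_all add: koszul0_def koszul1_def TT inM zero_prod_def)
  have k21: "koszul1 T1 T2 T3 v \<in> M \<times> M \<times> M" "koszul2 T1 T2 T3 (koszul1 T1 T2 T3 v) = 0"
    if v: "v \<in> M \<times> M \<times> M" for v
  proof -
    obtain x y z where xyz: "v = (x, y, z)" "x \<in> M" "y \<in> M" "z \<in> M" using v by blast
    then show "koszul1 T1 T2 T3 v \<in> M \<times> M \<times> M" "koszul2 T1 T2 T3 (koszul1 T1 T2 T3 v) = 0"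
      by (simp_all add: koszul1_def koszul2_def TT diff inM)
  qed
  have k2: "koszul2 T1 T2 T3 v \<in> M" if v: "v \<in> M \<times> M \<times> M" for v
  proof -
    obtain x y z where xyz: "v = (x, y, z)" "x \<in> M" "y \<in> M" "z \<in> M" using v by blast
    then show ?thesis by (simp add: koszul2_def inM)
  qed
  have e1: "{v \<in> M \<times> M \<times> M. koszul1 T1 T2 T3 v = 0} = koszul0 T1 T2 T3 ` M"
  proof (intro equalityI subsetI)
    fix v assume "v \<in> {v \<in> M \<times> M \<times> M. koszul1 T1 T2 T3 v = 0}"
    then obtain x y z where v: "v = (x, y, z)" and xyz: "x \<in> M" "y \<in> M" "z \<in> M"
      and k: "T1 y = T2 x" "T1 z = T3 x" "T2 z = T3 y" by (auto simp: koszul1_def prod_eq_iff)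
    define s where "s = R1 x + R2 y + R3 z"
    have s: "s \<in> M" unfolding s_def using xyz by (intro inM)
    have "T1 s = S x" "T2 s = S y" "T3 s = S z"
      using xyz by (simp_all add: s_def S_def add inM TR k)
    then have "koszul0 T1 T2 T3 (G s) = v"
      using GS xyz GT[OF s] by (simp add: koszul0_def v)
    then show "v \<in> koszul0 T1 T2 T3 ` M" using GM[OF s] by blast
  qed (use k10 in blast)
  have e2: "{v \<in> M \<times> M \<times> M. koszul2 T1 T2 T3 v = 0} = koszul1 T1 T2 T3 ` (M \<times> M \<times> M)"
  proof (intro equalityI subsetI)
    fix v assume "v \<in> {v \<in> M \<times> M \<times> M. koszul2 T1 T2 T3 v = 0}"
    then obtain x y z where v: "v = (x, y, z)" and xyz: "x \<in> M" "y \<in> M" "z \<in> M"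
      and k: "T1 z - T2 y + T3 x = 0" by (auto simp: koszul2_def)
    have k1: "T1 z = T2 y - T3 x" and k2y: "T2 y = T1 z + T3 x" and k3: "T3 x = T2 y - T1 z"
      using k by (simp_all add: algebra_simps eq_neg_iff_add_eq_0)
    \<comment> \<open>The components of the contraction of \<open>v\<close>, before \<open>G\<close> is applied.\<close>
    define a where "a = 0 - (R2 x + R3 y)"
    define b where "b = R1 x - R3 z"
    define c where "c = R1 y + R2 z"
    have abc: "a \<in> M" "b \<in> M" "c \<in> M" using xyz by (simp_all add: a_def b_def c_def inM)
    have k1': "R3 (T1 z) = R3 (T2 y) - R3 (T3 x)" unfolding k1 using xyz by (simp add: diff inM)
    have k2': "R2 (T2 y) = R2 (T1 z) + R2 (T3 x)" unfolding k2y using xyz by (simp add: add inM)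
    have k3': "R1 (T3 x) = R1 (T2 y) - R1 (T1 z)" unfolding k3 using xyz by (simp add: diff inM)
    have "T1 b - T2 a = S x" 
      using xyz by (simp add: a_def b_def S_def add diff zero inM TR k1')
    moreover have "T1 c - T3 a = S y"
      using xyz by (simp add: a_def c_def S_def add diff zero inM TR k2')
    moreover have "T2 c - T3 b = S z"
      using xyz by (simp add: b_def c_def S_def add diff zero inM TR k3')
    ultimately have "koszul1 T1 T2 T3 (G a, G b, G c) = v"
      using GS[OF xyz(1)] GS[OF xyz(2)] GS[OF xyz(3)] abc
      by (simp add: koszul1_def v GT[symmetric] Gdiff[symmetric] inM)
    then show "v \<in> koszul1 T1 T2 T3 ` (M \<times> M \<times> M)"
      using GM[OF abc(1)] GM[OF abc(2)] GM[OF abc(3)] by (auto intro!: image_eqI[of v _ "(G a, G b,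
          G c)"])
  qed (use k21 in blast)
  have e3: "M = koszul2 T1 T2 T3 ` (M \<times> M \<times> M)"
  proof (intro equalityI subsetI)
    fix y assume y: "y \<in> M"
    define g where "g = G y"
    have g: "g \<in> M" unfolding g_def by (rule GM[OF y])
    have "T1 (R1 g) - T2 (0 - R2 g) + T3 (R3 g) = S g"
      using g by (simp add: diff inM zero TR S_def)
    then have "koszul2 T1 T2 T3 (R3 g, 0 - R2 g, R1 g) = y"
      using SG[OF y] by (simp add: koszul2_def g_def)
    then show "y \<in> koszul2 T1 T2 T3 ` (M \<times> M \<times> M)"
      using g inM by (auto intro!: image_eqI[of y _ "(R3 g, 0 - R2 g, R1 g)"])
  qed (use k2 in blast)
  show ?thesis unfolding koszul_exact_def using e0 e1 e2 e3 by (intro conjI)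
qed

lemma square_sum3_le: "(a + b + d)\<^sup>2 \<le> 3 * (a\<^sup>2 + b\<^sup>2 + (d :: real)\<^sup>2)"
proof -
  have "0 \<le> (a - b)\<^sup>2 + (b - d)\<^sup>2 + (a - d)\<^sup>2" by simp
  then show ?thesis by (simp add: power2_eq_square algebra_simps)
qed

text \<open>For commuting normal operators the Taylor spectrum contains only joint approximate
  eigenvalues: if the three operators are jointly bounded below, then \<open>\<Sum> T\<^sub>i\<^sup>* T\<^sub>i\<close> is coercive and
  therefore invertible.\<close>

lemma koszul_exact_if_bounded_below:
  assumes M: "closed_csubspace M"
    and adj: "adjoint_pair M T1 R1" "adjoint_pair M T2 R2" "adjoint_pair M T3 R3"
    and TT: "\<And>x. x \<in> M \<Longrightarrow> T2 (T1 x) = T1 (T2 x)" "\<And>x. x \<in> M \<Longrightarrow> T3 (T1 x) = T1 (T3 x)"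
      "\<And>x. x \<in> M \<Longrightarrow> T3 (T2 x) = T2 (T3 x)"
    and TR: "\<And>x. x \<in> M \<Longrightarrow> T1 (R1 x) = R1 (T1 x)" "\<And>x. x \<in> M \<Longrightarrow> T1 (R2 x) = R2 (T1 x)"
      "\<And>x. x \<in> M \<Longrightarrow> T1 (R3 x) = R3 (T1 x)" "\<And>x. x \<in> M \<Longrightarrow> T2 (R1 x) = R1 (T2 x)"
      "\<And>x. x \<in> M \<Longrightarrow> T2 (R2 x) = R2 (T2 x)" "\<And>x. x \<in> M \<Longrightarrow> T2 (R3 x) = R3 (T2 x)"
      "\<And>x. x \<in> M \<Longrightarrow> T3 (R1 x) = R1 (T3 x)" "\<And>x. x \<in> M \<Longrightarrow> T3 (R2 x) = R2 (T3 x)"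
      "\<And>x. x \<in> M \<Longrightarrow> T3 (R3 x) = R3 (T3 x)"
    and c: "0 < c" "\<And>x. x \<in> M \<Longrightarrow> c * norm x \<le> norm (T1 x) + norm (T2 x) + norm (T3 x)"
  shows "koszul_exact M T1 T2 T3"
proof -
  note T = adjoint_pairD(1)[OF adj(1)] adjoint_pairD(1)[OF adj(2)] adjoint_pairD(1)[OF adj(3)]
  note R = adjoint_pairD(2)[OF adj(1)] adjoint_pairD(2)[OF adj(2)] adjoint_pairD(2)[OF adj(3)]
  have bij: "bij_betw (\<lambda>x. R1 (T1 x) + R2 (T2 x) + R3 (T3 x)) M M"
  proof (rule coercive_bij[OF M, where e = "c\<^sup>2 / 3"])
    show "operator_on M (\<lambda>x. R1 (T1 x) + R2 (T2 x) + R3 (T3 x))"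
      by (rule op_plus[OF M op_plus[OF M op_compose[OF R(1) T(1)] op_compose[OF R(2) T(2)]]
          op_compose[OF R(3) T(3)]])
    show "0 < c\<^sup>2 / 3" using c by simp
    fix x assume x: "x \<in> M"
    have "(c * norm x)\<^sup>2 \<le> (norm (T1 x) + norm (T2 x) + norm (T3 x))\<^sup>2"
      using c(1) by (intro power_mono c(2)[OF x]) simp
    also have "\<dots> \<le> 3 * ((norm (T1 x))\<^sup>2 + (norm (T2 x))\<^sup>2 + (norm (T3 x))\<^sup>2)" by (rule square_sum3_le)
    also have "\<dots> = 3 * Re (cinner (R1 (T1 x) + R2 (T2 x) + R3 (T3 x)) x)"
      by (simp add: cinner_add_left adjoint_pair_norm(1)[OF adj(1) x] adjoint_pair_norm(1)[OF adj(2) x]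
          adjoint_pair_norm(1)[OF adj(3) x])
    finally show "c\<^sup>2 / 3 * (norm x)\<^sup>2 \<le> Re (cinner (R1 (T1 x) + R2 (T2 x) + R3 (T3 x)) x)"
      by (simp add: power_mult_distrib)
  qed
  show ?thesis by (rule koszul_exact_of_homotopy[OF M T R]) (simp_all add: TT TR bij)
qed

text \<open>The complex on \<open>N\<close> is a direct summand of the exact one: \<open>Q\<close> is a chain map onto it, so it
  carries a preimage of an element of \<open>N\<close> to a preimage in \<open>N\<close>.\<close>

lemma koszul_exact_summand:
  assumes ex: "koszul_exact UNIV A B P"
    and Q: "\<And>x. Q x \<in> N" "\<And>x. x \<in> N \<Longrightarrow> Q x = x"
      "\<And>x y. Q (x + y) = Q x + Q y" "\<And>x y. Q (x - y) = Q x - Q y"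
    and N: "0 \<in> N" "\<And>x y. x \<in> N \<Longrightarrow> y \<in> N \<Longrightarrow> x + y \<in> N" "\<And>x y. x \<in> N \<Longrightarrow> y \<in> N \<Longrightarrow> x - y \<in> N"
    and inv: "\<And>x. x \<in> N \<Longrightarrow> A x \<in> N" "\<And>x. x \<in> N \<Longrightarrow> B x \<in> N" "\<And>x. x \<in> N \<Longrightarrow> P x \<in> N"
    and QA: "\<And>x. Q (A x) = A (Q x)" "\<And>x. Q (B x) = B (Q x)" "\<And>x. Q (P x) = P (Q x)"
  shows "koszul_exact N A B P"
proof -
  let ?Q = "\<lambda>(x, y, z). (Q x, Q y, Q z)"
  have Q0: "Q 0 = 0" using Q(2) N(1) by simp
  have k0: "koszul0 A B P (Q x) = ?Q (koszul0 A B P x)" for x by (simp add: koszul0_def QA)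
  have k1: "koszul1 A B P (?Q v) = ?Q (koszul1 A B P v)" for v
    by (simp add: koszul1_def QA Q split: prod.split)
  have k2: "koszul2 A B P (?Q v) = Q (koszul2 A B P v)" for v
    by (simp add: koszul2_def QA Q split: prod.split)
  have QN: "?Q v = v" if "v \<in> N \<times> N \<times> N" for v using that Q(2) by auto
  have QN': "?Q v \<in> N \<times> N \<times> N" for v using Q(1) by (auto split: prod.split)
  have in0: "koszul0 A B P x \<in> N \<times> N \<times> N" if "x \<in> N" for x using that inv by (simp add: koszul0_def)
  have in1: "koszul1 A B P v \<in> N \<times> N \<times> N" if "v \<in> N \<times> N \<times> N" for v
    using that inv N by (auto simp: koszul1_def)
  have in2: "koszul2 A B P v \<in> N" if "v \<in> N \<times> N \<times> N" for v
    using that inv N by (auto simp: koszul2_def)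
  have ex0: "{x. koszul0 A B P x = 0} = {0}" and ex1: "{v. koszul1 A B P v = 0} = range (koszul0 A B P)"
    and ex2: "{v. koszul2 A B P v = 0} = range (koszul1 A B P)" and ex3: "range (koszul2 A B P) = UNIV"
    using ex unfolding koszul_exact_def by auto
  show ?thesis unfolding koszul_exact_def
  proof (intro conjI)
    show "{x \<in> N. koszul0 A B P x = 0} = {0}" using ex0 N(1) by blast
    show "{v \<in> N \<times> N \<times> N. koszul1 A B P v = 0} = koszul0 A B P ` N"
    proof (intro equalityI subsetI)
      fix v assume v: "v \<in> {v \<in> N \<times> N \<times> N. koszul1 A B P v = 0}"
      then obtain x where "v = koszul0 A B P x" using ex1 by blast
      then have "v = koszul0 A B P (Q x)" using k0 QN v by auto
      then show "v \<in> koszul0 A B P ` N" using Q(1) by blast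
    qed (use in0 ex1 in blast)
    show "{v \<in> N \<times> N \<times> N. koszul2 A B P v = 0} = koszul1 A B P ` (N \<times> N \<times> N)"
    proof (intro equalityI subsetI)
      fix v assume v: "v \<in> {v \<in> N \<times> N \<times> N. koszul2 A B P v = 0}"
      then obtain x where "v = koszul1 A B P x" using ex2 by blast
      then have "v = koszul1 A B P (?Q x)" using k1 QN v by auto
      then show "v \<in> koszul1 A B P ` (N \<times> N \<times> N)" using QN' by blast
    qed (use in1 ex2 in blast)
    show "N = koszul2 A B P ` (N \<times> N \<times> N)"
    proof (intro equalityI subsetI)
      fix y assume y: "y \<in> N"
      then obtain x where "y = koszul2 A B P x" using ex3 by blast
      then have "y = koszul2 A B P (?Q x)" using k2 Q(2) y by auto
      then show "y \<in> koszul2 A B P ` (N \<times> N \<times> N)" using QN' by blast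
    qed (use in2 in blast)
  qed
qed

section \<open>The tetrablock and the fundamental equations\<close>

text \<open>Membership in the tetrablock says that the affine function \<open>w \<mapsto> (1 - z x\<^sub>2) - w (x\<^sub>1 - z x\<^sub>3)\<close>
  has no zero in the closed disc, whence its slope is dominated by its constant term. The second
  bound is the same with the first two coordinates exchanged.\<close>

lemma closure_tetrablock_bound:
  assumes "(x1, x2, x3) \<in> closure tetrablock" "cmod z \<le> 1"
  shows "cmod (x1 - z * x3) \<le> cmod (1 - z * x2)" "cmod (x2 - z * x3) \<le> cmod (1 - z * x1)"
proof -
  have nz: "cmod d \<le> cmod n" if "\<And>w. cmod w \<le> 1 \<Longrightarrow> n - w * d \<noteq> 0" for n d :: complex
  proof (rule ccontr)
    assume "\<not> cmod d \<le> cmod n"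
    then show False using that[of "n / d"] by (cases "d = 0") (auto simp: norm_divide divide_simps)
  qed
  have "closure tetrablock \<subseteq> {x. cmod (fst x - z * snd (snd x)) \<le> cmod (1 - z * fst (snd x))}"
  proof (rule closure_minimal)
    show "tetrablock \<subseteq> {x. cmod (fst x - z * snd (snd x)) \<le> cmod (1 - z * fst (snd x))}"
    proof
      fix x assume "x \<in> tetrablock"
      then obtain a b c where x: "x = (a, b, c)"
        and t: "\<And>v w. cmod v \<le> 1 \<Longrightarrow> cmod w \<le> 1 \<Longrightarrow> 1 - v * a - w * b + v * w * c \<noteq> 0"
        by (cases x) (auto simp: tetrablock_def)
      have "cmod (a - z * c) \<le> cmod (1 - z * b)"
        by (rule nz) (use t[OF _ assms(2)] in \<open>simp add: algebra_simps\<close>)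
      then show "x \<in> {x. cmod (fst x - z * snd (snd x)) \<le> cmod (1 - z * fst (snd x))}" by (simp add: x)
    qed
    show "closed {x :: complex \<times> complex \<times> complex. cmod (fst x - z * snd (snd x)) \<le> cmod (1 - z *
        fst (snd x))}"
      by (intro closed_Collect_le continuous_intros)
  qed
  then show "cmod (x1 - z * x3) \<le> cmod (1 - z * x2)" using assms(1) by auto
  have "closure tetrablock \<subseteq> {x. cmod (fst (snd x) - z * snd (snd x)) \<le> cmod (1 - z * fst x)}"
  proof (rule closure_minimal)
    show "tetrablock \<subseteq> {x. cmod (fst (snd x) - z * snd (snd x)) \<le> cmod (1 - z * fst x)}"
    proof
      fix x assume "x \<in> tetrablock"
      then obtain a b c where x: "x = (a, b, c)"
        and t: "\<And>v w. cmod v \<le> 1 \<Longrightarrow> cmod w \<le> 1 \<Longrightarrow> 1 - v * a - w * b + v * w * c \<noteq> 0"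
        by (cases x) (auto simp: tetrablock_def)
      have "cmod (b - z * c) \<le> cmod (1 - z * a)"
        by (rule nz) (use t[OF assms(2)] in \<open>simp add: algebra_simps\<close>)
      then show "x \<in> {x. cmod (fst (snd x) - z * snd (snd x)) \<le> cmod (1 - z * fst x)}" by (simp add: x)
    qed
    show "closed {x :: complex \<times> complex \<times> complex. cmod (fst (snd x) - z * snd (snd x)) \<le> cmod (1 -
        z * fst x)}"
      by (intro closed_Collect_le continuous_intros)
  qed
  then show "cmod (x2 - z * x3) \<le> cmod (1 - z * x1)" using assms(1) by auto
qed

lemma closure_tetrablock_coord_le_1:
  assumes "(x1, x2, x3) \<in> closure tetrablock" shows "cmod x1 \<le> 1" "cmod x2 \<le> 1"
  using closure_tetrablock_bound[OF assms, of 0] by simp_all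

text \<open>The dilates \<open>(r a, r b, r\<^sup>2 p)\<close> with \<open>r < 1\<close> lie in the tetrablock, because \<open>\<bar>1 - w b\<bar>\<^sup>2 - \<bar>b\<^sup>*
  - w\<bar>\<^sup>2 = (1 - \<bar>b\<bar>\<^sup>2) (1 - \<bar>w\<bar>\<^sup>2) \<ge> 0\<close> on the disc.\<close>

lemma b_tetrablockI:
  assumes p: "cmod p = 1" and a: "a = cnj b * p" and b: "cmod b \<le> 1"
  shows "(a, b, p) \<in> b_tetrablock"
proof -
  have pick: "cmod (a - w * p) \<le> cmod (1 - w * b)" if "cmod w \<le> 1" for w
  proof -
    have "(cmod (1 - w * b))\<^sup>2 - (cmod (cnj b - w))\<^sup>2 = (1 - (cmod b)\<^sup>2) * (1 - (cmod w)\<^sup>2)"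
      unfolding cmod_power2 by (simp add: power2_eq_square algebra_simps)
    moreover have "0 \<le> (1 - (cmod b)\<^sup>2) * (1 - (cmod w)\<^sup>2)"
      using b that by (intro mult_nonneg_nonneg) (auto simp: power_le_one)
    ultimately have "(cmod (cnj b - w))\<^sup>2 \<le> (cmod (1 - w * b))\<^sup>2" by linarith
    then have "cmod (cnj b - w) \<le> cmod (1 - w * b)" by (rule power2_le_imp_le) simp
    moreover have "a - w * p = (cnj b - w) * p" by (simp add: a algebra_simps)
    ultimately show ?thesis by (simp add: norm_mult p)
  qed
  have E: "(r * a, r * b, r\<^sup>2 * p) \<in> tetrablock" if r: "cmod r < 1" for r
  proof -
    have "1 - z * (r * a) - w * (r * b) + z * w * (r\<^sup>2 * p) \<noteq> 0" if z: "cmod z \<le> 1" and w: "cmod w \<le>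
        1" for z w
    proof
      assume "1 - z * (r * a) - w * (r * b) + z * w * (r\<^sup>2 * p) = 0"
      then have eq: "1 - (w * r) * b = (z * r) * (a - (w * r) * p)"
        by (simp add: algebra_simps power2_eq_square)
      have zr: "cmod (z * r) < 1" and wr: "cmod (w * r) < 1"
        using z w r mult_left_le_one_le[of "cmod r" "cmod z"] mult_left_le_one_le[of "cmod r" "cmod w"]
        by (simp_all add: norm_mult)
      have "cmod (w * r * b) < 1"
        using wr b mult_left_le[of "cmod b" "cmod (w * r)"] by (simp add: norm_mult)
      then have nz: "1 - (w * r) * b \<noteq> 0" by auto
      have "cmod (1 - (w * r) * b) \<le> cmod (z * r) * cmod (1 - (w * r) * b)"
        using pick[OF less_imp_le[OF wr]] unfolding eq[symmetric]
        by (metis eq mult_left_mono norm_ge_zero norm_mult)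
      also have "\<dots> < 1 * cmod (1 - (w * r) * b)" using zr nz by (intro mult_strict_right_mono) auto
      finally show False by simp
    qed
    then show ?thesis by (simp add: tetrablock_def)
  qed
  define r where "r n = complex_of_real (real n / real (Suc n))" for n
  have r1: "cmod (r n) < 1" for n unfolding r_def norm_of_real by (simp add: divide_simps)
  have "r \<longlonglongrightarrow> complex_of_real 1" unfolding r_def by (intro tendsto_of_real LIMSEQ_n_over_Suc_n)
  then have "(\<lambda>n. (r n * a, r n * b, (r n)\<^sup>2 * p)) \<longlonglongrightarrow> (of_real 1 * a, of_real 1 * b, (of_real 1)\<^sup>2 * p)"
    by (intro tendsto_intros)
  then have "(\<lambda>n. (r n * a, r n * b, (r n)\<^sup>2 * p)) \<longlonglongrightarrow> (a, b, p)" by simp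
  then have "(a, b, p) \<in> closure tetrablock"
    unfolding closure_sequential
    by (intro exI[of _ "\<lambda>n. (r n * a, r n * b, (r n)\<^sup>2 * p)"] conjI allI E r1)
  then show ?thesis using p by (simp add: b_tetrablock_def)
qed

lemma poly3_two_terms:
  assumes "m \<noteq> m'"
  shows "poly3_eval (Poly_Mapping.single m c + Poly_Mapping.single m' d) w =
      poly3_eval (Poly_Mapping.single m c) w + poly3_eval (Poly_Mapping.single m' d) w"
    and "poly3_op (Poly_Mapping.single m c + Poly_Mapping.single m' d) A B P x =
      poly3_op (Poly_Mapping.single m c) A B P x + poly3_op (Poly_Mapping.single m' d) A B P x"
proof -
  let ?q = "Poly_Mapping.single m c + Poly_Mapping.single m' d"
  have fin: "finite {m, m'}" by simp
  have k: "Poly_Mapping.keys ?q \<subseteq> {m, m'}" "Poly_Mapping.keys (Poly_Mapping.single m c) \<subseteq> {m, m'}"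
    "Poly_Mapping.keys (Poly_Mapping.single m' d) \<subseteq> {m, m'}"
    using Poly_Mapping.keys_add[of "Poly_Mapping.single m c" "Poly_Mapping.single m' d"] by (auto
        split: if_splits)
  have ev: "poly3_eval q (z1, z2, z3) = (\<Sum>(i, j, k)\<in>{m, m'}. Poly_Mapping.lookup q (i, j, k) * z1 ^
      i * z2 ^ j * z3 ^ k)"
    if "Poly_Mapping.keys q \<subseteq> {m, m'}" for q z1 z2 z3
    unfolding poly3_eval_def prod.case
    by (rule sum.mono_neutral_left[OF fin that]) (auto simp: in_keys_iff)
  have op: "poly3_op q A B P x = (\<Sum>(i, j, k)\<in>{m, m'}. Poly_Mapping.lookup q (i, j, k) *\<^sub>C (A ^^ i)
      ((B ^^ j) ((P ^^ k) x)))"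
    if "Poly_Mapping.keys q \<subseteq> {m, m'}" for q
    unfolding poly3_op_def
    by (rule sum.mono_neutral_left[OF fin that]) (auto simp: in_keys_iff scaleC_zero_left)
  obtain i j k i' j' k' where m: "m = (i, j, k)" "m' = (i', j', k')" by (metis prod_cases3)
  obtain z1 z2 z3 where w: "w = (z1, z2, z3)" by (metis prod_cases3)
  show "poly3_eval ?q w = poly3_eval (Poly_Mapping.single m c) w + poly3_eval (Poly_Mapping.single
      m' d) w"
    unfolding w ev[OF k(1)] ev[OF k(2)] ev[OF k(3)]
    using assms by (simp add: m lookup_add lookup_single_not_eq distrib_right)
  show "poly3_op ?q A B P x = poly3_op (Poly_Mapping.single m c) A B P x + poly3_op
      (Poly_Mapping.single m' d) A B P x"
    unfolding op[OF k(1)] op[OF k(2)] op[OF k(3)]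
    using assms by (simp add: m lookup_add lookup_single_not_eq scaleC_zero_left scaleC_add_left)
qed

lemma poly3_single:
  "poly3_eval (Poly_Mapping.single (i, j, k) c) (z1, z2, z3) = c * z1 ^ i * z2 ^ j * z3 ^ k"
  "poly3_op (Poly_Mapping.single (i, j, k) c) A B P x = c *\<^sub>C (A ^^ i) ((B ^^ j) ((P ^^ k) x))"
  by (cases "c = 0"; simp add: poly3_eval_def poly3_op_def scaleC_zero_left)+

text \<open>A spectral set turns a pointwise inequality \<open>\<bar>r\<bar> \<le> \<bar>q\<bar>\<close> into an operator inequality, via the
  rational function \<open>r / q\<close>.\<close>

lemma spectral_set_norm_le:
  assumes ss: "spectral_set K UNIV A B P" and "K \<noteq> {}"
    and q: "\<And>w. w \<in> K \<Longrightarrow> poly3_eval q w \<noteq> 0"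
    and le: "\<And>w. w \<in> K \<Longrightarrow> cmod (poly3_eval r w) \<le> cmod (poly3_eval q w)"
  shows "norm (poly3_op r A B P x) \<le> norm (poly3_op q A B P x)"
proof -
  have b: "bij_betw (poly3_op q A B P) UNIV UNIV"
    and n: "norm (poly3_op r A B P (inv_into UNIV (poly3_op q A B P) y))
        \<le> (SUP z\<in>K. cmod (poly3_eval r z / poly3_eval q z)) * norm y" for y
    using ss q unfolding spectral_set_def by blast+
  have "(SUP z\<in>K. cmod (poly3_eval r z / poly3_eval q z)) \<le> 1"
    using q le by (intro cSUP_least \<open>K \<noteq> {}\<close>) (simp add: norm_divide divide_simps)
  moreover have "inv_into UNIV (poly3_op q A B P) (poly3_op q A B P x) = x"
    using b by (simp add: bij_betw_def inv_f_f)
  ultimately show ?thesis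
    using n[of "poly3_op q A B P x"] mult_right_mono[of _ 1 "norm (poly3_op q A B P x)"] by fastforce
qed

text \<open>The rational functions used are \<open>(x\<^sub>1 - z x\<^sub>3) / (1 - z x\<^sub>2)\<close> and \<open>(x\<^sub>2 - z x\<^sub>3) / (1 - z x\<^sub>1)\<close>;
  for \<open>\<bar>z\<bar> < 1\<close> their poles stay off the closed tetrablock because its first two coordinates lie
  in the closed disc.\<close>

lemma E_contraction_norm_le_disc:
  assumes E: "E_contraction UNIV A B P" and z: "cmod z < 1"
  shows "norm (A h - z *\<^sub>C P h) \<le> norm (h - z *\<^sub>C B h)"
    and "norm (B h - z *\<^sub>C P h) \<le> norm (h - z *\<^sub>C A h)"
proof -
  have ss: "spectral_set (closure tetrablock) UNIV A B P" using E by (simp add: E_contraction_def)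
  have "(0, 0, 0) \<in> tetrablock" by (simp add: tetrablock_def)
  then have ne: "closure tetrablock \<noteq> {}" using closure_subset by blast
  have nz: "z * y \<noteq> 1" if "cmod y \<le> 1" for y
  proof -
    have "cmod (z * y) < 1" using z that mult_left_le[of "cmod y" "cmod z"] by (simp add: norm_mult)
    then show ?thesis by auto
  qed
  have nz': "z * x \<noteq> 1" "z * y \<noteq> 1" if "(x, y, p) \<in> closure tetrablock" for x y p
    using nz closure_tetrablock_coord_le_1[OF that] by auto
  let ?s = "Poly_Mapping.single :: nat \<times> nat \<times> nat \<Rightarrow> complex \<Rightarrow> poly3"
  have "norm (poly3_op (?s (1,0,0) 1 + ?s (0,0,1) (-z)) A B P h) \<le> norm (poly3_op (?s (0,0,0) 1 + ?s
      (0,1,0) (-z)) A B P h)"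
    by (rule spectral_set_norm_le[OF ss ne])
       (use z in \<open>auto simp: poly3_two_terms poly3_single closure_tetrablock_bound dest: nz'\<close>)
  then show "norm (A h - z *\<^sub>C P h) \<le> norm (h - z *\<^sub>C B h)"
    by (simp add: poly3_two_terms poly3_single scaleC_one scaleC_minus_left)
  have "norm (poly3_op (?s (0,1,0) 1 + ?s (0,0,1) (-z)) A B P h) \<le> norm (poly3_op (?s (0,0,0) 1 + ?s
      (1,0,0) (-z)) A B P h)"
    by (rule spectral_set_norm_le[OF ss ne])
       (use z in \<open>auto simp: poly3_two_terms poly3_single closure_tetrablock_bound dest: nz'\<close>)
  then show "norm (B h - z *\<^sub>C P h) \<le> norm (h - z *\<^sub>C A h)"
    by (simp add: poly3_two_terms poly3_single scaleC_one scaleC_minus_left)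
qed

lemma norm_le_on_closed_disc:
  fixes x y u v :: "'a::complex_inner"
  assumes le: "\<And>z. cmod z < 1 \<Longrightarrow> norm (x - z *\<^sub>C y) \<le> norm (u - z *\<^sub>C v)" and z: "cmod z \<le> 1"
  shows "norm (x - z *\<^sub>C y) \<le> norm (u - z *\<^sub>C v)"
proof -
  define r where "r n = real n / real (Suc n)" for n
  have r: "r \<longlonglongrightarrow> 1" unfolding r_def by (rule LIMSEQ_n_over_Suc_n)
  have lim: "(\<lambda>n. norm (a - r n *\<^sub>R (z *\<^sub>C b))) \<longlonglongrightarrow> norm (a - 1 *\<^sub>R (z *\<^sub>C b))" for a b :: 'a
    by (intro tendsto_intros r)
  have "norm (x - r n *\<^sub>R (z *\<^sub>C y)) \<le> norm (u - r n *\<^sub>R (z *\<^sub>C v))" for n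
  proof -
    have "cmod (of_real (r n) * z) < 1"
      using z by (simp add: r_def norm_mult divide_simps del: of_real_divide)
        (metis mult_left_le of_nat_0_le_iff less_add_one add.commute le_less_trans)
    from le[OF this] show ?thesis by (simp add: scaleC_scaleC[symmetric] scaleC_of_real)
  qed
  then show ?thesis using LIMSEQ_le[OF lim lim] by fastforce
qed

lemma adjoint_norm_le:
  assumes adj: "adjoint_pair M T S" and c: "\<And>x. x \<in> M \<Longrightarrow> norm (T x) \<le> norm x" and y: "y \<in> M"
  shows "norm (S y) \<le> norm y"
proof -
  have Sy: "S y \<in> M" using adjoint_pairD(2)[OF adj] y by (rule op_in)
  have "(norm (S y))\<^sup>2 = Re (cinner (T (S y)) y)"
    by (rule adjoint_pair_norm(1)[OF adjoint_pair_sym[OF adj] y])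
  also have "\<dots> \<le> norm (T (S y)) * norm y"
    using complex_Re_le_cmod norm_cinner_le by (rule order_trans)
  also have "\<dots> \<le> norm (S y) * norm y" using c[OF Sy] by (simp add: mult_right_mono)
  finally show ?thesis
    by (cases "norm (S y) = 0") (auto simp: power2_eq_square mult_le_cancel_left)
qed

lemma contraction_isometric_vector:
  assumes adj: "adjoint_pair M T S" and c: "\<And>x. x \<in> M \<Longrightarrow> norm (T x) \<le> norm x"
    and h: "h \<in> M" "norm (T h) = norm h"
  shows "S (T h) = h"
proof -
  have "norm (S (T h)) \<le> norm h"
    using adjoint_norm_le[OF adj c op_in[OF adjoint_pairD(1)[OF adj] h(1)]] h(2) by simp
  then have "(norm (S (T h)))\<^sup>2 \<le> (norm h)\<^sup>2" by (simp add: power_mono)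
  moreover have "Re (cinner (S (T h)) h) = (norm h)\<^sup>2"
    using adjoint_pair_norm(1)[OF adj h(1)] unfolding h(2) by (rule sym)
  ultimately have "(norm (S (T h) - h))\<^sup>2 \<le> 0"
    unfolding norm_diff_sq by linarith
  then show ?thesis by simp
qed

text \<open>The two inequalities add up to \<open>\<bar>\<langle>(A - B\<^sup>* P) x, x\<rangle>\<bar> \<le> \<parallel>x\<parallel>\<^sup>2 - \<parallel>P x\<parallel>\<^sup>2\<close>. The right-hand side is
  a positive semidefinite form with \<open>h\<close> in its kernel. Along \<open>h + s y\<close> it is therefore of order
  \<open>s\<^sup>2\<close>, so the terms of order \<open>s\<close> on the left vanish: \<open>A h = B\<^sup>* P h\<close> and \<open>A\<^sup>* h = P\<^sup>* B h\<close>,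
  expressed here without adjoints.\<close>

lemma fundamental_equations:
  fixes A B P :: "'a::chilbert_space \<Rightarrow> 'a"
  assumes op: "operator_on UNIV A" "operator_on UNIV B" "adjoint_pair UNIV P P'"
    and N1: "\<And>h u. cmod u = 1 \<Longrightarrow> norm (A h - u *\<^sub>C P h) \<le> norm (h - u *\<^sub>C B h)"
    and N2: "\<And>h u. cmod u = 1 \<Longrightarrow> norm (B h - u *\<^sub>C P h) \<le> norm (h - u *\<^sub>C A h)"
    and P: "\<And>x. norm (P x) \<le> norm x" and h: "norm (P h) = norm h"
  shows "cinner (A h) y = cinner (P h) (B y)" and "cinner (A y) h = cinner (P y) (B h)"
proof -
  note opP = adjoint_pairD(1)[OF op(3)]
  note lin = op_add[OF op(1) UNIV_I UNIV_I] op_add[OF op(2) UNIV_I UNIV_I] op_add[OF opP UNIV_I UNIV_I]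
    op_scaleC[OF op(1) UNIV_I] op_scaleC[OF op(2) UNIV_I] op_scaleC[OF opP UNIV_I]
  define \<alpha> where "\<alpha> x y = cinner (A x) y - cinner (P x) (B y)" for x y
  have form_le: "Re (v * \<alpha> x x) \<le> (norm x)\<^sup>2 - (norm (P x))\<^sup>2" if v: "cmod v = 1" for v x
  proof -
    have cross: "Re (cinner a (u *\<^sub>C b)) = Re (u * cinner b a)" for a b :: 'a and u
      by (metis cinner_commute cinner_scaleC_left cnj.sel(1))
    have n1: "(norm (A x))\<^sup>2 + (norm (P x))\<^sup>2 - 2 * Re (u * cinner (P x) (A x))
        \<le> (norm x)\<^sup>2 + (norm (B x))\<^sup>2 - 2 * Re (u * cinner (B x) x)" if u: "cmod u = 1" for u
      using power_mono[OF N1[OF u, of x] norm_ge_zero, of 2] u by (simp add: norm_diff_sq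
          norm_scaleC cross)
    have n2: "(norm (B x))\<^sup>2 + (norm (P x))\<^sup>2 - 2 * Re (v * cinner (P x) (B x))
        \<le> (norm x)\<^sup>2 + (norm (A x))\<^sup>2 - 2 * Re (v * cinner (A x) x)"
      using power_mono[OF N2[OF v, of x] norm_ge_zero, of 2] v by (simp add: norm_diff_sq
          norm_scaleC cross)
    have "Re (v * \<alpha> x x) = Re (v * cinner (A x) x) - Re (v * cinner (P x) (B x))"
      by (simp add: \<alpha>_def right_diff_distrib)
    \<comment> \<open>The cases \<open>u = 1\<close> and \<open>u = -1\<close> of \<open>n1\<close> average to a bound on \<open>\<parallel>A x\<parallel>\<^sup>2 - \<parallel>B x\<parallel>\<^sup>2\<close>.\<close>
    with n1[of 1] n1[of "-1"] n2 show ?thesis by simp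
  qed
  have \<alpha>hh: "\<alpha> h h = 0"
    by (rule Re_unimodular_le_zero) (use form_le[of _ h] h in simp)
  have hP: "cinner (P h) (P y) = cinner h y" for y
    using adjoint_pairD(3)[OF adjoint_pair_sym[OF op(3)], of "P h" y]
      contraction_isometric_vector[OF op(3) P _ h] by simp
  have sym: "\<alpha> h y + \<alpha> y h = 0" for y
  proof (rule Re_unimodular_le_zero)
    fix v :: complex assume v: "cmod v = 1"
    define g where "g = Re (v * (\<alpha> h y + \<alpha> y h))"
    define c where "c = (norm y)\<^sup>2 - (norm (P y))\<^sup>2 - Re (v * \<alpha> y y)"
    have bound: "g \<le> s * c" if s: "0 < s" for s
    proof -
      let ?x = "h + of_real s *\<^sub>C y"
      have "\<alpha> ?x ?x = \<alpha> h h + of_real s * (\<alpha> h y + \<alpha> y h) + of_real (s\<^sup>2) * \<alpha> y y"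
        by (simp add: \<alpha>_def lin cinner_simps algebra_simps power2_eq_square)
      then have "Re (v * \<alpha> ?x ?x) = s * g + s\<^sup>2 * Re (v * \<alpha> y y)"
        by (simp add: \<alpha>hh g_def algebra_simps power2_eq_square)
      moreover have "(norm ?x)\<^sup>2 - (norm (P ?x))\<^sup>2 = s\<^sup>2 * ((norm y)\<^sup>2 - (norm (P y))\<^sup>2)"
        using s by (simp add: lin norm_plus_sq norm_scaleC cinner_simps hP h power_mult_distrib
            right_diff_distrib)
      ultimately have "s * g \<le> s * (s * c)"
        using form_le[OF v, of ?x] by (simp add: c_def algebra_simps power2_eq_square)
      then show ?thesis using s by simp
    qed
    have "g \<le> 0"
    proof (rule ccontr)
      assume "\<not> g \<le> 0"
      then have g: "0 < g" by simp
      \<comment> \<open>A choice of \<open>s\<close> for which \<open>s \<bar>c\<bar> < g\<close>.\<close>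
      have "g \<le> g / (\<bar>c\<bar> + 1) * c" using g by (intro bound) simp
      also have "\<dots> \<le> g / (\<bar>c\<bar> + 1) * \<bar>c\<bar>" using g by (intro mult_left_mono) auto
      also have "\<dots> < g" using g by (simp add: field_simps)
      finally show False by simp
    qed
    then show "Re (v * (\<alpha> h y + \<alpha> y h)) \<le> 0" by (simp add: g_def)
  qed
  \<comment> \<open>Replacing \<open>y\<close> by \<open>\<i> y\<close> separates the antilinear summand of \<open>sym\<close> from the linear one.\<close>
  have "\<alpha> h (\<i> *\<^sub>C y) = - \<i> * \<alpha> h y" "\<alpha> (\<i> *\<^sub>C y) h = \<i> * \<alpha> y h"
    by (simp_all add: \<alpha>_def lin cinner_simps algebra_simps)
  then have "\<i> * (\<alpha> y h - \<alpha> h y) = 0" using sym[of "\<i> *\<^sub>C y"] by (simp add: algebra_simps)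
  then have "\<alpha> h y = 0" "\<alpha> y h = 0" using sym[of y] by auto
  then show "cinner (A h) y = cinner (P h) (B y)" "cinner (A y) h = cinner (P y) (B h)"
    by (simp_all add: \<alpha>_def)
qed

section \<open>A criterion for tetrablock unitaries\<close>

lemma commute_minus_scaleC:
  assumes M: "closed_csubspace M" and S: "operator_on M S" and T: "operator_on M T"
    and c: "S (T x) = T (S x)" and x: "x \<in> M"
  shows "S (T x - b *\<^sub>C x) - a *\<^sub>C (T x - b *\<^sub>C x) = T (S x - a *\<^sub>C x) - b *\<^sub>C (S x - a *\<^sub>C x)"
proof -
  have "S (T x - b *\<^sub>C x) = S (T x) - b *\<^sub>C S x" "T (S x - a *\<^sub>C x) = T (S x) - a *\<^sub>C T x"
    using x by (simp_all add: op_diff[OF M S] op_diff[OF M T] op_in[OF S] op_in[OF T] csub_scaleC[OF M]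
        op_scaleC[OF S] op_scaleC[OF T])
  then show ?thesis by (simp add: c scaleC_diff_right scaleC_scaleC mult.commute algebra_simps)
qed

text \<open>Since \<open>A\<^sup>* = B U\<^sup>*\<close> and \<open>B\<^sup>* = A U\<^sup>*\<close>, all operators and adjoints are expressions in the
  commuting operators \<open>A\<close>, \<open>B\<close>, \<open>U\<close>, \<open>U\<^sup>*\<close>; this gives normality. The same relations, evaluated on
  approximate joint eigenvectors, give together with \<open>\<parallel>B\<parallel> \<le> 1\<close> that \<open>\<bar>p\<bar> = 1\<close>, \<open>\<bar>b\<bar> \<le> 1\<close> and \<open>a =
  b\<^sup>* p\<close> for every point \<open>(a, b, p)\<close> of the spectrum, and such points lie in the distinguished
  boundary.\<close>

lemma E_unitary_criterion:
  assumes K: "closed_csubspace K"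
    and adj: "adjoint_pair K A A'" "adjoint_pair K B B'" "adjoint_pair K U U'"
    and UU: "\<And>x. x \<in> K \<Longrightarrow> U' (U x) = x" "\<And>x. x \<in> K \<Longrightarrow> U (U' x) = x"
    and AB: "\<And>x. x \<in> K \<Longrightarrow> A (B x) = B (A x)" and AU: "\<And>x. x \<in> K \<Longrightarrow> A (U x) = U (A x)"
    and BU: "\<And>x. x \<in> K \<Longrightarrow> B (U x) = U (B x)"
    and A': "\<And>x. x \<in> K \<Longrightarrow> A' x = B (U' x)" and B': "\<And>x. x \<in> K \<Longrightarrow> B' x = A (U' x)"
    and nB: "\<And>x. x \<in> K \<Longrightarrow> norm (B x) \<le> norm x"
  shows "E_unitary K A B U"
proof -
  note ops = adjoint_pairD(1)[OF adj(1)] adjoint_pairD(1)[OF adj(2)] adjoint_pairD(1)[OF adj(3)]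
  note ops' = adjoint_pairD(2)[OF adj(1)] adjoint_pairD(2)[OF adj(2)] adjoint_pairD(2)[OF adj(3)]
  note inK = op_in[OF ops(1)] op_in[OF ops(2)] op_in[OF ops(3)]
    op_in[OF ops'(1)] op_in[OF ops'(2)] op_in[OF ops'(3)]
  have AU': "A (U' x) = U' (A x)" if "x \<in> K" for x
    using UU(1)[OF inK(1)[OF inK(6)[OF that]]] AU[OF inK(6)[OF that]] UU(2)[OF that] by simp
  have BU': "B (U' x) = U' (B x)" if "x \<in> K" for x
    using UU(1)[OF inK(2)[OF inK(6)[OF that]]] BU[OF inK(6)[OF that]] UU(2)[OF that] by simp
  have comm: "A (A' x) = A' (A x)" "A (B' x) = B' (A x)" "B (A' x) = A' (B x)" "B (B' x) = B' (B x)"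
    "U (A' x) = A' (U x)" "U (B' x) = B' (U x)" "U (U' x) = U' (U x)" if x: "x \<in> K" for x
    using x by (simp_all add: A' B' AB AU' BU' AU BU UU inK)
  have normal: "normal_on K A" "normal_on K B" "normal_on K U"
    unfolding normal_on_def commute_on_def
    using comm ops inK by (simp_all add: adjoint_pair_eq[OF K adj(1)] adjoint_pair_eq[OF K adj(2)]
        adjoint_pair_eq[OF K adj(3)])
  have triple: "commuting_triple K A B U"
    unfolding commuting_triple_def commute_on_def using ops AB AU BU by simp
  have nU: "norm (U x) = norm x" if "x \<in> K" for x
  proof -
    have "(norm (U x))\<^sup>2 = (norm x)\<^sup>2"
      using adjoint_pair_norm(1)[OF adj(3) that] UU(1)[OF that] by (simp add: cinner_self)
    then show ?thesis by (simp add: power2_eq_iff_nonneg)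
  qed
  have nB': "norm (B' x) \<le> norm x" if "x \<in> K" for x by (rule adjoint_norm_le[OF adj(2) nB that])
  have "taylor_spectrum K A B U \<subseteq> b_tetrablock"
  proof
    fix s assume s: "s \<in> taylor_spectrum K A B U"
    obtain a b p where abp: "s = (a, b, p)" by (metis prod_cases3)
    let ?A = "\<lambda>x. A x - a *\<^sub>C x" and ?B = "\<lambda>x. B x - b *\<^sub>C x" and ?U = "\<lambda>x. U x - p *\<^sub>C x"
    let ?A' = "\<lambda>x. A' x - cnj a *\<^sub>C x" and ?B' = "\<lambda>x. B' x - cnj b *\<^sub>C x" and ?U' = "\<lambda>x. U' x - cnj
        p *\<^sub>C x"
    have nex: "\<not> koszul_exact K ?A ?B ?U" using s by (simp add: taylor_spectrum_def abp)
    have no_bound: "\<not> (\<forall>x\<in>K. c * norm x \<le> norm (?A x) + norm (?B x) + norm (?U x))" if c: "0 < c" for c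
    proof
      assume bound: "\<forall>x\<in>K. c * norm x \<le> norm (?A x) + norm (?B x) + norm (?U x)"
      have "koszul_exact K ?A ?B ?U"
      proof (rule koszul_exact_if_bounded_below[OF K, where c = c and ?R1.0 = ?A' and ?R2.0 = ?B'
          and ?R3.0 = ?U'])
        show "adjoint_pair K ?A ?A'" "adjoint_pair K ?B ?B'" "adjoint_pair K ?U ?U'"
          by (intro adjoint_pair_minus_scaleC[OF K] adj)+
        show "0 < c" by (rule c)
        show "c * norm x \<le> norm (?A x) + norm (?B x) + norm (?U x)" if "x \<in> K" for x
          using bound that by blast
      qed (rule commute_minus_scaleC[OF K]; (simp add: ops ops' AB AU BU AU' BU' comm)?)+
      then show False using nex by contradiction
    qed
    have p: "cmod p = 1"
    proof (rule ccontr)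
      assume "cmod p \<noteq> 1"
      moreover have "\<bar>1 - cmod p\<bar> * norm x \<le> norm (?A x) + norm (?B x) + norm (?U x)" if "x \<in> K" for x
      proof -
        have "norm (U x) - norm (p *\<^sub>C x) = (1 - cmod p) * norm x"
          using nU[OF that] by (simp add: norm_scaleC left_diff_distrib)
        then have "\<bar>1 - cmod p\<bar> * norm x = \<bar>norm (U x) - norm (p *\<^sub>C x)\<bar>"
          by (simp add: abs_mult)
        also have "\<dots> \<le> norm (?U x)" by (rule norm_triangle_ineq3)
        finally show ?thesis using norm_ge_zero[of "?A x"] norm_ge_zero[of "?B x"] by linarith
      qed
      ultimately show False using no_bound[of "\<bar>1 - cmod p\<bar>"] by auto
    qed
    have b: "cmod b \<le> 1"
    proof (rule ccontr)
      assume "\<not> cmod b \<le> 1"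
      moreover have "(cmod b - 1) * norm x \<le> norm (?A x) + norm (?B x) + norm (?U x)" if "x \<in> K" for x
      proof -
        have "(cmod b - 1) * norm x \<le> norm (b *\<^sub>C x) - norm (B x)"
          using nB[OF that] by (simp add: norm_scaleC left_diff_distrib)
        also have "\<dots> \<le> norm (?B x)" by (metis norm_minus_commute norm_triangle_ineq2)
        finally show ?thesis using norm_ge_zero[of "?A x"] norm_ge_zero[of "?U x"] by linarith
      qed
      ultimately show False using no_bound[of "cmod b - 1"] by auto
    qed
    have a: "a = cnj b * p"
    proof (rule ccontr)
      assume ne: "a \<noteq> cnj b * p"
      have "cmod (a - cnj b * p) * norm x \<le> norm (?A x) + norm (?B x) + norm (?U x)" if x: "x \<in> K" for x
      proof -
        have Ax: "A x = B' (U x)" using x by (simp add: B' inK UU)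
        have "B' (?U x) = B' (U x) - p *\<^sub>C B' x"
          using x by (simp add: op_diff[OF K ops'(2)] op_scaleC[OF ops'(2)] inK csub_scaleC[OF K])
        \<comment> \<open>From \<open>A = B\<^sup>* U\<close>: the scalar \<open>a - b\<^sup>* p\<close> is expressed through the three shifted operators.\<close>
        then have "(a - cnj b * p) *\<^sub>C x = - ?A x + (B' (?U x) + p *\<^sub>C ?B' x)"
          by (simp add: Ax scaleC_diff_left scaleC_diff_right scaleC_scaleC mult.commute)
        then have "cmod (a - cnj b * p) * norm x = norm (- ?A x + (B' (?U x) + p *\<^sub>C ?B' x))"
          by (simp flip: norm_scaleC)
        also have "\<dots> \<le> norm (?A x) + (norm (B' (?U x)) + norm (p *\<^sub>C ?B' x))"
          using norm_triangle_ineq[of "- ?A x" "B' (?U x) + p *\<^sub>C ?B' x"]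
            norm_triangle_ineq[of "B' (?U x)" "p *\<^sub>C ?B' x"] unfolding norm_minus_cancel by linarith
        also have "norm (p *\<^sub>C ?B' x) = norm (?B x)"
          using normal_norm_eq[OF adjoint_pair_minus_scaleC[OF K adj(2), of b], of x] x p
            commute_minus_scaleC[OF K ops'(2) ops(2), of _ b "cnj b"] comm(4)
          by (simp add: norm_scaleC)
        also have "norm (B' (?U x)) \<le> norm (?U x)"
          using x by (intro nB' csub_diff[OF K] inK csub_scaleC[OF K])
        finally show ?thesis by simp
      qed
      then show False using no_bound[of "cmod (a - cnj b * p)"] ne by auto
    qed
    show "s \<in> b_tetrablock" unfolding abp by (rule b_tetrablockI[OF p a b])
  qed
  then show ?thesis unfolding E_unitary_def using triple normal by blast
qed

section \<open>Block operators on square-summable sequences\<close>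

lemma ell2_nth_le_norm: "norm (ell2_nth f n) \<le> norm f"
proof -
  have "(norm (ell2_nth f n))\<^sup>2 \<le> (\<Sum>k<Suc n. (norm (ell2_nth f k))\<^sup>2)"
    by (simp add: sum_nonneg)
  also have "\<dots> \<le> (norm f)\<^sup>2" unfolding norm_ell2_sq by (intro sum_le_suminf summable_ell2) auto
  finally show ?thesis by (rule power2_le_imp_le) simp
qed

lemma ell2_nth_tendsto: "X \<longlonglongrightarrow> f \<Longrightarrow> (\<lambda>k. ell2_nth (X k) n) \<longlonglongrightarrow> ell2_nth f n"
proof (rule LIM_zero_cancel, rule Lim_null_comparison)
  assume X: "X \<longlonglongrightarrow> f"
  show "\<forall>\<^sub>F k in sequentially. norm (ell2_nth (X k) n - ell2_nth f n) \<le> norm (X k - f)"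
    unfolding ell2_nth_diff[symmetric] by (simp add: ell2_nth_le_norm)
  show "(\<lambda>k. norm (X k - f)) \<longlonglongrightarrow> 0" using X by (intro tendsto_norm_zero LIM_zero)
qed

lemma ell2_nth_to_0: "(\<lambda>n. norm (ell2_nth f n)) \<longlonglongrightarrow> 0"
proof -
  have "(\<lambda>n. sqrt ((norm (ell2_nth f n))\<^sup>2)) \<longlonglongrightarrow> sqrt 0"
    by (intro tendsto_real_sqrt summable_LIMSEQ_zero summable_ell2)
  then show ?thesis by simp
qed

text \<open>Each of the three shifted sequences has square sum at most twice that of \<open>f\<close> (the term for
  \<open>n - 1\<close> counts \<open>f\<^sub>0\<close> twice, the others count nothing twice), so the total is at most \<open>3 c\<^sup>2 (2 + 1
  + 1) \<parallel>f\<parallel>\<^sup>2 \<le> (4 c \<parallel>f\<parallel>)\<^sup>2\<close>.\<close>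

lemma tridiagonal_bound:
  fixes f :: "'a::chilbert_space ell2"
  assumes c: "0 \<le> c"
    and g: "\<And>n. norm (g n) \<le> c * (norm (ell2_nth f (n - 1)) + norm (ell2_nth f n) + norm (ell2_nth f
        (Suc n)))"
  shows "summable (\<lambda>n. (norm (g n))\<^sup>2)" and "norm (Abs_ell2 g) \<le> 4 * c * norm f"
proof -
  let ?a = "\<lambda>n. (norm (ell2_nth f n))\<^sup>2"
  have sm: "summable (\<lambda>n. ?a (n - 1))" by (subst summable_Suc_iff[symmetric]) (simp add: summable_ell2)
  have sp: "summable (\<lambda>n. ?a (Suc n))" by (subst summable_Suc_iff) (rule summable_ell2)
  have sq: "(norm (g n))\<^sup>2 \<le> 3 * c\<^sup>2 * (?a (n - 1) + ?a n + ?a (Suc n))" for n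
  proof -
    let ?s = "norm (ell2_nth f (n - 1)) + norm (ell2_nth f n) + norm (ell2_nth f (Suc n))"
    have "(norm (g n))\<^sup>2 \<le> (c * ?s)\<^sup>2" by (rule power_mono[OF g norm_ge_zero])
    also have "\<dots> = c\<^sup>2 * ?s\<^sup>2" by (rule power_mult_distrib)
    also have "\<dots> \<le> c\<^sup>2 * (3 * (?a (n - 1) + ?a n + ?a (Suc n)))"
      by (rule mult_left_mono[OF square_sum3_le zero_le_power2])
    finally show ?thesis by (simp only: mult_ac)
  qed
  have sb: "summable (\<lambda>n. 3 * c\<^sup>2 * (?a (n - 1) + ?a n + ?a (Suc n)))"
    by (intro summable_mult summable_add sm sp summable_ell2)
  show sg: "summable (\<lambda>n. (norm (g n))\<^sup>2)"
    by (rule summable_comparison_test'[OF sb, of 0]) (use sq in simp)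
  have s1: "suminf (\<lambda>n. ?a (n - 1)) \<le> 2 * (norm f)\<^sup>2"
  proof -
    have "suminf (\<lambda>n. ?a (n - 1)) = suminf (\<lambda>n. ?a n) + ?a 0"
      using suminf_split_head[OF sm] by simp
    then show ?thesis using power_mono[OF ell2_nth_le_norm[of f 0], of 2] by (simp add: norm_ell2_sq)
  qed
  have s2: "suminf (\<lambda>n. ?a (Suc n)) \<le> (norm f)\<^sup>2"
    using suminf_split_head[OF summable_ell2[of f]] by (simp add: norm_ell2_sq)
  have "(norm (Abs_ell2 g))\<^sup>2 = suminf (\<lambda>n. (norm (g n))\<^sup>2)"
    by (simp add: norm_ell2_sq ell2_nth_Abs[OF sg])
  also have "\<dots> \<le> suminf (\<lambda>n. 3 * c\<^sup>2 * (?a (n - 1) + ?a n + ?a (Suc n)))"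
    by (rule suminf_le[OF sq sg sb])
  also have "\<dots> = 3 * c\<^sup>2 * (suminf (\<lambda>n. ?a (n - 1)) + suminf (\<lambda>n. ?a n) + suminf (\<lambda>n. ?a (Suc n)))"
    by (simp only: suminf_mult[OF summable_add[OF summable_add[OF sm summable_ell2] sp]]
        suminf_add[OF summable_add[OF sm summable_ell2] sp, symmetric] suminf_add[OF sm
            summable_ell2, symmetric])
  also have "\<dots> \<le> 3 * c\<^sup>2 * (2 * (norm f)\<^sup>2 + (norm f)\<^sup>2 + (norm f)\<^sup>2)"
    using s1 s2 by (intro mult_left_mono add_mono) (simp_all add: norm_ell2_sq)
  also have "\<dots> \<le> (4 * c * norm f)\<^sup>2" by (simp add: power_mult_distrib)
  finally show "norm (Abs_ell2 g) \<le> 4 * c * norm f"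
    by (rule power2_le_imp_le) (simp add: c)
qed

text \<open>The Hilbert space direct sum \<open>M \<oplus> E \<oplus> E \<oplus> \<dots>\<close>.\<close>

definition seq_space :: "'a::chilbert_space set \<Rightarrow> 'a set \<Rightarrow> 'a ell2 set" where
  "seq_space M E = {f. ell2_nth f 0 \<in> M \<and> (\<forall>n. ell2_nth f (Suc n) \<in> E)}"

lemma csub_seq_space:
  assumes M: "closed_csubspace M" and E: "closed_csubspace E"
  shows "closed_csubspace (seq_space M E)"
proof -
  have "closed (seq_space M E)"
    unfolding closed_sequential_limits
  proof (intro allI impI)
    fix X l assume X: "(\<forall>n. X n \<in> seq_space M E) \<and> X \<longlonglongrightarrow> l"
    note lim = ell2_nth_tendsto[OF conjunct2[OF X]]
    have X0: "ell2_nth (X k) 0 \<in> M" and XS: "ell2_nth (X k) (Suc n) \<in> E" for k n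
      using X by (auto simp: seq_space_def)
    show "l \<in> seq_space M E"
      using closed_sequentially[OF csub_closed[OF M] X0 lim] closed_sequentially[OF csub_closed[OF
          E] XS lim]
      by (simp add: seq_space_def)
  qed
  then show ?thesis
    using M E by (simp add: closed_csubspace_def seq_space_def ell2_nth_zero ell2_nth_add
        ell2_nth_scaleC)
qed

text \<open>On \<open>M \<oplus> E \<oplus> E \<oplus> \<dots>\<close>, \<open>upper D0 D R\<close> is the block matrix with diagonal \<open>D0, D, D, \<dots>\<close> and
  superdiagonal \<open>R, R, \<dots>\<close>; in \<open>lower D0 D R\<close> the entries \<open>R\<close> form the subdiagonal.\<close>

definition upper :: "('a::chilbert_space \<Rightarrow> 'a) \<Rightarrow> ('a \<Rightarrow> 'a) \<Rightarrow> ('a \<Rightarrow> 'a) \<Rightarrow> 'a ell2 \<Rightarrow> 'a ell2" where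
  "upper D0 D R f = Abs_ell2 (\<lambda>n. (if n = 0 then D0 else D) (ell2_nth f n) + R (ell2_nth f (Suc n)))"

definition lower :: "('a::chilbert_space \<Rightarrow> 'a) \<Rightarrow> ('a \<Rightarrow> 'a) \<Rightarrow> ('a \<Rightarrow> 'a) \<Rightarrow> 'a ell2 \<Rightarrow> 'a ell2" where
  "lower D0 D R f = Abs_ell2 (\<lambda>n. case n of 0 \<Rightarrow> D0 (ell2_nth f 0)
    | Suc m \<Rightarrow> R (ell2_nth f m) + D (ell2_nth f (Suc m)))"

lemma tridiagonal_operator:
  fixes G :: "'a::chilbert_space ell2 \<Rightarrow> nat \<Rightarrow> 'a"
  assumes c: "0 \<le> c"
    and b: "\<And>f n. f \<in> K \<Longrightarrow> norm (G f n) \<le> c * (norm (ell2_nth f (n - 1)) + norm (ell2_nth f n) + norm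
        (ell2_nth f (Suc n)))"
    and add: "\<And>f g n. f \<in> K \<Longrightarrow> g \<in> K \<Longrightarrow> G (f + g) n = G f n + G g n"
    and scale: "\<And>a f n. f \<in> K \<Longrightarrow> G (a *\<^sub>C f) n = a *\<^sub>C G f n"
    and K: "closed_csubspace K" and inK: "\<And>f h. f \<in> K \<Longrightarrow> (\<And>n. ell2_nth h n = G f n) \<Longrightarrow> h \<in> K"
  shows "operator_on K (\<lambda>f. Abs_ell2 (G f))" and "\<And>f n. f \<in> K \<Longrightarrow> ell2_nth (Abs_ell2 (G f)) n = G f n"
proof -
  show nth: "ell2_nth (Abs_ell2 (G f)) n = G f n" if "f \<in> K" for f n
    by (simp add: ell2_nth_Abs[OF tridiagonal_bound(1)[OF c b[OF that]]])
  show "operator_on K (\<lambda>f. Abs_ell2 (G f))"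
  proof (rule operator_onI[where c = "4 * c"])
    show "Abs_ell2 (G f) \<in> K" if "f \<in> K" for f using inK[OF that nth[OF that]] .
    show "norm (Abs_ell2 (G f)) \<le> 4 * c * norm f" if "f \<in> K" for f
      by (rule tridiagonal_bound(2)[OF c b[OF that]])
    show "Abs_ell2 (G (f + g)) = Abs_ell2 (G f) + Abs_ell2 (G g)" if "f \<in> K" "g \<in> K" for f g
      using that by (intro ell2_eqI) (simp add: nth csub_add[OF K] ell2_nth_add add)
    show "Abs_ell2 (G (a *\<^sub>C f)) = a *\<^sub>C Abs_ell2 (G f)" if "f \<in> K" for a f
      using that by (intro ell2_eqI) (simp add: nth csub_scaleC[OF K] ell2_nth_scaleC scale)
  qed
qed

lemma upper_operator:
  assumes M: "closed_csubspace M" and E: "closed_csubspace E" "E \<subseteq> M"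
    and D0: "operator_on M D0" and D: "operator_on E D" and R: "operator_on E R"
  shows "operator_on (seq_space M E) (upper D0 D R)"
    and "f \<in> seq_space M E \<Longrightarrow> ell2_nth (upper D0 D R f) n =
      (if n = 0 then D0 else D) (ell2_nth f n) + R (ell2_nth f (Suc n))"
proof -
  obtain c0 c1 c2 where cs: "0 < c0" "0 < c1" "0 < c2"
    and b0: "\<And>x. x \<in> M \<Longrightarrow> norm (D0 x) \<le> c0 * norm x" and b1: "\<And>x. x \<in> E \<Longrightarrow> norm (D x) \<le> c1 * norm x"
    and b2: "\<And>x. x \<in> E \<Longrightarrow> norm (R x) \<le> c2 * norm x"
    using op_bound[OF D0] op_bound[OF D] op_bound[OF R] by metis
  define c where "c = c0 + c1 + c2"
  have c: "0 \<le> c" "c0 \<le> c" "c1 \<le> c" "c2 \<le> c" using cs by (simp_all add: c_def)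
  have K: "f \<in> seq_space M E \<Longrightarrow> ell2_nth f 0 \<in> M" "f \<in> seq_space M E \<Longrightarrow> ell2_nth f (Suc n) \<in> E" for f n
    by (simp_all add: seq_space_def)
  let ?G = "\<lambda>f n. (if n = 0 then D0 else D) (ell2_nth f n) + R (ell2_nth f (Suc n))"
  have bound: "norm (?G f n) \<le> c * (norm (ell2_nth f (n - 1)) + norm (ell2_nth f n) + norm (ell2_nth
      f (Suc n)))"
    if f: "f \<in> seq_space M E" for f n
  proof -
    have "norm ((if n = 0 then D0 else D) (ell2_nth f n)) \<le> c * norm (ell2_nth f n)"
    proof (cases n)
      case 0
      then show ?thesis using order_trans[OF b0[OF K(1)[OF f]] mult_right_mono[OF c(2)
          norm_ge_zero]] by simp
    next
      case (Suc m)
      then show ?thesis using order_trans[OF b1[OF K(2)[OF f]] mult_right_mono[OF c(3)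
          norm_ge_zero]] by simp
    qed
    moreover have "norm (R (ell2_nth f (Suc n))) \<le> c * norm (ell2_nth f (Suc n))"
      by (rule order_trans[OF b2[OF K(2)[OF f]] mult_right_mono[OF c(4) norm_ge_zero]])
    moreover have "0 \<le> c * norm (ell2_nth f (n - 1))" using c by simp
    ultimately show ?thesis
      using norm_triangle_ineq[of "(if n = 0 then D0 else D) (ell2_nth f n)" "R (ell2_nth f (Suc n))"]
      unfolding distrib_left by linarith
  qed
  have add: "?G (f + g) n = ?G f n + ?G g n" if "f \<in> seq_space M E" "g \<in> seq_space M E" for f g n
    using K[OF that(1)] K[OF that(2)] by (cases n) (simp_all add: ell2_nth_add op_add[OF D0]
        op_add[OF D] op_add[OF R])
  have scale: "?G (a *\<^sub>C f) n = a *\<^sub>C ?G f n" if "f \<in> seq_space M E" for a f n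
    using K[OF that] by (cases n) (simp_all add: ell2_nth_scaleC op_scaleC[OF D0] op_scaleC[OF D]
        op_scaleC[OF R] scaleC_add_right)
  have inK: "h \<in> seq_space M E" if f: "f \<in> seq_space M E" and h: "\<And>n. ell2_nth h n = ?G f n" for f h
    using K[OF f] E(2) op_in[OF R K(2)[OF f]]
    by (auto simp: seq_space_def h intro!: csub_add[OF M] csub_add[OF E(1)] op_in[OF D0] op_in[OF D])
  show "operator_on (seq_space M E) (upper D0 D R)"
    unfolding upper_def
    by (rule tridiagonal_operator(1)[where G = ?G, OF c(1)]) (fact bound add scale csub_seq_space[OF
        M E(1)] inK)+
  show "ell2_nth (upper D0 D R f) n = (if n = 0 then D0 else D) (ell2_nth f n) + R (ell2_nth f (Suc n))"
    if "f \<in> seq_space M E"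
    unfolding upper_def
    by (rule tridiagonal_operator(2)[where G = ?G, OF c(1)]) (fact bound add scale csub_seq_space[OF
        M E(1)] inK that)+
qed

lemma lower_operator:
  assumes M: "closed_csubspace M" and E: "closed_csubspace E" "E \<subseteq> M"
    and D0: "operator_on M D0" and D: "operator_on E D" and R: "operator_on M R" and RE: "R ` M \<subseteq> E"
  shows "operator_on (seq_space M E) (lower D0 D R)"
    and "f \<in> seq_space M E \<Longrightarrow> ell2_nth (lower D0 D R f) 0 = D0 (ell2_nth f 0)"
    and "f \<in> seq_space M E \<Longrightarrow> ell2_nth (lower D0 D R f) (Suc n) = R (ell2_nth f n) + D (ell2_nth f
        (Suc n))"
proof -
  obtain c0 c1 c2 where cs: "0 < c0" "0 < c1" "0 < c2"
    and b0: "\<And>x. x \<in> M \<Longrightarrow> norm (D0 x) \<le> c0 * norm x" and b1: "\<And>x. x \<in> E \<Longrightarrow> norm (D x) \<le> c1 * norm x"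
    and b2: "\<And>x. x \<in> M \<Longrightarrow> norm (R x) \<le> c2 * norm x"
    using op_bound[OF D0] op_bound[OF D] op_bound[OF R] by metis
  define c where "c = c0 + c1 + c2"
  have c: "0 \<le> c" "c0 \<le> c" "c1 \<le> c" "c2 \<le> c" using cs by (simp_all add: c_def)
  have K: "ell2_nth f 0 \<in> M" "ell2_nth f (Suc n) \<in> E" "ell2_nth f n \<in> M" if "f \<in> seq_space M E" for f n
    using that E(2) by (cases n, auto simp: seq_space_def)+
  let ?G = "\<lambda>f n. case n of 0 \<Rightarrow> D0 (ell2_nth f 0) | Suc m \<Rightarrow> R (ell2_nth f m) + D (ell2_nth f (Suc m))"
  have bound: "norm (?G f n) \<le> c * (norm (ell2_nth f (n - 1)) + norm (ell2_nth f n) + norm (ell2_nth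
      f (Suc n)))"
    if f: "f \<in> seq_space M E" for f n
  proof (cases n)
    case 0
    have "norm (D0 (ell2_nth f 0)) \<le> c * norm (ell2_nth f 0)"
      by (rule order_trans[OF b0[OF K(1)[OF f]] mult_right_mono[OF c(2) norm_ge_zero]])
    moreover have "0 \<le> c * norm (ell2_nth f 0)" "0 \<le> c * norm (ell2_nth f 1)" using c by simp_all
    ultimately show ?thesis by (simp add: 0 distrib_left)
  next
    case (Suc m)
    have "norm (R (ell2_nth f m)) \<le> c * norm (ell2_nth f m)"
      by (rule order_trans[OF b2[OF K(3)[OF f]] mult_right_mono[OF c(4) norm_ge_zero]])
    moreover have "norm (D (ell2_nth f (Suc m))) \<le> c * norm (ell2_nth f (Suc m))"
      by (rule order_trans[OF b1[OF K(2)[OF f]] mult_right_mono[OF c(3) norm_ge_zero]])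
    moreover have "0 \<le> c * norm (ell2_nth f (Suc n))" using c by simp
    ultimately show ?thesis
      using norm_triangle_ineq[of "R (ell2_nth f m)" "D (ell2_nth f (Suc m))"]
      by (simp add: Suc distrib_left)
  qed
  have add: "?G (f + g) n = ?G f n + ?G g n" if "f \<in> seq_space M E" "g \<in> seq_space M E" for f g n
    using K[OF that(1)] K[OF that(2)] by (cases n) (simp_all add: ell2_nth_add op_add[OF D0]
        op_add[OF D] op_add[OF R])
  have scale: "?G (a *\<^sub>C f) n = a *\<^sub>C ?G f n" if "f \<in> seq_space M E" for a f n
    using K[OF that] by (cases n) (simp_all add: ell2_nth_scaleC op_scaleC[OF D0] op_scaleC[OF D]
        op_scaleC[OF R] scaleC_add_right)
  have inK: "h \<in> seq_space M E" if f: "f \<in> seq_space M E" and h: "\<And>n. ell2_nth h n = ?G f n" for f h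
    using K[OF f] by (auto simp: seq_space_def h intro!: csub_add[OF E(1)] subsetD[OF RE, OF imageI]
        op_in[OF D0] op_in[OF D])
  have nth: "ell2_nth (lower D0 D R f) n = ?G f n" if "f \<in> seq_space M E" for f n
    unfolding lower_def
    by (rule tridiagonal_operator(2)[where G = ?G, OF c(1)]) (fact bound add scale csub_seq_space[OF
        M E(1)] inK that)+
  show "operator_on (seq_space M E) (lower D0 D R)"
    unfolding lower_def
    by (rule tridiagonal_operator(1)[where G = ?G, OF c(1)]) (fact bound add scale csub_seq_space[OF
        M E(1)] inK)+
  show "f \<in> seq_space M E \<Longrightarrow> ell2_nth (lower D0 D R f) 0 = D0 (ell2_nth f 0)" by (simp add: nth)
  show "f \<in> seq_space M E \<Longrightarrow> ell2_nth (lower D0 D R f) (Suc n) = R (ell2_nth f n) + D (ell2_nth f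
      (Suc n))"
    by (simp add: nth)
qed

text \<open>The partial sums of the two inner products differ by a single boundary term, which tends to
  zero because the coordinates of square-summable sequences do.\<close>

lemma upper_lower_adjoint:
  assumes M: "closed_csubspace M" and E: "closed_csubspace E" "E \<subseteq> M"
    and D0: "adjoint_pair M D0 D0'" and D: "adjoint_pair E D D'"
    and R: "operator_on E R" and R': "operator_on M R'" "R' ` M \<subseteq> E"
    and RR': "\<And>x y. x \<in> E \<Longrightarrow> y \<in> M \<Longrightarrow> cinner (R x) y = cinner x (R' y)"
  shows "adjoint_pair (seq_space M E) (upper D0 D R) (lower D0' D' R')"
proof -
  note u = upper_operator[OF M E adjoint_pairD(1)[OF D0] adjoint_pairD(1)[OF D] R]
  note l = lower_operator[OF M E adjoint_pairD(2)[OF D0] adjoint_pairD(2)[OF D] R']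
  have "cinner (upper D0 D R f) g = cinner f (lower D0' D' R' g)"
    if f: "f \<in> seq_space M E" and g: "g \<in> seq_space M E" for f g
  proof -
    have K: "ell2_nth h 0 \<in> M" "ell2_nth h (Suc n) \<in> E" "ell2_nth h n \<in> M" if "h \<in> seq_space M E" for h n
      using that E(2) by (cases n, auto simp: seq_space_def)+
    define a where "a n = cinner ((if n = 0 then D0 else D) (ell2_nth f n)) (ell2_nth g n)" for n
    define b where "b n = cinner (R (ell2_nth f (Suc n))) (ell2_nth g n)" for n
    let ?l = "\<lambda>n. cinner (ell2_nth (upper D0 D R f) n) (ell2_nth g n)"
    let ?r = "\<lambda>n. cinner (ell2_nth f n) (ell2_nth (lower D0' D' R' g) n)"
    have l_eq: "?l n = a n + b n" for n by (simp add: u(2)[OF f] a_def b_def cinner_add_left)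
    have r0: "?r 0 = a 0" using adjoint_pairD(3)[OF D0 K(1)[OF f] K(1)[OF g]] by (simp add: l(2)[OF
        g] a_def)
    have rS: "?r (Suc n) = b n + a (Suc n)" for n
      using adjoint_pairD(3)[OF D K(2)[OF f, of n] K(2)[OF g, of n]] RR'[OF K(2)[OF f, of n] K(3)[OF
          g, of n]]
      by (simp add: l(3)[OF g] a_def b_def cinner_add_right)
    have part: "(\<Sum>n<Suc N. ?l n) = (\<Sum>n<Suc N. ?r n) + b N" for N
      by (induction N) (simp_all add: l_eq r0 rS)
    obtain c where c: "0 < c" "\<And>x. x \<in> E \<Longrightarrow> norm (R x) \<le> c * norm x" using op_bound[OF R] by metis
    have b0: "b \<longlonglongrightarrow> 0"
    proof (rule Lim_null_comparison)
      show "\<forall>\<^sub>F n in sequentially. norm (b n) \<le> c * norm (ell2_nth f (Suc n)) * norm g"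
      proof (rule always_eventually, rule allI)
        fix n
        have "norm (b n) \<le> norm (R (ell2_nth f (Suc n))) * norm (ell2_nth g n)"
          unfolding b_def by (rule norm_cinner_le)
        also have "\<dots> \<le> c * norm (ell2_nth f (Suc n)) * norm g"
          using c by (intro mult_mono c(2)[OF K(2)[OF f]] ell2_nth_le_norm) auto
        finally show "norm (b n) \<le> c * norm (ell2_nth f (Suc n)) * norm g" .
      qed
      show "(\<lambda>n. c * norm (ell2_nth f (Suc n)) * norm g) \<longlonglongrightarrow> 0"
        using LIMSEQ_Suc[OF ell2_nth_to_0[of f]] by (intro tendsto_mult_left_zero
            tendsto_mult_right_zero)
    qed
    have "(\<lambda>N. \<Sum>n<Suc N. ?l n) \<longlonglongrightarrow> suminf ?l"
      by (rule LIMSEQ_Suc[OF summable_LIMSEQ[OF summable_ell2_cinner]])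
    moreover have "(\<lambda>N. (\<Sum>n<Suc N. ?r n) + b N) \<longlonglongrightarrow> suminf ?r + 0"
      by (rule tendsto_add[OF LIMSEQ_Suc[OF summable_LIMSEQ[OF summable_ell2_cinner]] b0])
    ultimately have "suminf ?l = suminf ?r + 0" unfolding part by (rule LIMSEQ_unique)
    then show ?thesis by (simp add: cinner_ell2_def)
  qed
  then show ?thesis using u(1) l(1) by (simp add: adjoint_pair_def)
qed

section \<open>Unitary extension of isometric triples\<close>

text \<open>The structure that a tetrablock contraction has on a reducing subspace where its last
  component is isometric: the relations \<open>A = B\<^sup>* P\<close> and \<open>B = A\<^sup>* P\<close> are the fundamental equations
  there. The axioms are symmetric in \<open>A\<close> and \<open>B\<close>, so that whatever is proved for the extension of
  \<open>A\<close> holds for that of \<open>B\<close>.\<close>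

locale isometric_triple =
  fixes M :: "'a::chilbert_space set" and A B P A' B' P' :: "'a \<Rightarrow> 'a"
  assumes M: "closed_csubspace M"
    and adjA: "adjoint_pair M A A'" and adjB: "adjoint_pair M B B'" and adjP: "adjoint_pair M P P'"
    and P'P: "\<And>x. x \<in> M \<Longrightarrow> P' (P x) = x"
    and AB: "\<And>x. x \<in> M \<Longrightarrow> A (B x) = B (A x)"
    and AP: "\<And>x. x \<in> M \<Longrightarrow> A (P x) = P (A x)" and BP: "\<And>x. x \<in> M \<Longrightarrow> B (P x) = P (B x)"
    and A_eq: "\<And>x. x \<in> M \<Longrightarrow> A x = B' (P x)" and B_eq: "\<And>x. x \<in> M \<Longrightarrow> B x = A' (P x)"
    and norm_A: "\<And>x. x \<in> M \<Longrightarrow> norm (A x) \<le> norm x" and norm_B: "\<And>x. x \<in> M \<Longrightarrow> norm (B x) \<le> norm x"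
begin

lemma swap: "isometric_triple M B A P B' A' P'"
  by unfold_locales (simp_all add: M adjA adjB adjP P'P AB AP BP A_eq[symmetric] B_eq[symmetric]
      norm_A norm_B)

lemmas opA = adjoint_pairD(1)[OF adjA] and opA' = adjoint_pairD(2)[OF adjA]
  and opB = adjoint_pairD(1)[OF adjB] and opB' = adjoint_pairD(2)[OF adjB]
  and opP = adjoint_pairD(1)[OF adjP] and opP' = adjoint_pairD(2)[OF adjP]

lemmas in_M = op_in[OF opA] op_in[OF opA'] op_in[OF opB] op_in[OF opB'] op_in[OF opP] op_in[OF opP']
  csub_add[OF M] csub_diff[OF M]
lemmas lin = op_add[OF opA] op_add[OF opA'] op_add[OF opB] op_add[OF opB'] op_add[OF opP] op_add[OF opP']
  op_diff[OF M opA] op_diff[OF M opA'] op_diff[OF M opB] op_diff[OF M opB'] op_diff[OF M opP]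
      op_diff[OF M opP']
lemmas zero = op_zero[OF M opA] op_zero[OF M opA'] op_zero[OF M opB] op_zero[OF M opB']
  op_zero[OF M opP] op_zero[OF M opP']

lemma A'_eq: "x \<in> M \<Longrightarrow> P' (B x) = A' x"
proof (rule cinner_eqI_on[OF M])
  fix y assume "x \<in> M" "y \<in> M"
  then show "cinner y (P' (B x)) = cinner y (A' x)"
    using adjoint_pairD(3)[OF adjP, of y "B x"] adjoint_pairD(3)[OF adjA, of y x]
      adjoint_pairD(3)[OF adjoint_pair_sym[OF adjB], of "P y" x] A_eq[of y] by (simp add: in_M)
qed (simp_all add: in_M)

lemma A'P': "x \<in> M \<Longrightarrow> P' (A' x) = A' (P' x)"
proof (rule cinner_eqI_on[OF M])
  fix y assume "x \<in> M" "y \<in> M"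
  then show "cinner y (P' (A' x)) = cinner y (A' (P' x))"
    using adjoint_pairD(3)[OF adjP, of y "A' x"] adjoint_pairD(3)[OF adjA, of "P y" x]
      adjoint_pairD(3)[OF adjA, of y "P' x"] adjoint_pairD(3)[OF adjP, of "A y" x] AP[of y] by (simp
          add: in_M)
qed (simp_all add: in_M)

text \<open>For the isometry \<open>P\<close>, \<open>Q = 1 - P P\<^sup>*\<close> is the orthogonal projection onto its wandering
  subspace \<open>E = ker P\<^sup>* = M \<ominus> P M\<close>.\<close>

definition Q :: "'a \<Rightarrow> 'a" where "Q x = x - P (P' x)"

definition E :: "'a set" where "E = {x \<in> M. P' x = 0}"

lemma E_sub: "E \<subseteq> M" by (auto simp: E_def)

lemma csub_E: "closed_csubspace E"
proof -
  have "closed E" unfolding closed_sequential_limits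
  proof (intro allI impI)
    fix X l assume X: "(\<forall>n. X n \<in> E) \<and> X \<longlonglongrightarrow> l"
    then have XM: "X n \<in> M" for n using E_sub by blast
    have "(\<lambda>n. P' (X n)) \<longlonglongrightarrow> P' l" by (rule op_tendsto[OF M opP']) (use XM X in auto)
    moreover have "P' (X n) = 0" for n using X by (simp add: E_def)
    ultimately have "P' l = 0" by (simp add: LIMSEQ_const_iff)
    moreover have "l \<in> M" by (rule closed_sequentially[OF csub_closed[OF M]]) (use XM X in auto)
    ultimately show "l \<in> E" by (simp add: E_def)
  qed
  then show ?thesis
    using M by (simp add: closed_csubspace_def E_def zero lin op_scaleC[OF opP'] scaleC_zero_right)
qed

lemma Q_in: "x \<in> M \<Longrightarrow> Q x \<in> E"
  by (simp add: Q_def E_def in_M lin P'P)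

lemma Q_E: "x \<in> E \<Longrightarrow> Q x = x"
  by (simp add: Q_def E_def zero)

lemma opQ: "operator_on M Q"
  using op_sub[OF M op_const_scaleC[OF M, of 1] op_compose[OF opP opP']]
  by (simp add: Q_def[abs_def] scaleC_one)

lemma Q_sym: "x \<in> M \<Longrightarrow> y \<in> M \<Longrightarrow> cinner (Q x) y = cinner x (Q y)"
  using adjoint_pairD(3)[OF adjP, of "P' x" y] adjoint_pairD(3)[OF adjoint_pair_sym[OF adjP], of x
      "P' y"]
  by (simp add: Q_def cinner_simps in_M)

lemma A'_E: "x \<in> E \<Longrightarrow> A' x \<in> E"
  using A'P' by (simp add: E_def in_M zero)

lemma op_QB: "operator_on M (\<lambda>x. Q (B x))"
  by (rule op_compose[OF opQ opB])

lemma adjoint_QA: "adjoint_pair E (\<lambda>x. Q (A x)) A'"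
  unfolding adjoint_pair_def
proof (intro conjI ballI)
  show "operator_on E (\<lambda>x. Q (A x))"
    by (rule op_subspace[OF op_compose[OF opQ opA] E_sub]) (use E_sub Q_in in_M in blast)
  show "operator_on E A'" by (rule op_subspace[OF opA' E_sub]) (use A'_E in blast)
  fix x y assume xy: "x \<in> E" "y \<in> E"
  then have "x \<in> M" "y \<in> M" using E_sub by auto
  then show "cinner (Q (A x)) y = cinner x (A' y)"
    using Q_sym[of "A x" y] Q_E[OF xy(2)] adjoint_pairD(3)[OF adjA] by (simp add: in_M)
qed

definition K :: "'a ell2 set" where "K = seq_space M E"

lemma csub_K: "closed_csubspace K" unfolding K_def by (rule csub_seq_space[OF M csub_E])

lemma in_K: "f \<in> K \<Longrightarrow> ell2_nth f n \<in> M" "f \<in> K \<Longrightarrow> ell2_nth f (Suc n) \<in> E"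
  using E_sub by (cases n, auto simp: K_def seq_space_def)+

text \<open>\<open>U\<close> is the minimal unitary extension of \<open>P\<close>: the coordinate with index \<open>n > 0\<close> stands for
  \<open>U\<^sup>-\<^sup>n E\<close>. The extension of \<open>A\<close> is then forced by \<open>A U\<^sup>-\<^sup>n h = U\<^sup>-\<^sup>n A h\<close>: for \<open>e \<in> E\<close> the vector \<open>A
  e\<close> splits into \<open>Q A e\<close>, which stays in the coordinate of \<open>e\<close>, and \<open>P P\<^sup>* A e = P B\<^sup>* e\<close>, which
  moves to the preceding one.\<close>

definition U :: "'a ell2 \<Rightarrow> 'a ell2" where "U = upper P (\<lambda>_. 0) (\<lambda>x. x)"
definition U' :: "'a ell2 \<Rightarrow> 'a ell2" where "U' = lower P' (\<lambda>_. 0) Q"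
definition A_ext :: "'a ell2 \<Rightarrow> 'a ell2" where "A_ext = upper A (\<lambda>x. Q (A x)) B'"
definition A'_ext :: "'a ell2 \<Rightarrow> 'a ell2" where "A'_ext = lower A' A' (\<lambda>x. Q (B x))"

lemma op_id_zero: "operator_on E (\<lambda>_. 0)" "operator_on E (\<lambda>x. x)"
  using csub_E by (auto simp: operator_on_def clinear_on_def scaleC_zero_right closed_csubspace_def
      intro: exI[of _ 1])

lemma adjoint_U: "adjoint_pair K U U'"
  unfolding K_def U_def U'_def
proof (rule upper_lower_adjoint[OF M csub_E E_sub adjP _ op_id_zero(2) opQ])
  show "adjoint_pair E (\<lambda>_. 0) (\<lambda>_. 0)" using op_id_zero by (simp add: adjoint_pair_def)
  show "Q ` M \<subseteq> E" using Q_in by blast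
  show "cinner x y = cinner x (Q y)" if "x \<in> E" "y \<in> M" for x y
    using Q_sym[of x y] Q_E[of x] that E_sub by auto
qed

lemma U_nth: "f \<in> K \<Longrightarrow> ell2_nth (U f) 0 = P (ell2_nth f 0) + ell2_nth f 1"
  "f \<in> K \<Longrightarrow> ell2_nth (U f) (Suc n) = ell2_nth f (Suc (Suc n))"
  unfolding U_def K_def
  by (simp_all add: upper_operator(2)[OF M csub_E E_sub opP op_id_zero])

lemma U'_nth: "f \<in> K \<Longrightarrow> ell2_nth (U' f) 0 = P' (ell2_nth f 0)"
  "f \<in> K \<Longrightarrow> ell2_nth (U' f) (Suc n) = Q (ell2_nth f n)"
proof -
  have "Q ` M \<subseteq> E" using Q_in by blast
  note l = lower_operator[OF M csub_E E_sub opP' op_id_zero(1) opQ this]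
  show "f \<in> K \<Longrightarrow> ell2_nth (U' f) 0 = P' (ell2_nth f 0)"
    "f \<in> K \<Longrightarrow> ell2_nth (U' f) (Suc n) = Q (ell2_nth f n)"
    unfolding U'_def K_def by (simp_all add: l)
qed

lemma B'_E: "operator_on E B'"
  by (rule adjoint_pairD(2)[OF isometric_triple.adjoint_QA[OF swap]])

lemma adjoint_A_ext: "adjoint_pair K A_ext A'_ext"
  unfolding K_def A_ext_def A'_ext_def
proof (rule upper_lower_adjoint[OF M csub_E E_sub adjA adjoint_QA B'_E op_QB])
  show "(\<lambda>x. Q (B x)) ` M \<subseteq> E" using Q_in in_M by blast
  show "cinner (B' x) y = cinner x (Q (B y))" if "x \<in> E" "y \<in> M" for x y
  proof -
    have "x \<in> M" using that E_sub by blast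
    then show ?thesis
      using Q_sym[of x "B y"] Q_E[OF that(1)] adjoint_pairD(3)[OF adjoint_pair_sym[OF adjB], of x y]
          that(2)
      by (simp add: in_M)
  qed
qed

lemma A_ext_nth:
  "f \<in> K \<Longrightarrow> ell2_nth (A_ext f) 0 = A (ell2_nth f 0) + B' (ell2_nth f 1)"
  "f \<in> K \<Longrightarrow> ell2_nth (A_ext f) (Suc n) = Q (A (ell2_nth f (Suc n))) + B' (ell2_nth f (Suc (Suc n)))"
  unfolding A_ext_def K_def
  by (simp_all add: upper_operator(2)[OF M csub_E E_sub opA adjoint_pairD(1)[OF adjoint_QA] B'_E])

lemma A'_ext_nth:
  "f \<in> K \<Longrightarrow> ell2_nth (A'_ext f) 0 = A' (ell2_nth f 0)"
  "f \<in> K \<Longrightarrow> ell2_nth (A'_ext f) (Suc n) = Q (B (ell2_nth f n)) + A' (ell2_nth f (Suc n))"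
proof -
  have "(\<lambda>x. Q (B x)) ` M \<subseteq> E" using Q_in in_M by blast
  note l = lower_operator[OF M csub_E E_sub opA' adjoint_pairD(2)[OF adjoint_QA] op_QB this]
  show "f \<in> K \<Longrightarrow> ell2_nth (A'_ext f) 0 = A' (ell2_nth f 0)"
    "f \<in> K \<Longrightarrow> ell2_nth (A'_ext f) (Suc n) = Q (B (ell2_nth f n)) + A' (ell2_nth f (Suc n))"
    unfolding A'_ext_def K_def by (simp_all add: l)
qed

lemmas opU = adjoint_pairD(1)[OF adjoint_U] and opU' = adjoint_pairD(2)[OF adjoint_U]
  and op_ext = adjoint_pairD(1)[OF adjoint_A_ext] and op_ext' = adjoint_pairD(2)[OF adjoint_A_ext]

lemma U'U: "f \<in> K \<Longrightarrow> U' (U f) = f"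
proof (rule ell2_eqI)
  fix n assume f: "f \<in> K"
  have 1: "P' (ell2_nth f (Suc n)) = 0" for n using in_K(2)[OF f] by (simp add: E_def)
  note f0 = in_K(1)[OF f, of 0] and f1 = in_K(1)[OF f, of 1]
  have q: "Q (P (ell2_nth f 0) + ell2_nth f 1) = ell2_nth f 1"
    using f0 f1 1[of 0] by (simp add: Q_def lin in_M P'P)
  show "ell2_nth (U' (U f)) n = ell2_nth f n"
  proof (cases n)
    case 0
    then show ?thesis using f0 f1 1[of 0] by (simp add: U'_nth U_nth op_in[OF opU] f lin in_M P'P)
  next
    case (Suc m)
    then show ?thesis
      using q Q_E[OF in_K(2)[OF f]] by (cases m) (simp_all add: U'_nth U_nth op_in[OF opU] f)
  qed
qed

lemma UU': "f \<in> K \<Longrightarrow> U (U' f) = f"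
proof (rule ell2_eqI)
  fix n assume f: "f \<in> K"
  show "ell2_nth (U (U' f)) n = ell2_nth f n"
    using Q_E[OF in_K(2)[OF f]]
    by (cases n) (simp_all add: U'_nth U_nth op_in[OF opU'] f Q_def)
qed

lemma A_ext_U: "f \<in> K \<Longrightarrow> A_ext (U f) = U (A_ext f)"
proof (rule ell2_eqI)
  fix n assume f: "f \<in> K"
  note fM = in_K(1)[OF f]
  have "Q (A (ell2_nth f 1)) = A (ell2_nth f 1) - P (B' (ell2_nth f 1))"
    using isometric_triple.A'_eq[OF swap, OF fM[of 1]] by (simp add: Q_def)
  then show "ell2_nth (A_ext (U f)) n = ell2_nth (U (A_ext f)) n"
    using fM by (cases n) (simp_all add: A_ext_nth U_nth op_in[OF opU] op_in[OF op_ext] f lin in_M AP)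
qed

text \<open>Applied to \<open>g = B U\<^sup>* f\<close>, with the extension of \<open>B\<close> on the right, this yields \<open>A\<^sup>* = B U\<^sup>*\<close> for
  the extended operators. It is stated through the coordinates of \<open>g\<close> because that extension is
  the present construction with \<open>A\<close> and \<open>B\<close> exchanged, which becomes available once the locale has
  been interpreted in itself.\<close>

lemma A'_ext_eqI:
  assumes f: "f \<in> K" and g: "g \<in> K"
    and g0: "ell2_nth g 0 = B (P' (ell2_nth f 0)) + A' (Q (ell2_nth f 0))"
    and gS: "\<And>n. ell2_nth g (Suc n) = Q (B (Q (ell2_nth f n))) + A' (Q (ell2_nth f (Suc n)))"
  shows "A'_ext f = g"
proof (rule ell2_eqI)
  fix n
  note fM = in_K(1)[OF f]
  have x0: "A' (P (P' x)) = B (P' x)" if "x \<in> M" for x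
    using B_eq[of "P' x"] that by (simp add: in_M)
  have QBQ: "Q (B (Q x)) = Q (B x)" if "x \<in> M" for x
  proof -
    have "B (Q x) = B x - P (B (P' x))" using that by (simp add: Q_def lin in_M BP)
    then show ?thesis using that by (simp add: Q_def lin in_M P'P)
  qed
  show "ell2_nth (A'_ext f) n = ell2_nth g n"
  proof (cases n)
    case 0
    then show ?thesis using x0[OF fM[of 0]] fM[of 0] by (simp add: A'_ext_nth f g0 Q_def lin in_M)
  next
    case (Suc m)
    then show ?thesis using fM Q_E[OF in_K(2)[OF f]] by (simp add: A'_ext_nth f gS QBQ)
  qed
qed

subsection \<open>Embedding and density\<close>

definition emb :: "'a \<Rightarrow> 'a ell2" where "emb x = Abs_ell2 (\<lambda>n. if n = 0 then x else 0)"

lemma emb_nth: "ell2_nth (emb x) n = (if n = 0 then x else 0)"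
proof -
  have "summable (\<lambda>n. (norm (if n = 0 then x else 0))\<^sup>2)"
    by (rule summable_finite[of "{0}"]) auto
  then show ?thesis unfolding emb_def by (simp add: ell2_nth_Abs)
qed

lemma emb_in_K: "x \<in> M \<Longrightarrow> emb x \<in> K"
  using csub_zero[OF csub_E] by (simp add: K_def seq_space_def emb_nth)

lemma norm_emb: "norm (emb x) = norm x"
proof -
  have "(\<lambda>n. (norm (ell2_nth (emb x) n))\<^sup>2) sums (\<Sum>n\<in>{0}. (norm (ell2_nth (emb x) n))\<^sup>2)"
    by (rule sums_finite) (auto simp: emb_nth)
  then have "(norm (emb x))\<^sup>2 = (norm x)\<^sup>2"
    unfolding norm_ell2_sq by (simp add: sums_iff emb_nth)
  then show ?thesis by (simp add: power2_eq_iff_nonneg)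
qed

lemma isometry_emb: "isometry_on M emb"
  unfolding isometry_on_def clinear_on_def
  by (auto intro!: ell2_eqI simp: norm_emb emb_nth ell2_nth_add ell2_nth_scaleC scaleC_zero_right)

lemma norm_U: "f \<in> K \<Longrightarrow> norm (U f) = norm f"
proof -
  assume f: "f \<in> K"
  have "(norm (U f))\<^sup>2 = (norm f)\<^sup>2"
    using adjoint_pair_norm(1)[OF adjoint_U f] U'U[OF f] by (simp add: cinner_self)
  then show ?thesis by (simp add: power2_eq_iff_nonneg)
qed

text \<open>The spaces \<open>U\<^sup>-\<^sup>N M\<close> exhaust \<open>K\<close>, so an operator that commutes with \<open>U\<close> is determined by its
  restriction to \<open>M\<close> and has the same norm bound: all coordinates of \<open>U\<^sup>N f\<close> but the first form a
  tail of \<open>f\<close>. The bound is used with \<open>c = 1\<close> for the extensions and with \<open>c = 0\<close> for their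
  commutator.\<close>

lemma extension_norm_le:
  assumes X: "operator_on K X" and XU: "\<And>f. f \<in> K \<Longrightarrow> X (U f) = U (X f)"
    and c: "0 \<le> c" "\<And>x. x \<in> M \<Longrightarrow> norm (X (emb x)) \<le> c * norm x" and f: "f \<in> K"
  shows "norm (X f) \<le> c * norm f"
proof -
  have iter: "(U ^^ N) f \<in> K \<and> norm ((U ^^ N) f) = norm f \<and> norm (X ((U ^^ N) f)) = norm (X f) \<and>
      (\<forall>n. ell2_nth ((U ^^ N) f) (Suc n) = ell2_nth f (Suc n + N))" for N
  proof (induction N)
    case (Suc N)
    then show ?case by (simp add: op_in[OF opU] norm_U XU op_in[OF X] U_nth)
  qed (simp add: f)
  define t where "t N = sqrt (suminf (\<lambda>n. (norm (ell2_nth f (n + Suc N)))\<^sup>2))" for N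
  obtain C where C: "0 < C" "\<And>f. f \<in> K \<Longrightarrow> norm (X f) \<le> C * norm f" using op_bound[OF X] by metis
  have "norm (X f) \<le> c * norm f + C * t N" for N
  proof -
    define g where "g = (U ^^ N) f"
    have g: "g \<in> K" "norm g = norm f" "norm (X g) = norm (X f)"
      "\<And>n. ell2_nth g (Suc n) = ell2_nth f (Suc n + N)" using iter[of N] by (simp_all add: g_def)
    define e where "e = emb (ell2_nth g 0)"
    have e: "e \<in> K" unfolding e_def using in_K(1)[OF g(1)] by (rule emb_in_K)
    have d: "ell2_nth (g - e) 0 = 0" "ell2_nth (g - e) (Suc n) = ell2_nth f (n + Suc N)" for n
      by (simp_all add: ell2_nth_diff e_def emb_nth g(4))
    have "(norm (g - e))\<^sup>2 = suminf (\<lambda>n. (norm (ell2_nth (g - e) (Suc n)))\<^sup>2)"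
      unfolding norm_ell2_sq using suminf_split_head[OF summable_ell2[of "g - e"]] by (simp add: d(1))
    then have "norm (g - e) = t N" unfolding d(2) t_def by (metis norm_ge_zero real_sqrt_abs
        abs_of_nonneg)
    moreover have "norm (X g) \<le> norm (X e) + norm (X (g - e))"
      using norm_triangle_ineq[of "X e" "X (g - e)"] by (simp add: op_diff[OF csub_K X g(1) e])
    moreover have "norm (X e) \<le> c * norm f"
    proof -
      have "norm (X e) \<le> c * norm (ell2_nth g 0)" unfolding e_def using in_K(1)[OF g(1)] by (rule c(2))
      also have "\<dots> \<le> c * norm g" using c(1) by (intro mult_left_mono ell2_nth_le_norm)
      finally show ?thesis by (simp add: g(2))
    qed
    moreover have "norm (X (g - e)) \<le> C * norm (g - e)" by (rule C(2)[OF csub_diff[OF csub_K g(1) e]])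
    ultimately show ?thesis by (simp add: g(3))
  qed
  moreover have "t \<longlonglongrightarrow> 0"
  proof -
    let ?a = "\<lambda>n. (norm (ell2_nth f n))\<^sup>2"
    have "(\<lambda>N. suminf ?a - sum ?a {..<Suc N}) \<longlonglongrightarrow> suminf ?a - suminf ?a"
      by (intro tendsto_diff tendsto_const LIMSEQ_Suc[OF summable_LIMSEQ[OF summable_ell2]])
    then have "(\<lambda>N. sqrt (suminf (\<lambda>n. ?a (n + Suc N)))) \<longlonglongrightarrow> sqrt 0"
      unfolding suminf_minus_initial_segment[OF summable_ell2] by (intro tendsto_real_sqrt) simp
    then show ?thesis by (simp add: t_def[abs_def])
  qed
  then have "(\<lambda>N. c * norm f + C * t N) \<longlonglongrightarrow> c * norm f + C * 0" by (intro tendsto_intros)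
  ultimately show ?thesis using LIMSEQ_le_const[of _ "c * norm f + C * 0" "norm (X f)"] by auto
qed

lemma A_ext_emb: "x \<in> M \<Longrightarrow> A_ext (emb x) = emb (A x)"
proof (rule ell2_eqI)
  fix n assume x: "x \<in> M"
  have "Q 0 = 0" using op_zero[OF M opQ] .
  then show "ell2_nth (A_ext (emb x)) n = ell2_nth (emb (A x)) n"
    by (cases n) (simp_all add: A_ext_nth emb_in_K[OF x] emb_nth zero)
qed

lemma U_emb: "x \<in> M \<Longrightarrow> U (emb x) = emb (P x)"
proof (rule ell2_eqI)
  fix n assume x: "x \<in> M"
  show "ell2_nth (U (emb x)) n = ell2_nth (emb (P x)) n"
    by (cases n) (simp_all add: U_nth emb_in_K[OF x] emb_nth)
qed

lemma norm_A_ext: "f \<in> K \<Longrightarrow> norm (A_ext f) \<le> norm f"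
  using extension_norm_le[OF op_ext A_ext_U, of 1 f] norm_A by (simp add: A_ext_emb norm_emb)

end

context isometric_triple begin

interpretation sw: isometric_triple M B A P B' A' P' by (rule swap)

lemma A'_ext_eq: "f \<in> K \<Longrightarrow> A'_ext f = sw.A_ext (U' f)"
proof -
  assume f: "f \<in> K"
  have U'f: "U' f \<in> K" using f by (rule op_in[OF opU'])
  show ?thesis
    using op_in[OF sw.op_ext, OF U'f]
    by (intro A'_ext_eqI[OF f])
       (simp_all add: sw.A_ext_nth U'f U'_nth f)
qed

lemma E_isometry: "E_isometry M A B P"
proof -
  have comm: "A_ext (sw.A_ext f) = sw.A_ext (A_ext f)" if f: "f \<in> K" for f
  proof -
    let ?X = "\<lambda>f. A_ext (sw.A_ext f) - sw.A_ext (A_ext f)"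
    note op2 = sw.op_ext
    have inK: "A_ext f \<in> K" "sw.A_ext f \<in> K" "U f \<in> K" if "f \<in> K" for f
      using that by (auto intro: op_in[OF op_ext] op_in[OF op2] op_in[OF opU])
    have opX: "operator_on K ?X"
      by (rule op_sub[OF csub_K op_compose[OF op_ext op2] op_compose[OF op2 op_ext]])
    have "norm (?X f) \<le> 0 * norm f"
    proof (rule extension_norm_le[OF opX _ _ _ f])
      show "?X (U f) = U (?X f)" if "f \<in> K" for f
        using that by (simp add: A_ext_U sw.A_ext_U inK op_diff[OF csub_K opU])
      show "norm (?X (emb x)) \<le> 0 * norm x" if "x \<in> M" for x
        using that by (simp add: A_ext_emb sw.A_ext_emb in_M AB)
    qed simp
    then show ?thesis by simp
  qed
  have "E_unitary K A_ext sw.A_ext U"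
    by (rule E_unitary_criterion[OF csub_K adjoint_A_ext sw.adjoint_A_ext adjoint_U])
       (simp_all add: U'U UU' comm A_ext_U sw.A_ext_U A'_ext_eq
         sw.norm_A_ext isometric_triple.A'_ext_eq[OF swap])
  then show ?thesis
    unfolding E_isometry_def
    using opA opB opP csub_K isometry_emb emb_in_K A_ext_emb sw.A_ext_emb U_emb by blast
qed

end

section \<open>Restriction to reducing subspaces\<close>

lemma reducing_subspace_UNIV_iff:
  assumes "adjoint_pair UNIV T T'"
  shows "reducing_subspace UNIV T N \<longleftrightarrow> closed_csubspace N \<and> T ` N \<subseteq> N \<and> T' ` N \<subseteq> N"
proof -
  have "adjoint_on UNIV T = T'" using adjoint_pair_eq[OF csub_UNIV assms UNIV_I] by blast
  then show ?thesis by (auto simp: reducing_subspace_def invariant_subspace_def)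
qed

lemma adjoint_pair_restrict:
  assumes "adjoint_pair UNIV T T'" "T ` N \<subseteq> N" "T' ` N \<subseteq> N"
  shows "adjoint_pair N T T'"
  using assms op_subspace[of UNIV T N] op_subspace[of UNIV T' N] by (simp add: adjoint_pair_def)

lemma reducing_subspace_orth:
  assumes adj: "adjoint_pair UNIV T T'" and N: "reducing_subspace UNIV T N"
  shows "reducing_subspace UNIV T (UNIV \<ominus> N)"
proof -
  have N': "T y \<in> N" "T' y \<in> N" if "y \<in> N" for y
    using N that by (auto simp: reducing_subspace_UNIV_iff[OF adj])
  have "T x \<in> UNIV \<ominus> N" "T' x \<in> UNIV \<ominus> N" if x: "x \<in> UNIV \<ominus> N" for x
    using adjoint_pairD(3)[OF adj, of x] adjoint_pairD(3)[OF adjoint_pair_sym[OF adj], of x] N' x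
    by (simp_all add: orth_diff_def)
  then show ?thesis by (auto simp: reducing_subspace_UNIV_iff[OF adj] csub_orth)
qed

lemma reducing_subspace_trans:
  assumes adj: "adjoint_pair UNIV T T'" and N: "reducing_subspace UNIV T N"
    and L: "reducing_subspace N T L"
  shows "reducing_subspace UNIV T L"
proof -
  have N': "closed_csubspace N" "T ` N \<subseteq> N" "T' ` N \<subseteq> N"
    using N by (auto simp: reducing_subspace_UNIV_iff[OF adj])
  have L': "closed_csubspace L" "L \<subseteq> N" "T ` L \<subseteq> L" "adjoint_on N T ` L \<subseteq> L"
    using L by (auto simp: reducing_subspace_def invariant_subspace_def)
  have "T' y \<in> L" if "y \<in> L" for y
    using adjoint_pair_eq[OF N'(1) adjoint_pair_restrict[OF adj N'(2,3)] subsetD[OF L'(2) that]]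
      L'(4) imageI[OF that] by (metis subsetD)
  then show ?thesis unfolding reducing_subspace_UNIV_iff[OF adj] using L'(1,3) by blast
qed

lemma contraction_on_subspace:
  "contraction_on UNIV T \<Longrightarrow> T ` N \<subseteq> N \<Longrightarrow> contraction_on N T"
  using op_subspace[of UNIV T N] by (auto simp: contraction_on_def)

lemma proj_add: "closed_csubspace M \<Longrightarrow> proj M (x + y) = proj M x + proj M y"
  by (rule proj_unique) (simp_all add: csub_add proj_in proj_cinner cinner_simps)

lemma proj_diff: "closed_csubspace M \<Longrightarrow> proj M (x - y) = proj M x - proj M y"
  by (rule proj_unique) (simp_all add: csub_diff proj_in proj_cinner cinner_simps)

lemma proj_scaleC: "closed_csubspace M \<Longrightarrow> proj M (c *\<^sub>C x) = c *\<^sub>C proj M x"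
  by (rule proj_unique) (simp_all add: csub_scaleC proj_in proj_cinner cinner_simps)

lemma proj_id: "closed_csubspace M \<Longrightarrow> x \<in> M \<Longrightarrow> proj M x = x"
  by (rule proj_unique) simp_all

lemma proj_commute:
  assumes adj: "adjoint_pair UNIV T T'" and N: "reducing_subspace UNIV T N"
  shows "proj N (T x) = T (proj N x)"
proof -
  have N': "closed_csubspace N" "T ` N \<subseteq> N" "T' ` N \<subseteq> N"
    using N by (auto simp: reducing_subspace_UNIV_iff[OF adj])
  show ?thesis
  proof (rule proj_unique[OF N'(1)])
    show "T (proj N x) \<in> N" using proj_in[OF N'(1)] N'(2) by blast
    fix y assume y: "y \<in> N"
    then have "T' y \<in> N" using N'(3) by blast
    then show "cinner y (T x - T (proj N x)) = 0"
      using proj_cinner[OF N'(1), of "T' y" x] adjoint_pairD(3)[OF adjoint_pair_sym[OF adj], of y]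
      by (simp add: cinner_diff_right)
  qed
qed

text \<open>The projection onto a reducing subspace commutes with every polynomial in the triple. It
  exhibits the Koszul complex of the restriction as a direct summand, and the inverse of \<open>q(A, B,
  P)\<close> restricts to the subspace.\<close>

lemma spectral_set_reduce:
  assumes adj: "adjoint_pair UNIV A A'" "adjoint_pair UNIV B B'" "adjoint_pair UNIV P P'"
    and red: "reducing_subspace UNIV A N" "reducing_subspace UNIV B N" "reducing_subspace UNIV P N"
    and ss: "spectral_set K UNIV A B P"
  shows "spectral_set K N A B P"
proof -
  have N: "closed_csubspace N" and inv: "A ` N \<subseteq> N" "B ` N \<subseteq> N" "P ` N \<subseteq> N"
    using red by (auto simp: reducing_subspace_def invariant_subspace_def)
  note pA = proj_commute[OF adj(1) red(1)] and pB = proj_commute[OF adj(2) red(2)]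
    and pP = proj_commute[OF adj(3) red(3)]
  have "taylor_spectrum N A B P \<subseteq> taylor_spectrum UNIV A B P"
  proof -
    have "koszul_exact N (\<lambda>x. A x - a *\<^sub>C x) (\<lambda>x. B x - b *\<^sub>C x) (\<lambda>x. P x - p *\<^sub>C x)"
      if ex: "koszul_exact UNIV (\<lambda>x. A x - a *\<^sub>C x) (\<lambda>x. B x - b *\<^sub>C x) (\<lambda>x. P x - p *\<^sub>C x)" for a b p
    proof (rule koszul_exact_summand[OF ex, where Q = "proj N"])
      show "\<And>x. x \<in> N \<Longrightarrow> A x - a *\<^sub>C x \<in> N" "\<And>x. x \<in> N \<Longrightarrow> B x - b *\<^sub>C x \<in> N"
        "\<And>x. x \<in> N \<Longrightarrow> P x - p *\<^sub>C x \<in> N"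
        using inv by (auto intro!: csub_diff[OF N] csub_scaleC[OF N])
    qed (simp_all add: proj_in[OF N] proj_id[OF N] proj_add[OF N] proj_diff[OF N] proj_scaleC[OF N]
        csub_zero[OF N] csub_add[OF N] csub_diff[OF N] pA pB pP)
    then show ?thesis by (auto simp: taylor_spectrum_def)
  qed
  then have ts: "taylor_spectrum N A B P \<subseteq> K" using ss by (auto simp: spectral_set_def)
  have pow: "proj N ((T ^^ i) x) = (T ^^ i) (proj N x)" if "\<And>x. proj N (T x) = T (proj N x)" for T i x
    by (induction i) (simp_all add: that)
  have sum: "proj N (sum g S) = (\<Sum>s\<in>S. proj N (g s))" for g :: "nat \<times> nat \<times> nat \<Rightarrow> 'a" and S
    by (induction S rule: infinite_finite_induct)
       (simp_all add: proj_id[OF N csub_zero[OF N]] proj_add[OF N])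
  have pq: "proj N (poly3_op q A B P x) = poly3_op q A B P (proj N x)" for q x
    unfolding poly3_op_def sum
    by (rule sum.cong) (auto simp: proj_scaleC[OF N] pow[of A, OF pA] pow[of B, OF pB] pow[of P, OF pP])
  have calc: "bij_betw (poly3_op q A B P) N N \<and>
      (\<forall>x\<in>N. norm (poly3_op r A B P (inv_into N (poly3_op q A B P) x))
        \<le> (SUP z\<in>K. cmod (poly3_eval r z / poly3_eval q z)) * norm x)"
    if q: "\<forall>z\<in>K. poly3_eval q z \<noteq> 0" for r q
  proof -
    let ?q = "poly3_op q A B P"
    have bij: "bij_betw ?q UNIV UNIV" and bound: "norm (poly3_op r A B P (inv_into UNIV ?q x))
        \<le> (SUP z\<in>K. cmod (poly3_eval r z / poly3_eval q z)) * norm x" for x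
      using ss q unfolding spectral_set_def by blast+
    have inj: "inj ?q" and surj: "surj ?q" using bij by (auto simp: bij_betw_def)
    have "?q x \<in> N" if "x \<in> N" for x using pq[of q x] proj_id[OF N that] proj_in[OF N] by metis
    moreover have "y \<in> ?q ` N" if y: "y \<in> N" for y
    proof -
      obtain x where "y = ?q x" using surj by blast
      then have "?q (proj N x) = y" using pq[of q x] proj_id[OF N y] by simp
      then show ?thesis using proj_in[OF N] by blast
    qed
    ultimately have img: "?q ` N = N" by blast
    have "inv_into N ?q x = inv_into UNIV ?q x" if x: "x \<in> N" for x
      using f_inv_into_f[of x ?q N] img x inv_f_f[OF inj] by metis
    then show ?thesis
      using img bound inj_on_subset[OF inj subset_UNIV] by (simp add: bij_betw_def)
  qed
  show ?thesis using ss ts calc unfolding spectral_set_def by blast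
qed

section \<open>Invariance of the isometric part\<close>

lemma op_bounded_linear: "operator_on UNIV T \<Longrightarrow> bounded_linear T"
proof -
  assume T: "operator_on UNIV T"
  obtain c where c: "\<And>x. norm (T x) \<le> c * norm x" using op_bound[OF T] by (metis UNIV_I)
  show ?thesis
    by (rule bounded_linear_intro[where K = c])
       (use c op_add[OF T] op_scaleC[OF T] in \<open>simp_all add: mult.commute flip: scaleC_of_real\<close>)
qed

lemma csub_closure_image:
  assumes M: "closed_csubspace M" and T: "operator_on UNIV T"
  shows "closed_csubspace (closure (T ` M))"
proof -
  have "0 \<in> T ` M" using op_zero[OF csub_UNIV T] csub_zero[OF M] by (metis image_eqI)
  then have z: "0 \<in> closure (T ` M)" by (rule subsetD[OF closure_subset])
  have add: "x + y \<in> closure (T ` M)" if "x \<in> closure (T ` M)" "y \<in> closure (T ` M)" for x y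
  proof -
    from that obtain X Y where X: "\<And>n. X n \<in> T ` M" "X \<longlonglongrightarrow> x" and Y: "\<And>n. Y n \<in> T ` M" "Y \<longlonglongrightarrow> y"
      unfolding closure_sequential by blast
    have "X n + Y n \<in> T ` M" for n
    proof -
      obtain u v where "X n = T u" "u \<in> M" "Y n = T v" "v \<in> M" using X(1)[of n] Y(1)[of n] by auto
      then show ?thesis
        using op_add[OF T UNIV_I UNIV_I, of u v] csub_add[OF M, of u v] by (metis image_eqI)
    qed
    then show ?thesis
      unfolding closure_sequential by (intro exI[of _ "\<lambda>n. X n + Y n"] conjI allI tendsto_add X(2) Y(2))
  qed
  have scale: "c *\<^sub>C x \<in> closure (T ` M)" if "x \<in> closure (T ` M)" for c x
  proof -
    from that obtain X where X: "\<And>n. X n \<in> T ` M" "X \<longlonglongrightarrow> x" unfolding closure_sequential by blast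
    have "c *\<^sub>C X n \<in> T ` M" for n
    proof -
      obtain u where "X n = T u" "u \<in> M" using X(1)[of n] by auto
      then show ?thesis using op_scaleC[OF T UNIV_I, of c u] csub_scaleC[OF M, of u c] by (metis
          image_eqI)
    qed
    then show ?thesis
      unfolding closure_sequential by (intro exI[of _ "\<lambda>n. c *\<^sub>C X n"] conjI allI tendsto_scaleC X(2))
  qed
  show ?thesis unfolding closed_csubspace_def using z add scale by blast
qed

lemma op_image_closure: "operator_on UNIV S \<Longrightarrow> S ` X \<subseteq> X \<Longrightarrow> S ` closure X \<subseteq> closure X"
  using closure_bounded_linear_image_subset[OF op_bounded_linear] closure_mono by blast

lemma isometry_on_closure:
  assumes P: "operator_on UNIV P" and iso: "\<And>x. x \<in> X \<Longrightarrow> norm (P x) = norm x"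
  shows "isometry_on (closure X) P"
proof -
  have "closure X \<subseteq> {x. norm (P x) = norm x}"
  proof (rule closure_minimal)
    show "closed {x. norm (P x) = norm x}"
      by (intro closed_Collect_eq continuous_on_norm continuous_on_id
          linear_continuous_on[OF op_bounded_linear[OF P]])
  qed (use iso in blast)
  then show ?thesis using P unfolding isometry_on_def clinear_on_def operator_on_def by blast
qed

text \<open>The vectors on which a contraction \<open>P\<close> is isometric are those fixed by \<open>P\<^sup>* P\<close>; if \<open>T\<close>
  commutes with \<open>P\<close> and maps \<open>M\<close> into this set, then the closure of \<open>T M\<close> is a competitor for a
  maximal isometric subspace.\<close>

lemma isometric_image:
  assumes P: "adjoint_pair UNIV P P'" and T: "operator_on UNIV T" and M: "closed_csubspace M"
    and TP: "\<And>x. T (P x) = P (T x)" and PM: "P ` M \<subseteq> M" and PP: "\<And>h. h \<in> M \<Longrightarrow> P' (P (T h)) = T h"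
  shows "closed_csubspace (closure (T ` M))" "P ` closure (T ` M) \<subseteq> closure (T ` M)"
    "isometry_on (closure (T ` M)) P"
proof -
  note opP = adjoint_pairD(1)[OF P]
  show "closed_csubspace (closure (T ` M))" by (rule csub_closure_image[OF M T])
  have "P (T h) \<in> T ` M" if "h \<in> M" for h using PM that TP[of h, symmetric] by blast
  then show "P ` closure (T ` M) \<subseteq> closure (T ` M)" by (intro op_image_closure[OF opP]) blast
  show "isometry_on (closure (T ` M)) P"
  proof (rule isometry_on_closure[OF opP])
    fix x assume "x \<in> T ` M"
    then have "P' (P x) = x" using PP by blast
    then have "(norm (P x))\<^sup>2 = (norm x)\<^sup>2"
      using adjoint_pair_norm(1)[OF P UNIV_I, of x] by (simp add: cinner_self)
    then show "norm (P x) = norm x" by (simp add: power2_eq_iff_nonneg)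
  qed
qed

text \<open>An operator commuting with \<open>P\<close> and \<open>P\<^sup>*\<close> commutes with \<open>P\<^sup>* P\<close>, so it maps \<open>H\<close> to vectors
  fixed by \<open>P\<^sup>* P\<close>.\<close>

lemma double_commutant_invariant:
  assumes P: "adjoint_pair UNIV P P'" and T: "operator_on UNIV T"
    and TP: "\<And>x. T (P x) = P (T x)" and TP': "\<And>x. T (P' x) = P' (T x)"
    and L: "largest (\<lambda>M. reducing_subspace UNIV P M \<and> isometry_on M P) H"
    and PP: "\<And>h. h \<in> H \<Longrightarrow> P' (P h) = h"
  shows "T ` H \<subseteq> H"
proof -
  have H: "closed_csubspace H" "P ` H \<subseteq> H" "P' ` H \<subseteq> H"
    using L by (auto simp: largest_def reducing_subspace_UNIV_iff[OF P])
  have fixT: "P' (P (T h)) = T h" if "h \<in> H" for h using PP[OF that] TP TP' by metis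
  have "P' (T h) \<in> T ` H" if "h \<in> H" for h using H(3) that TP'[of h, symmetric] by blast
  then have "P' ` closure (T ` H) \<subseteq> closure (T ` H)"
    by (intro op_image_closure[OF adjoint_pairD(2)[OF P]]) blast
  then have "reducing_subspace UNIV P (closure (T ` H)) \<and> isometry_on (closure (T ` H)) P"
    using isometric_image[OF P T H(1) TP H(2) fixT] by (simp add: reducing_subspace_UNIV_iff[OF P])
  then have "closure (T ` H) \<subseteq> H" using L unfolding largest_def by blast
  then show ?thesis by (rule order_trans[OF closure_subset])
qed

lemma adjoint_commute:
  assumes S: "adjoint_pair UNIV S S'" and T: "adjoint_pair UNIV T T'"
    and ST: "\<And>x. S (T x) = T (S x)"
  shows "S' (T' x) = T' (S' x)"
proof (rule cinner_eqI)
  fix y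
  show "cinner y (S' (T' x)) = cinner y (T' (S' x))"
    using adjoint_pairD(3)[OF S UNIV_I UNIV_I] adjoint_pairD(3)[OF T UNIV_I UNIV_I] ST by metis
qed

section \<open>The decomposition\<close>

theorem theorem5p1:
  fixes A B P :: "'a::chilbert_space \<Rightarrow> 'a" and H1 H2 :: "'a set"
  assumes "E_contraction UNIV A B P" and "cnu UNIV P"
    and "largest (\<lambda>M. reducing_subspace UNIV P M \<and> isometry_on M P) H1"
    and "H2 = UNIV \<ominus> H1"
    and "(commute_on UNIV (adjoint_on UNIV A) P \<and> commute_on UNIV (adjoint_on UNIV B) P) \<or>
         largest (\<lambda>M. invariant_subspace UNIV P M \<and> isometry_on M P) H1"
  shows "(reducing_subspace UNIV A H1 \<and> reducing_subspace UNIV B H1 \<and>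
          reducing_subspace UNIV A H2 \<and> reducing_subspace UNIV B H2) \<and>
         (E_isometry H1 A B P \<and> cnu H1 P) \<and>
         (E_contraction H2 A B P \<and> cni H2 P)"
proof -
  note E = assms(1) and cnu = assms(2) and L = assms(3) and H2 = assms(4)
  have opA: "operator_on UNIV A" and opB: "operator_on UNIV B" and opP: "operator_on UNIV P"
    and AB: "\<And>x. A (B x) = B (A x)" and AP: "\<And>x. A (P x) = P (A x)" and BP: "\<And>x. B (P x) = P (B x)"
    using E by (auto simp: E_contraction_def commuting_triple_def commute_on_def)
  have ss: "spectral_set (closure tetrablock) UNIV A B P" using E by (simp add: E_contraction_def)
  define A' where "A' = adjoint_on UNIV A"
  define B' where "B' = adjoint_on UNIV B"
  define P' where "P' = adjoint_on UNIV P"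
  have adjA: "adjoint_pair UNIV A A'" and adjB: "adjoint_pair UNIV B B'" and adjP: "adjoint_pair UNIV P P'"
    unfolding A'_def B'_def P'_def by (rule adjoint_pair_adjoint_on[OF csub_UNIV], fact)+
  have contr: "contraction_on UNIV P" using cnu by (simp add: cnu_def)
  then have nP: "norm (P x) \<le> norm x" for x by (simp add: contraction_on_def)
  have redP: "reducing_subspace UNIV P H1" and isoP: "isometry_on H1 P"
    using L by (auto simp: largest_def)
  have H1: "closed_csubspace H1" "P ` H1 \<subseteq> H1" "P' ` H1 \<subseteq> H1"
    using redP by (auto simp: reducing_subspace_UNIV_iff[OF adjP])
  have iso: "norm (P h) = norm h" if "h \<in> H1" for h using isoP that by (simp add: isometry_on_def)
  have P'P: "P' (P h) = h" if "h \<in> H1" for h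
    by (rule contraction_isometric_vector[OF adjP nP UNIV_I iso[OF that]])
  have N: "norm (A h - u *\<^sub>C P h) \<le> norm (h - u *\<^sub>C B h)" "norm (B h - u *\<^sub>C P h) \<le> norm (h - u *\<^sub>C A h)"
    if "cmod u = 1" for h u
    by (rule norm_le_on_closed_disc, erule E_contraction_norm_le_disc[OF E], simp add: that)+
  have FA: "cinner (A h) y = cinner (P h) (B y)" "cinner (A y) h = cinner (P y) (B h)" if "h \<in> H1" for h y
    by (rule fundamental_equations[OF opA opB adjP]; simp add: N nP iso that)+
  have FB: "cinner (B h) y = cinner (P h) (A y)" "cinner (B y) h = cinner (P y) (A h)" if "h \<in> H1" for h y
    by (rule fundamental_equations[OF opB opA adjP]; simp add: N nP iso that)+
  have A_eq: "A h = B' (P h)" and B_eq: "B h = A' (P h)" and A'_eq: "A' h = P' (B h)" and B'_eq: "B' h = P' (A h)"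
    if h: "h \<in> H1" for h
  proof -
    note c = cinner_commute
    show "A' h = P' (B h)"
      by (rule cinner_eqI) (use FA(2)[OF h] adjoint_pairD(3)[OF adjA] adjoint_pairD(3)[OF adjP] in simp)
    show "B' h = P' (A h)"
      by (rule cinner_eqI) (use FB(2)[OF h] adjoint_pairD(3)[OF adjB] adjoint_pairD(3)[OF adjP] in simp)
    have "cinner (A h) y = cinner (B' (P h)) y" for y
      using FA(1)[OF h, of y] adjoint_pairD(3)[OF adjoint_pair_sym[OF adjB]] by simp
    then show "A h = B' (P h)" using c cinner_eqI by metis
    have "cinner (B h) y = cinner (A' (P h)) y" for y
      using FB(1)[OF h, of y] adjoint_pairD(3)[OF adjoint_pair_sym[OF adjA]] by simp
    then show "B h = A' (P h)" using c cinner_eqI by metis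
  qed
  have inv: "A ` H1 \<subseteq> H1 \<and> A' ` H1 \<subseteq> H1 \<and> B ` H1 \<subseteq> H1 \<and> B' ` H1 \<subseteq> H1"
    using assms(5)
  proof
    assume "commute_on UNIV (adjoint_on UNIV A) P \<and> commute_on UNIV (adjoint_on UNIV B) P"
    then have A'P: "A' (P x) = P (A' x)" and B'P: "B' (P x) = P (B' x)" for x
      by (auto simp: commute_on_def A'_def B'_def)
    note inv = double_commutant_invariant[OF adjP _ _ _ L P'P]
    have "A ` H1 \<subseteq> H1"
      by (rule inv[OF opA AP]) (use adjoint_commute[OF adjoint_pair_sym[OF adjA] adjP A'P] in simp_all)
    moreover have "B ` H1 \<subseteq> H1"
      by (rule inv[OF opB BP]) (use adjoint_commute[OF adjoint_pair_sym[OF adjB] adjP B'P] in simp_all)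
    moreover have "A' ` H1 \<subseteq> H1"
      by (rule inv[OF adjoint_pairD(2)[OF adjA] A'P]) (use adjoint_commute[OF adjA adjP AP] in simp_all)
    moreover have "B' ` H1 \<subseteq> H1"
      by (rule inv[OF adjoint_pairD(2)[OF adjB] B'P]) (use adjoint_commute[OF adjB adjP BP] in simp_all)
    ultimately show ?thesis by blast
  next
    assume L': "largest (\<lambda>M. invariant_subspace UNIV P M \<and> isometry_on M P) H1"
    have inv: "T ` H1 \<subseteq> H1" if T: "operator_on UNIV T" "\<And>x. T (P x) = P (T x)"
      "\<And>h. h \<in> H1 \<Longrightarrow> P' (P (T h)) = T h" for T
    proof -
      have "closure (T ` H1) \<subseteq> H1"
        using L' isometric_image[OF adjP T(1) H1(1) T(2) H1(2) T(3)]
        unfolding largest_def invariant_subspace_def by blast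
      then show ?thesis by (rule order_trans[OF closure_subset])
    qed
    have PH: "P h \<in> H1" "P' h \<in> H1" if "h \<in> H1" for h using H1 that by auto
    \<comment> \<open>On \<open>H1\<close>: \<open>P\<^sup>* P A h = P\<^sup>* A (P h) = B\<^sup>* (P h) = A h\<close>, since \<open>P\<^sup>* A = B\<^sup>*\<close> on \<open>P h \<in> H1\<close>.\<close>
    have A: "A ` H1 \<subseteq> H1"
      by (rule inv[OF opA AP]) (metis AP A_eq B'_eq PH(1))
    have B: "B ` H1 \<subseteq> H1"
      by (rule inv[OF opB BP]) (metis BP B_eq A'_eq PH(1))
    have "A' ` H1 \<subseteq> H1" "B' ` H1 \<subseteq> H1"
      using A B PH(2) by (auto simp: A'_eq B'_eq)
    then show ?thesis using A B by blast
  qed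
  have redA: "reducing_subspace UNIV A H1" and redB: "reducing_subspace UNIV B H1"
    using inv H1(1) by (simp_all add: reducing_subspace_UNIV_iff[OF adjA] reducing_subspace_UNIV_iff[OF adjB])
  note redA2 = reducing_subspace_orth[OF adjA redA, folded H2]
    and redB2 = reducing_subspace_orth[OF adjB redB, folded H2]
    and redP2 = reducing_subspace_orth[OF adjP redP, folded H2]
  have inv2: "A ` H2 \<subseteq> H2" "B ` H2 \<subseteq> H2" "P ` H2 \<subseteq> H2"
    using redA2 redB2 redP2 by (auto simp: reducing_subspace_def invariant_subspace_def)
  have "isometric_triple H1 A B P A' B' P'"
  proof (unfold_locales)
    show "adjoint_pair H1 A A'" "adjoint_pair H1 B B'" "adjoint_pair H1 P P'"
      using inv H1 by (auto intro!: adjoint_pair_restrict adjA adjB adjP)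
    show "norm (A x) \<le> norm x" "norm (B x) \<le> norm x" for x
      using E_contraction_norm_le_disc[OF E, of 0 x] by (simp_all add: scaleC_zero_left)
  qed (simp_all add: H1 P'P AB AP BP A_eq[symmetric] B_eq[symmetric])
  then have iso1: "E_isometry H1 A B P" by (rule isometric_triple.E_isometry)
  have cnu1: "cnu H1 P"
    using cnu contraction_on_subspace[OF contr H1(2)] reducing_subspace_trans[OF adjP redP]
    unfolding cnu_def by blast
  have "commuting_triple H2 A B P"
    using op_subspace[OF opA _ inv2(1)] op_subspace[OF opB _ inv2(2)] op_subspace[OF opP _ inv2(3)] AB AP BP
    by (simp add: commuting_triple_def commute_on_def)
  then have contr2: "E_contraction H2 A B P"
    using spectral_set_reduce[OF adjA adjB adjP redA2 redB2 redP2 ss] by (simp add: E_contraction_def)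
  have "N = {0}" if N: "reducing_subspace H2 P N" "isometry_on N P" for N
  proof -
    have "N \<subseteq> H1" using reducing_subspace_trans[OF adjP redP2 N(1)] N(2) L unfolding largest_def by blast
    moreover have "N \<subseteq> H2" "0 \<in> N"
      using N(1) csub_zero by (auto simp: reducing_subspace_def invariant_subspace_def)
    moreover have "x = 0" if "x \<in> H1" "x \<in> H2" for x
      using that orth_cinner[of x H1 x] by (simp add: H2 cinner_self_eq_0)
    ultimately show ?thesis by blast
  qed
  then have cni2: "cni H2 P"
    unfolding cni_def using contraction_on_subspace[OF contr inv2(3)] by blast
  show ?thesis using redA redB redA2 redB2 iso1 cnu1 contr2 cni2 by blast
qed

end
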